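(* The BSP scheduling problem can be solved in time polynomial in $n$ for chain DAGs and for connected chain DAGs.
   Context: A DAG $G=(V,E)$ with $n=|V|$ nodes is given as input by listing its nodes and edges; $[k]=\{1,\dots,k\}$. The number of processors $P\in\mathbb{N}$, the per-unit communication cost $g\in\mathbb{N}$ and the latency $L\in\mathbb{N}$ are fixed constants, not part of the input. A BSP schedule with $S$ supersteps consists of $\pi:V\to[P]$, $\tau:V\to[S]$ and $\Gamma\subseteq V\times[P]\times[P]\times[S]$, where $(v,p_1,p_2,s)\in\Gamma$ means the output of $v$ is sent from $p_1$ to $p_2$ in the communication phase of superstep $s$. It is valid if (i) for every $(u,v)\in E$: if $\pi(u)=\pi(v)$ then $\tau(u)\le\tau(v)$, and if $\pi(u)\neq\pi(v)$ then $(u,\pi(u),\pi(v),s)\in\Gamma$ for some $s<\tau(v)$; (ii) every $(v,p_1,p_2,s)\in\Gamma$ has $p_1=\pi(v)$ and $\tau(v)\le s$. Costs: $C_{work}^{(s)}=\max_{p\in[P]}|\{v:\pi(v)=p,\tau(v)=s\}|$; $C_{sent}^{(s,p)}=|\{(v,p_1,p_2,s')\in\Gamma:p_1=p,s'=s\}|$, $C_{rec}^{(s,p)}=|\{(v,p_1,p_2,s')\in\Gamma:p_2=p,s'=s\}|$, $C_{comm}^{(s)}=\max_p\max(C_{sent}^{(s,p)},C_{rec}^{(s,p)})$; total cost $\sum_{s\in[S]}(C_{work}^{(s)}+g\,C_{comm}^{(s)}+L)$. The BSP scheduling problem asks for a valid schedule (with freely chosen $S$) of minimum total cost. A chain DAG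 is a DAG in which every node has indegree at most $1$ and outdegree at most $1$. A connected chain DAG is obtained from a chain DAG by adding one new source node $v_0$ and an edge from $v_0$ to the first node of every chain. *)

theory Defs
  imports Main "HOL-Computational_Algebra.Polynomial"
begin

section \<open>DAGs\<close>

definition dag :: "'v set \<Rightarrow> ('v \<times> 'v) set \<Rightarrow> bool" where
  "dag V E \<longleftrightarrow> finite V \<and> E \<subseteq> V \<times> V \<and> acyclic E"

definition chain_dag :: "'v set \<Rightarrow> ('v \<times> 'v) set \<Rightarrow> bool" where
  "chain_dag V E \<longleftrightarrow> dag V E \<and>
     (\<forall>v\<in>V. card {u. (u, v) \<in> E} \<le> 1 \<and> card {w. (v, w) \<in> E} \<le> 1)"

text \<open>The first nodes of the chains of a chain DAG are exactly its sources.\<close>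

definition connected_chain_dag :: "'v set \<Rightarrow> ('v \<times> 'v) set \<Rightarrow> bool" where
  "connected_chain_dag V E \<longleftrightarrow>
     (\<exists>V' E' v0. chain_dag V' E' \<and> v0 \<notin> V' \<and> V = insert v0 V' \<and>
        E = E' \<union> {(v0, v) | v. v \<in> V' \<and> (\<forall>u. (u, v) \<notin> E')})"


section \<open>BSP schedules\<close>

record 'v schedule =
  supersteps :: nat
  proc :: "'v \<Rightarrow> nat"
  step :: "'v \<Rightarrow> nat"
  comm :: "('v \<times> nat \<times> nat \<times> nat) set"

text \<open>The functions \<^term>\<open>proc X\<close> and \<^term>\<open>step X\<close> matter only on the node set.\<close>

definition valid_schedule ::
    "nat \<Rightarrow> 'v set \<Rightarrow> ('v \<times> 'v) set \<Rightarrow> 'v schedule \<Rightarrow> bool" where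
  "valid_schedule P V E X \<longleftrightarrow>
     (\<forall>v\<in>V. proc X v \<in> {1..P} \<and> step X v \<in> {1..supersteps X}) \<and>
     comm X \<subseteq> V \<times> {1..P} \<times> {1..P} \<times> {1..supersteps X} \<and>
     (\<forall>(u, v)\<in>E.
        (proc X u = proc X v \<longrightarrow> step X u \<le> step X v) \<and>
        (proc X u \<noteq> proc X v \<longrightarrow>
          (\<exists>s. s < step X v \<and> (u, proc X u, proc X v, s) \<in> comm X))) \<and>
     (\<forall>(v, p1, p2, s)\<in>comm X. p1 = proc X v \<and> step X v \<le> s)"

definition work_cost :: "nat \<Rightarrow> 'v set \<Rightarrow> 'v schedule \<Rightarrow> nat \<Rightarrow> nat" where
  "work_cost P V X s = (MAX p\<in>{1..P}. card {v \<in> V. proc X v = p \<and> step X v = s})"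

definition sent_cost :: "'v schedule \<Rightarrow> nat \<Rightarrow> nat \<Rightarrow> nat" where
  "sent_cost X s p = card {(v, p1, p2, s') \<in> comm X. p1 = p \<and> s' = s}"

definition rec_cost :: "'v schedule \<Rightarrow> nat \<Rightarrow> nat \<Rightarrow> nat" where
  "rec_cost X s p = card {(v, p1, p2, s') \<in> comm X. p2 = p \<and> s' = s}"

definition comm_cost :: "nat \<Rightarrow> 'v schedule \<Rightarrow> nat \<Rightarrow> nat" where
  "comm_cost P X s = (MAX p\<in>{1..P}. max (sent_cost X s p) (rec_cost X s p))"

definition total_cost :: "nat \<Rightarrow> nat \<Rightarrow> nat \<Rightarrow> 'v set \<Rightarrow> 'v schedule \<Rightarrow> nat" where
  "total_cost P g L V X =
     (\<Sum>s\<in>{1..supersteps X}. work_cost P V X s + g * comm_cost P X s + L)"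

definition optimal_schedule ::
    "nat \<Rightarrow> nat \<Rightarrow> nat \<Rightarrow> 'v set \<Rightarrow> ('v \<times> 'v) set \<Rightarrow> 'v schedule \<Rightarrow> bool" where
  "optimal_schedule P g L V E X \<longleftrightarrow> valid_schedule P V E X \<and>
     (\<forall>Y. valid_schedule P V E Y \<longrightarrow> total_cost P g L V X \<le> total_cost P g L V Y)"


section \<open>Model of computation\<close>

text \<open>
  A random access machine, presented as a while language. The memory consists of named
  arrays of natural numbers (a scalar is cell 0 of an array); every program mentions only
  finitely many names. The arithmetic operations are addition and truncated subtraction.
  Every operation, memory access and test is charged one unit. As there is no
  multiplication, the bit length of the numbers in memory grows by at most a constant per
  step, so this measure agrees with Turing machine time up to a polynomial.
\<close>

type_synonym vname = string
type_synonym state = "vname \<Rightarrow> nat \<Rightarrow> nat"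

datatype aexp =
    Const nat
  | Cell vname aexp
  | Plus aexp aexp
  | Minus aexp aexp

datatype bexp =
    Less aexp aexp
  | Equal aexp aexp
  | Not bexp
  | And bexp bexp

datatype com =
    Skip
  | Assign vname aexp aexp
  | Seq com com
  | If bexp com com
  | While bexp com

fun aval :: "aexp \<Rightarrow> state \<Rightarrow> nat" where
  "aval (Const k) \<sigma> = k"
| "aval (Cell x i) \<sigma> = \<sigma> x (aval i \<sigma>)"
| "aval (Plus a b) \<sigma> = aval a \<sigma> + aval b \<sigma>"
| "aval (Minus a b) \<sigma> = aval a \<sigma> - aval b \<sigma>"

fun acost :: "aexp \<Rightarrow> nat" where
  "acost (Const k) = 1"
| "acost (Cell x i) = 1 + acost i"
| "acost (Plus a b) = 1 + acost a + acost b"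
| "acost (Minus a b) = 1 + acost a + acost b"

fun bval :: "bexp \<Rightarrow> state \<Rightarrow> bool" where
  "bval (Less a b) \<sigma> \<longleftrightarrow> aval a \<sigma> < aval b \<sigma>"
| "bval (Equal a b) \<sigma> \<longleftrightarrow> aval a \<sigma> = aval b \<sigma>"
| "bval (Not b) \<sigma> \<longleftrightarrow> \<not> bval b \<sigma>"
| "bval (And b c) \<sigma> \<longleftrightarrow> bval b \<sigma> \<and> bval c \<sigma>"

fun bcost :: "bexp \<Rightarrow> nat" where
  "bcost (Less a b) = 1 + acost a + acost b"
| "bcost (Equal a b) = 1 + acost a + acost b"
| "bcost (Not b) = 1 + bcost b"
| "bcost (And b c) = 1 + bcost b + bcost c"

text \<open>
  \<^term>\<open>Assign x i a\<close> stores the value of \<^term>\<open>a\<close> in the cell of array \<^term>\<open>x\<close> whose index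
  is the value of \<^term>\<open>i\<close>. The proposition \<open>exec c \<sigma> t \<sigma>'\<close> says that \<open>c\<close>, started in \<open>\<sigma>\<close>,
  halts in \<open>\<sigma>'\<close> after \<open>t\<close> units of time; \<open>t\<close> and \<open>\<sigma>'\<close> are determined by \<open>c\<close> and \<open>\<sigma>\<close>.
\<close>

inductive exec :: "com \<Rightarrow> state \<Rightarrow> nat \<Rightarrow> state \<Rightarrow> bool" where
  Skip: "exec Skip \<sigma> 1 \<sigma>"
| Assign: "exec (Assign x i a) \<sigma> (1 + acost i + acost a)
             (\<sigma>(x := (\<sigma> x)(aval i \<sigma> := aval a \<sigma>)))"
| Seq: "exec c \<sigma> t \<sigma>' \<Longrightarrow> exec d \<sigma>' t' \<sigma>'' \<Longrightarrow> exec (Seq c d) \<sigma> (t + t') \<sigma>''"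
| IfTrue: "bval b \<sigma> \<Longrightarrow> exec c \<sigma> t \<sigma>' \<Longrightarrow> exec (If b c d) \<sigma> (1 + bcost b + t) \<sigma>'"
| IfFalse: "\<not> bval b \<sigma> \<Longrightarrow> exec d \<sigma> t \<sigma>' \<Longrightarrow> exec (If b c d) \<sigma> (1 + bcost b + t) \<sigma>'"
| WhileFalse: "\<not> bval b \<sigma> \<Longrightarrow> exec (While b c) \<sigma> (1 + bcost b) \<sigma>"
| WhileTrue: "bval b \<sigma> \<Longrightarrow> exec c \<sigma> t \<sigma>' \<Longrightarrow> exec (While b c) \<sigma>' t' \<sigma>'' \<Longrightarrow>
                exec (While b c) \<sigma> (1 + bcost b + t + t') \<sigma>''"


section \<open>Polynomial-time solvability of BSP scheduling\<close>

text \<open>Cells not mentioned by the input, and cells past the end of the lists, are 0.\<close>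

definition list_cells :: "nat list \<Rightarrow> nat \<Rightarrow> nat" where
  "list_cells xs i = (if i < length xs then xs ! i else 0)"

definition input_state :: "nat list \<Rightarrow> (nat \<times> nat) list \<Rightarrow> state" where
  "input_state vs es = (\<lambda>_ _. 0)
     (''n'' := list_cells [length vs],
      ''node'' := list_cells vs,
      ''m'' := list_cells [length es],
      ''src'' := list_cells (map fst es),
      ''dst'' := list_cells (map snd es))"

text \<open>
  The arrays \<open>proc\<close> and \<open>step\<close> of the output are indexed by the names of the nodes. The
  communication set is listed in four parallel arrays, in any order.
\<close>

definition output_schedule :: "state \<Rightarrow> nat schedule" where
  "output_schedule \<sigma> =
     \<lparr>supersteps = \<sigma> ''S'' 0,
      proc = \<sigma> ''proc'',
      step = \<sigma> ''step'',
      comm = (\<lambda>i. (\<sigma> ''cnode'' i, \<sigma> ''cfrom'' i, \<sigma> ''cto'' i, \<sigma> ''cstep'' i)) ` {..<\<sigma> ''k'' 0}\<rparr>"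

text \<open>
  \<open>\<C>\<close> is a class of DAGs, whose nodes are named by arbitrary natural numbers. The program
  may depend on \<open>P\<close>, \<open>g\<close> and \<open>L\<close>, which are not part of the input.
\<close>

definition bsp_poly_time_solvable ::
    "nat \<Rightarrow> nat \<Rightarrow> nat \<Rightarrow> (nat set \<Rightarrow> (nat \<times> nat) set \<Rightarrow> bool) \<Rightarrow> bool" where
  "bsp_poly_time_solvable P g L \<C> \<longleftrightarrow>
     (\<exists>c. \<exists>q :: nat poly. \<forall>vs es. distinct vs \<and> distinct es \<and> \<C> (set vs) (set es) \<longrightarrow>
        (\<exists>t \<sigma>. exec c (input_state vs es) t \<sigma> \<and> t \<le> poly q (length vs) \<and>
           optimal_schedule P g L (set vs) (set es) (output_schedule \<sigma>)))"

end

theory Submission imports Defs "HOL-Library.FuncSet" begin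

text \<open>
  By McNaughton's wrap-around rule, a schedule whose work costs add up to \<open>W\<close> can be replaced by
  one with at most \<open>P + 1\<close> supersteps, the same total work cost and at most \<open>2 P\<close> transmissions.
  Since a superstep without transmissions can be merged with the next one, a schedule with more
  than \<open>2 P + 1\<close> supersteps left is at least as expensive, so \<open>2 P + 1\<close> supersteps suffice.

  With a constant number of supersteps, the cost of a schedule depends only on how often each of
  constantly many options (processor, superstep, reception of the output of the predecessor) is
  chosen. If the nodes are listed chain by chain, whether an option is allowed depends only on
  the previous option. Hence it suffices to search the polynomially many pairs of a vector of
  counts and a last option. For connected chains, the first option fixes the place of the source
  and the supersteps in which its output is sent to the other processors.
\<close>

section \<open>Execution times of programs\<close>

text \<open>Why the wrap-around schedule is cheap enough: related nodes that share a superstep share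
  a processor, so in any schedule the work costs add up to at least the length of every chain, and
  \<open>P\<close> times their sum is at least the number of nodes. With that sum as the number of
  slots per processor a chain meets at most one of the \<open>P - 1\<close> inner borders, so at
  most \<open>P - 1\<close> chain edges change the processor. A source precedes everything and
  occupies one unit of work alone; it adds one superstep and at most \<open>P\<close> transmissions.

  The obstacle to counting options is that \<open>comm\<close> is a set: a single transmission
  serves all successors on a processor. Inside a chain an output has one reader, so its transmission
  can be charged to the option of the reader. The output of the source may have many readers, so its
  transmissions are charged once, to the first option.

  Words and schedules do not correspond exactly: schedules may send more than is read, and words may
  repeat a transmission. Neither translation raises the cost, and this is enough for
  optimality.\<close>

definition trip :: "com \<Rightarrow> state \<Rightarrow> nat \<Rightarrow> (state \<Rightarrow> bool) \<Rightarrow> bool" where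
  "trip c \<sigma> k Q \<longleftrightarrow> (\<exists>t \<sigma>'. exec c \<sigma> t \<sigma>' \<and> t \<le> k \<and> Q \<sigma>')"

lemma trip_weaken:
  "trip c \<sigma> k Q \<Longrightarrow> k \<le> k' \<Longrightarrow> (\<And>\<sigma>'. Q \<sigma>' \<Longrightarrow> Q' \<sigma>') \<Longrightarrow> trip c \<sigma> k' Q'"
  unfolding trip_def by (meson le_trans)

lemma trip_Seq:
  assumes "trip c \<sigma> k Q" and "\<And>\<sigma>'. Q \<sigma>' \<Longrightarrow> trip d \<sigma>' k' Q'"
  shows "trip (Seq c d) \<sigma> (k + k') Q'"
  using assms unfolding trip_def by (meson exec.Seq add_mono)

lemma trip_If:
  assumes "bval b \<sigma> \<Longrightarrow> trip c \<sigma> k Q" and "\<not> bval b \<sigma> \<Longrightarrow> trip d \<sigma> k Q"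
  shows "trip (If b c d) \<sigma> (1 + bcost b + k) Q"
  using assms unfolding trip_def by (cases "bval b \<sigma>") (meson exec.IfTrue exec.IfFalse add_left_mono)+

lemma trip_While:
  assumes "I \<sigma>" and "\<mu> \<sigma> \<le> N"
    and step: "\<And>\<sigma>. I \<sigma> \<Longrightarrow> bval b \<sigma> \<Longrightarrow> trip c \<sigma> k (\<lambda>\<sigma>'. I \<sigma>' \<and> \<mu> \<sigma>' < (\<mu> \<sigma> :: nat))"
  shows "trip (While b c) \<sigma> (N * (1 + bcost b + k) + (1 + bcost b)) (\<lambda>\<sigma>'. I \<sigma>' \<and> \<not> bval b \<sigma>')"
  using assms(1,2)
proof (induction N arbitrary: \<sigma>)
  case 0
  \<comment> \<open>A further iteration would push the measure below 0.\<close>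
  then have "\<not> bval b \<sigma>"
    using step[of \<sigma>] by (auto simp: trip_def)
  then show ?case using 0 exec.WhileFalse[of b \<sigma> c] by (auto simp: trip_def)
next
  case (Suc N)
  show ?case
  proof (cases "bval b \<sigma>")
    case True
    then obtain t \<sigma>' where t: "exec c \<sigma> t \<sigma>'" "t \<le> k" "I \<sigma>'" "\<mu> \<sigma>' < \<mu> \<sigma>"
      using step[OF Suc.prems(1)] by (auto simp: trip_def)
    then have "\<mu> \<sigma>' \<le> N" using Suc.prems by simp
    then obtain t' \<sigma>'' where t': "exec (While b c) \<sigma>' t' \<sigma>''"
      "t' \<le> N * (1 + bcost b + k) + (1 + bcost b)" "I \<sigma>''" "\<not> bval b \<sigma>''"
      using Suc.IH[of \<sigma>'] t by (auto simp: trip_def)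
    show ?thesis
      unfolding trip_def
      using exec.WhileTrue[OF True t(1) t'(1)] t(2) t'(2-)
      by (intro exI[of _ "1 + bcost b + t + t'"] exI[of _ \<sigma>'']) auto
  next
    case False
    then show ?thesis
      unfolding trip_def using Suc.prems exec.WhileFalse[of b \<sigma> c]
      by (intro exI[of _ "1 + bcost b"] exI[of _ \<sigma>]) auto
  qed
qed

text \<open>On a While loop \<open>run\<close> is junk; it is the semantics of loop-free commands only.\<close>

fun run :: "com \<Rightarrow> state \<Rightarrow> state" where
  "run Skip \<sigma> = \<sigma>"
| "run (Assign x i a) \<sigma> = \<sigma>(x := (\<sigma> x)(aval i \<sigma> := aval a \<sigma>))"
| "run (Seq c d) \<sigma> = run d (run c \<sigma>)"
| "run (If b c d) \<sigma> = (if bval b \<sigma> then run c \<sigma> else run d \<sigma>)"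
| "run (While b c) \<sigma> = \<sigma>"

fun loop_free :: "com \<Rightarrow> bool" where
  "loop_free Skip = True"
| "loop_free (Assign x i a) = True"
| "loop_free (Seq c d) = (loop_free c \<and> loop_free d)"
| "loop_free (If b c d) = (loop_free c \<and> loop_free d)"
| "loop_free (While b c) = False"

text \<open>Only an upper bound is wanted, so the two branches of an \<open>If\<close> are simply
  added. Like \<open>run\<close>, it is meaningful for loop-free commands only.\<close>

fun max_time :: "com \<Rightarrow> nat" where
  "max_time Skip = 1"
| "max_time (Assign x i a) = 1 + acost i + acost a"
| "max_time (Seq c d) = max_time c + max_time d"
| "max_time (If b c d) = 1 + bcost b + (max_time c + max_time d)"
| "max_time (While b c) = 0"

lemma exec_run: "loop_free c \<Longrightarrow> \<exists>t. exec c \<sigma> t (run c \<sigma>) \<and> t \<le> max_time c"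
proof (induction c arbitrary: \<sigma>)
  case (Seq c d)
  then show ?case by simp (meson exec.Seq add_mono)
next
  case (If b c d)
  show ?case
  proof (cases "bval b \<sigma>")
    case True
    obtain t where "exec c \<sigma> t (run c \<sigma>)" "t \<le> max_time c" using If by auto
    with True show ?thesis
      by (intro exI[of _ "1 + bcost b + t"]) (auto intro: exec.IfTrue simp del: One_nat_def)
  next
    case False
    obtain t where "exec d \<sigma> t (run d \<sigma>)" "t \<le> max_time d" using If by auto
    with False show ?thesis
      by (intro exI[of _ "1 + bcost b + t"]) (auto intro: exec.IfFalse simp del: One_nat_def)
  qed
qed (auto intro: exec.Skip exec.Assign simp del: One_nat_def)

lemma trip_run: "loop_free c \<Longrightarrow> Q (run c \<sigma>) \<Longrightarrow> trip c \<sigma> (max_time c) Q"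
  using exec_run unfolding trip_def by blast

text \<open>For a loop-free body one iteration is symbolic execution by \<open>run\<close>, so only
  the invariant and the measure remain to be checked.\<close>

lemma trip_While_run:
  assumes "loop_free c" "I \<sigma>" "\<mu> \<sigma> \<le> N"
    and "\<And>\<sigma>. I \<sigma> \<Longrightarrow> bval b \<sigma> \<Longrightarrow> I (run c \<sigma>) \<and> \<mu> (run c \<sigma>) < (\<mu> \<sigma> :: nat)"
  shows "trip (While b c) \<sigma> (N * (1 + bcost b + max_time c) + (1 + bcost b)) (\<lambda>\<sigma>'. I \<sigma>' \<and> \<not> bval b \<sigma>')"
  using assms by (intro trip_While[where \<mu> = \<mu>]) (auto intro: trip_run)

fun seqs :: "com list \<Rightarrow> com" where
  "seqs [] = Skip"
| "seqs (c # cs) = Seq c (seqs cs)"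

lemma loop_free_seqs [simp]: "loop_free (seqs cs) \<longleftrightarrow> (\<forall>c\<in>set cs. loop_free c)"
  by (induction cs) auto

lemma run_seqs_append [simp]: "run (seqs (cs @ ds)) \<sigma> = run (seqs ds) (run (seqs cs) \<sigma>)"
  by (induction cs arbitrary: \<sigma>) auto

text \<open>Serves loops that are unrolled because their length is a constant; the index of
  \<open>I\<close> counts the commands already executed.\<close>

lemma trip_seqs:
  assumes "I 0 \<sigma>"
    and "\<And>i \<sigma>. i < length cs \<Longrightarrow> I i \<sigma> \<Longrightarrow> trip (cs ! i) \<sigma> k (I (Suc i))"
  shows "trip (seqs cs) \<sigma> (length cs * k + 1) (I (length cs))"
  using assms
proof (induction cs arbitrary: I \<sigma>)
  case Nil
  then show ?case by (auto simp: trip_def intro!: exI exec.Skip)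
next
  case (Cons c cs)
  have "trip c \<sigma> k (I (Suc 0))" using Cons.prems(1) Cons.prems(2)[of 0] by auto
  moreover have "trip (seqs cs) \<sigma>' (length cs * k + 1) (I (length (c # cs)))" if "I (Suc 0) \<sigma>'" for \<sigma>'
    using Cons.IH[of "\<lambda>i. I (Suc i)" \<sigma>'] that Cons.prems(2)[of "Suc _"] by fastforce
  ultimately have "trip (Seq c (seqs cs)) \<sigma> (k + (length cs * k + 1)) (I (length (c # cs)))"
    by (rule trip_Seq)
  then show ?case by (simp add: algebra_simps)
qed

fun conj_list :: "bexp list \<Rightarrow> bexp" where
  "conj_list [] = Equal (Const 0) (Const 0)"
| "conj_list (b # bs) = And b (conj_list bs)"

lemma bval_conj_list [simp]: "bval (conj_list bs) \<sigma> \<longleftrightarrow> (\<forall>b\<in>set bs. bval b \<sigma>)"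
  by (induction bs) auto

text \<open>The language has no multiplication; a constant factor is unrolled into
  additions.\<close>

fun times_const :: "nat \<Rightarrow> aexp \<Rightarrow> aexp" where
  "times_const 0 a = Const 0"
| "times_const (Suc k) a = Plus a (times_const k a)"

lemma aval_times_const [simp]: "aval (times_const k a) \<sigma> = k * aval a \<sigma>"
  by (induction k) auto

abbreviation var :: "vname \<Rightarrow> aexp" where "var x \<equiv> Cell x (Const 0)"
abbreviation set_var :: "vname \<Rightarrow> aexp \<Rightarrow> com" where "set_var x a \<equiv> Assign x (Const 0) a"
abbreviation incr :: "vname \<Rightarrow> com" where "incr x \<equiv> set_var x (Plus (var x) (Const 1))"

section \<open>Growth bounds by polynomials\<close>

definition poly_bounded :: "(nat \<Rightarrow> nat) \<Rightarrow> bool" where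
  "poly_bounded f \<longleftrightarrow> (\<exists>q :: nat poly. \<forall>n. f n \<le> poly q n)"

lemma poly_bounded_const [simp, intro]: "poly_bounded (\<lambda>n. c)"
  unfolding poly_bounded_def by (rule exI[of _ "[:c:]"]) auto

lemma poly_bounded_id [simp, intro]: "poly_bounded (\<lambda>n. n)"
  unfolding poly_bounded_def by (rule exI[of _ "[:0,1:]"]) auto

lemma poly_bounded_add [intro]: "poly_bounded f \<Longrightarrow> poly_bounded g \<Longrightarrow> poly_bounded (\<lambda>n. f n + g n)"
  unfolding poly_bounded_def by (metis add_mono poly_add)

lemma poly_bounded_mult [intro]: "poly_bounded f \<Longrightarrow> poly_bounded g \<Longrightarrow> poly_bounded (\<lambda>n. f n * g n)"
  unfolding poly_bounded_def by (metis mult_le_mono poly_mult)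

lemma poly_bounded_power [intro]: "poly_bounded f \<Longrightarrow> poly_bounded (\<lambda>n. f n ^ k)"
  by (induction k) auto

section \<open>Search for a cheapest word\<close>

text \<open>Frame condition: the set names the arrays that a command may have changed.\<close>

definition agree_off :: "vname set \<Rightarrow> state \<Rightarrow> state \<Rightarrow> bool" where
  "agree_off X \<sigma> \<sigma>' \<longleftrightarrow> (\<forall>x. x \<notin> X \<longrightarrow> \<sigma>' x = \<sigma> x)"

lemma agree_off_refl [simp]: "agree_off X \<sigma> \<sigma>"
  by (simp add: agree_off_def)

lemma agree_off_trans: "agree_off X \<sigma> \<sigma>' \<Longrightarrow> agree_off Y \<sigma>' \<sigma>'' \<Longrightarrow> X \<union> Y \<subseteq> Z \<Longrightarrow> agree_off Z \<sigma> \<sigma>''"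
  unfolding agree_off_def by (subgoal_tac "\<forall>x. x \<notin> Z \<longrightarrow> x \<notin> X \<and> x \<notin> Y") (simp, blast)

text \<open>\<open>K\<close> stands for the missing predecessor of the first letter.\<close>

definition accepted :: "nat \<Rightarrow> (nat \<times> nat \<times> nat) list \<Rightarrow> (nat \<Rightarrow> nat) \<Rightarrow> nat list \<Rightarrow> bool" where
  "accepted K trs fs ks \<longleftrightarrow>
     (\<forall>i<length ks. ((K # ks) ! i, fs i, ks ! i) \<in> set trs)"

text \<open>The search appends letters at the end, whereas acceptance is stated position by
  position.\<close>

lemma accepted_snoc:
  "accepted K trs fs (ks @ [k]) \<longleftrightarrow>
     accepted K trs fs ks \<and> (last (K # ks), fs (length ks), k) \<in> set trs"
proof -
  have "(K # ks @ [k]) ! length ks = last (K # ks)"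
    by (cases ks rule: rev_cases) (auto simp: nth_append nth_Cons')
  moreover have "(K # ks @ [k]) ! i = (K # ks) ! i" if "i < length ks" for i
    using that by (auto simp: nth_append nth_Cons')
  ultimately show ?thesis
    by (auto simp: accepted_def nth_append less_Suc_eq)
qed

text \<open>
  Breadth-first search over the pairs (Parikh vector, last letter) of accepted words. Record
  \<open>j\<close> occupies the cells \<open>j * (K + 3) + i\<close> of \<open>T\<close>: the fields \<open>i < K\<close> hold the Parikh vector,
  field \<open>K\<close> the last letter, field \<open>K + 1\<close> the length of the word, and field \<open>K + 2\<close> the record
  of the word without its last letter.
\<close>

locale parikh_search =
  fixes K :: nat and trs :: "(nat \<times> nat \<times> nat) list" and ce :: aexp and F :: "(nat \<Rightarrow> nat) \<Rightarrow> nat"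
  assumes letter: "(k, f, k') \<in> set trs \<Longrightarrow> k' < K"
    and F_cong: "(\<And>i. i < K \<Longrightarrow> x i = y i) \<Longrightarrow> F x = F y"
    and aval_ce: "aval ce \<sigma> = F (\<lambda>i. \<sigma> ''T'' (\<sigma> ''a'' 0 * (K + 3) + i))"
begin

section \<open>The commands of the search\<close>

abbreviation rcd :: "state \<Rightarrow> nat \<Rightarrow> nat \<Rightarrow> nat" where
  "rcd \<sigma> j i \<equiv> \<sigma> ''T'' (j * (K + 3) + i)"

definition fld :: "aexp \<Rightarrow> nat \<Rightarrow> aexp" where
  "fld e i = Cell ''T'' (Plus (times_const (K + 3) e) (Const i))"

lemma aval_fld [simp]: "aval (fld e i) \<sigma> = rcd \<sigma> (aval e \<sigma>) i"
  by (simp only: fld_def aval.simps aval_times_const mult.commute)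

definition entry :: "nat \<Rightarrow> nat \<Rightarrow> aexp" where
  "entry k' i =
     (if i < K then Plus (fld (var ''a'') i) (Const (if i = k' then 1 else 0))
      else if i = K then Const k'
      else if i = K + 1 then Plus (fld (var ''a'') (K + 1)) (Const 1) else var ''a'')"

definition candidate :: "nat \<Rightarrow> com" where
  "candidate k' = seqs (map (\<lambda>i. Assign ''T'' (Plus (times_const (K + 3) (var ''tl'')) (Const i)) (entry k' i)) [0..<K + 3])"

definition same_key :: bexp where
  "same_key = conj_list (map (\<lambda>i. Equal (fld (var ''b'') i) (fld (var ''tl'') i)) [0..<K + 1])"

text \<open>The candidate lies just behind the table, so the scan for an equal key stops there at the latest.\<close>

definition add_rcd :: "nat \<Rightarrow> com" where
  "add_rcd k' = Seq (Seq (candidate k') (set_var ''b'' (Const 0)))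
     (Seq (While (Not same_key) (incr ''b''))
          (If (Equal (var ''b'') (var ''tl'')) (incr ''tl'') Skip))"

text \<open>The number of letters read so far is the position of the next letter, so it serves as
  index into \<open>''f''\<close>. The bound \<open>''M''\<close> keeps the search finite.\<close>

definition guard :: "nat \<Rightarrow> nat \<Rightarrow> bexp" where
  "guard k f = And (Less (fld (var ''a'') (K + 1)) (var ''M''))
     (And (Equal (fld (var ''a'') K) (Const k)) (Equal (Cell ''f'' (fld (var ''a'') (K + 1))) (Const f)))"

definition expand :: "nat \<times> nat \<times> nat \<Rightarrow> com" where
  "expand = (\<lambda>(k, f, k'). If (guard k f) (add_rcd k') Skip)"

text \<open>Record 0 is the empty word. Only its last letter has to be written, because
  \<open>''T''\<close> is 0 everywhere at the start.\<close>

definition bfs :: com where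
  "bfs = Seq (Seq (Assign ''T'' (Const K) (Const K)) (Seq (set_var ''a'' (Const 0)) (set_var ''tl'' (Const 1))))
     (While (Less (var ''a'') (var ''tl'')) (Seq (seqs (map expand trs)) (incr ''a'')))"

text \<open>\<open>bs\<close> holds the successor of the least cost found so far, or 0.\<close>

definition pick_body :: com where
  "pick_body = Seq (If (And (Equal (fld (var ''a'') (K + 1)) (var ''M''))
                 (Not (And (Less (Const 0) (var ''bs'')) (Less (var ''bs'') (Plus ce (Const 2))))))
               (Seq (set_var ''bs'' (Plus ce (Const 1))) (set_var ''bj'' (var ''a''))) Skip)
             (incr ''a'')"

definition pick_best :: com where
  "pick_best = Seq (Seq (set_var ''a'' (Const 0)) (set_var ''bs'' (Const 0)))
     (While (Less (var ''a'') (var ''tl'')) pick_body)"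

text \<open>The back pointers yield the letters from the last to the first, so \<open>''i''\<close>
  counts down.\<close>

definition trace_body :: com where
  "trace_body = Seq (set_var ''i'' (Minus (var ''i'') (Const 1)))
         (Seq (Assign ''w'' (var ''i'') (fld (var ''bj'') K)) (set_var ''bj'' (fld (var ''bj'') (K + 2))))"

definition trace_back :: com where
  "trace_back = Seq (set_var ''i'' (var ''M''))
     (While (Less (Const 0) (var ''i'')) trace_body)"

definition search :: com where
  "search = Seq bfs (Seq pick_best trace_back)"

text \<open>The condition \<open>p < j\<close> makes the back pointers well-founded, which the
  inductions over records rely on.\<close>

definition extends :: "(nat \<Rightarrow> nat) \<Rightarrow> nat \<Rightarrow> (nat \<Rightarrow> nat \<Rightarrow> nat) \<Rightarrow> nat \<Rightarrow> nat \<Rightarrow> bool" where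
  "extends fs M r p j \<longleftrightarrow>
     p < j \<and> r p (K + 1) < M \<and> (r p K, fs (r p (K + 1)), r j K) \<in> set trs \<and>
     r j (K + 1) = Suc (r p (K + 1)) \<and> (\<forall>i<K. r j i = r p i + (if i = r j K then 1 else 0))"

text \<open>The invariant of the search. The key of a record consists of its fields up to
  \<open>K\<close>; that keys are pairwise distinct bounds the number of records. The length is left
  out of the key because the counts determine it.\<close>

definition table :: "(nat \<Rightarrow> nat) \<Rightarrow> nat \<Rightarrow> (nat \<Rightarrow> nat \<Rightarrow> nat) \<Rightarrow> nat \<Rightarrow> bool" where
  "table fs M r n \<longleftrightarrow> 0 < n \<and> (\<forall>i<K. r 0 i = 0) \<and> r 0 K = K \<and> r 0 (K + 1) = 0 \<and>
     (\<forall>j. 0 < j \<and> j < n \<longrightarrow> extends fs M r (r j (K + 2)) j) \<and>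
     (\<forall>i j. i < j \<and> j < n \<longrightarrow> (\<exists>l\<le>K. r i l \<noteq> r j l))"

text \<open>The back pointer of the record \<open>j'\<close> may differ from \<open>j\<close>, as
  the same key may have been reached from another record first.\<close>

definition has_succ :: "(nat \<Rightarrow> nat \<Rightarrow> nat) \<Rightarrow> nat \<Rightarrow> nat \<Rightarrow> nat \<Rightarrow> bool" where
  "has_succ r n j k' \<longleftrightarrow> (\<exists>j'<n. r j' K = k' \<and> (\<forall>i<K. r j' i = r j i + (if i = k' then 1 else 0)))"

definition applicable :: "(nat \<Rightarrow> nat) \<Rightarrow> nat \<Rightarrow> (nat \<Rightarrow> nat \<Rightarrow> nat) \<Rightarrow> nat \<Rightarrow> nat \<times> nat \<times> nat \<Rightarrow> bool" where
  "applicable fs M r j = (\<lambda>(k, f, k'). r j (K + 1) < M \<and> r j K = k \<and> fs (r j (K + 1)) = f)"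

lemma table_prev:
  "table fs M r n \<Longrightarrow> 0 < j \<Longrightarrow> j < n \<Longrightarrow> extends fs M r (r j (K + 2)) j"
  by (simp add: table_def)

lemma table_first:
  "table fs M r n \<Longrightarrow> 0 < n \<and> (\<forall>i<K. r 0 i = 0) \<and> r 0 K = K \<and> r 0 (K + 1) = 0"
  unfolding table_def by (elim conjE) (intro conjI; assumption)

lemma table_distinct: "table fs M r n \<Longrightarrow> i < j \<Longrightarrow> j < n \<Longrightarrow> \<exists>l\<le>K. r i l \<noteq> r j l"
  unfolding table_def by (elim conjE) simp

lemma table_last: "table fs M r n \<Longrightarrow> j < n \<Longrightarrow> r j K \<le> K"
  using table_prev[of fs M r n j] table_first[of fs M r n] unfolding extends_def
  by (cases "j = 0") (auto dest!: letter simp del: add_2_eq_Suc')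

text \<open>Each step along the back pointers removes one letter from exactly one count. So records
  with equal keys have equal length.\<close>

lemma table_sum: "table fs M r n \<Longrightarrow> j < n \<Longrightarrow> (\<Sum>i<K. r j i) = r j (K + 1)"
proof (induction j rule: less_induct)
  case (less j)
  show ?case
  proof (cases "j = 0")
    case False
    obtain p where p: "p < j" "(r p K, fs (r p (K + 1)), r j K) \<in> set trs"
      "r j (K + 1) = Suc (r p (K + 1))" "\<forall>i<K. r j i = r p i + (if i = r j K then 1 else 0)"
      using table_prev[OF less.prems(1) _ less.prems(2)] False unfolding extends_def by blast
    have "(\<Sum>i<K. r j i) = (\<Sum>i<K. r p i) + (\<Sum>i<K. if i = r j K then 1 else 0)"
      using p(4) by (simp add: sum.distrib)
    also have "(\<Sum>i<K. if i = r j K then 1 else 0) = (1::nat)"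
      using letter[OF p(2)] by (simp add: sum.delta)
    finally show ?thesis using less p by simp
  qed (use table_first[OF less.prems(1)] in simp)
qed

lemma table_len: "table fs M r n \<Longrightarrow> j < n \<Longrightarrow> r j (K + 1) \<le> M"
  using table_prev[of fs M r n j] table_first[of fs M r n]
  by (cases "j = 0") (auto simp: extends_def)

text \<open>Pigeonhole on the keys, which lie in a box of dimension \<open>K + 1\<close>. The bound
  is polynomial in \<open>M\<close> because \<open>K\<close> is a constant.\<close>

lemma table_bound:
  assumes "table fs M r n"
  shows "n \<le> (M + K + 1) ^ (K + 1)"
proof -
  let ?g = "\<lambda>j. restrict (r j) {..K}"
  \<comment> \<open>A count is at most the length, hence at most \<open>M\<close>, and the last
    letter is at most \<open>K\<close>; the sum covers both.\<close>
  have "r j i \<le> M + K" if "j < n" "i \<le> K" for i j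
  proof (cases "i = K")
    case False
    then have "r j i \<le> (\<Sum>i<K. r j i)" using that by (intro member_le_sum) auto
    then show ?thesis using table_sum[OF assms that(1)] table_len[OF assms that(1)] by simp
  qed (use table_last[OF assms that(1)] in auto)
  then have "?g ` {..<n} \<subseteq> PiE {..K} (\<lambda>_. {..M + K})"
    by (auto simp: PiE_iff extensional_def split: if_splits)
  moreover have "inj_on ?g {..<n}"
  proof (rule linorder_inj_onI)
    fix i j assume "i < j" "j \<in> {..<n}"
    then obtain l where "l \<le> K" "r i l \<noteq> r j l" using table_distinct[OF assms] by auto
    then show "?g i \<noteq> ?g j" by (metis atMost_iff restrict_apply')
  qed auto
  ultimately have "card {..<n} \<le> card (PiE {..K} (\<lambda>_. {..M + K}))"
    by (intro card_inj_on_le finite_PiE) auto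
  also have "\<dots> = (M + K + 1) ^ (K + 1)" by (simp add: card_PiE)
  finally show ?thesis by simp
qed

text \<open>Allows a candidate to be written behind the table.\<close>

lemma table_cong:
  assumes t: "table fs M r n" and eq: "\<And>j i. j < n \<Longrightarrow> i < K + 3 \<Longrightarrow> r' j i = r j i"
  shows "table fs M r' n"
proof -
  have "0 < n" using t by (simp add: table_def)
  moreover have "extends fs M r' (r' j (K + 2)) j" if j: "0 < j" "j < n" for j
  proof -
    define p where "p = r j (K + 2)"
    have p: "extends fs M r p j" using table_prev[OF t j] by (simp add: p_def)
    then have "p < n" using j by (simp add: extends_def)
    then have "r' j i = r j i" "r' p i = r p i" if "i < K + 3" for i
      using that j by (simp_all add: eq)
    moreover have "r' j (K + 2) = p" using j by (simp add: eq p_def)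
    ultimately show ?thesis using p by (simp only: extends_def) simp
  qed
  moreover have "\<exists>l\<le>K. r' i l \<noteq> r' j l" if ij: "i < j" "j < n" for i j
  proof -
    obtain l where "l \<le> K" "r i l \<noteq> r j l" using table_distinct[OF t ij] by auto
    then show ?thesis
      using that by (intro exI[of _ l]) (simp add: eq)
  qed
  moreover have "(\<forall>i<K. r' 0 i = 0) \<and> r' 0 K = K \<and> r' 0 (K + 1) = 0"
    using table_first[OF t] eq[OF \<open>0 < n\<close>] by simp
  ultimately show ?thesis unfolding table_def by (intro conjI allI impI) (elim conjE; assumption | simp only:)+
qed

lemma table_extend:
  assumes "table fs M r n" and a: "a < n" and app: "applicable fs M r a (k, f, k')" and "(k, f, k') \<in> set trs"
    and old: "\<And>j i. j < n \<Longrightarrow> i < K + 3 \<Longrightarrow> r' j i = r j i"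
    and new: "\<And>i. i < K \<Longrightarrow> r' n i = r a i + (if i = k' then 1 else 0)" "r' n K = k'"
      "r' n (K + 1) = Suc (r a (K + 1))" "r' n (K + 2) = a"
    and diff: "\<forall>j<n. \<exists>l\<le>K. r j l \<noteq> r' n l"
  shows "table fs M r' (Suc n)"
proof -
  have t: "table fs M r' n" using assms(1) old by (rule table_cong)
  have "extends fs M r' a n"
    using app a assms(4) old[OF a] new by (simp add: applicable_def extends_def)
  moreover have "\<exists>l\<le>K. r' j l \<noteq> r' n l" if j: "j < n" for j
  proof -
    obtain l where "l \<le> K" "r j l \<noteq> r' n l" using diff j by auto
    with old[OF j, of l] show ?thesis by auto
  qed
  ultimately show ?thesis
    using t new(4) by (auto simp: table_def less_Suc_eq)
qed

lemma has_succ_mono: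
  assumes "has_succ r n j k'" "j < n" "n \<le> n'" "\<And>j i. j < n \<Longrightarrow> i < K + 3 \<Longrightarrow> r' j i = r j i"
  shows "has_succ r' n' j k'"
proof -
  obtain j' where "j' < n" "r j' K = k'" "\<forall>i<K. r j' i = r j i + (if i = k' then 1 else 0)"
    using assms(1) by (auto simp: has_succ_def)
  then show ?thesis unfolding has_succ_def using assms(2-4) by (intro exI[of _ j']) auto
qed

section \<open>Execution of the breadth-first search\<close>

lemma loop_free_candidate [simp]: "loop_free (candidate k')"
  by (simp add: candidate_def)

text \<open>The candidate is computed from record \<open>''a''\<close>, which ends before record
  \<open>''tl''\<close> begins; hence no write disturbs a later read.\<close>

lemma run_candidate:
  assumes "\<sigma> ''a'' 0 < \<sigma> ''tl'' 0"
  shows "n \<le> K + 3 \<Longrightarrow>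
    run (seqs (map (\<lambda>i. Assign ''T'' (Plus (times_const (K + 3) (var ''tl'')) (Const i)) (entry k' i)) [0..<n])) \<sigma> =
    \<sigma>(''T'' := \<lambda>x. if \<sigma> ''tl'' 0 * (K + 3) \<le> x \<and> x < \<sigma> ''tl'' 0 * (K + 3) + n
       then aval (entry k' (x - \<sigma> ''tl'' 0 * (K + 3))) \<sigma> else \<sigma> ''T'' x)" (is "_ \<Longrightarrow> run (?c n) \<sigma> = ?s n")
proof (induction n)
  case 0
  then show ?case by (simp add: fun_eq_iff)
next
  case (Suc n)
  define a t where "a = \<sigma> ''a'' 0" and "t = \<sigma> ''tl'' 0"
  have "a * (K + 3) + (K + 3) \<le> t * (K + 3)"
    using assms mult_le_mono1[of "Suc a" t "K + 3"] by (simp add: a_def t_def)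
  then have "aval (entry k' n) (?s n) = aval (entry k' n) \<sigma>"
    using Suc.prems by (auto simp: entry_def a_def t_def)
  moreover have "run (?c (Suc n)) \<sigma> = (?s n)(''T'' := (?s n ''T'')(t * (K + 3) + n := aval (entry k' n) (?s n)))"
    using Suc by (simp add: t_def mult.commute)
  ultimately show ?case
    by (auto simp: fun_eq_iff t_def less_Suc_eq simp del: mult_Suc_right)
qed

definition scan_time :: "nat \<Rightarrow> nat" where
  "scan_time N = N * (1 + bcost (Not same_key) + max_time (incr ''b'')) + (1 + bcost (Not same_key))"

text \<open>Summing over all letters gives a bound that does not depend on the letter
  appended.\<close>

definition add_time :: "nat \<Rightarrow> nat" where
  "add_time N = (\<Sum>k'<K. max_time (Seq (candidate k') (set_var ''b'' (Const 0)))) +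
     (scan_time N + max_time (If (Equal (var ''b'') (var ''tl'')) (incr ''tl'') Skip))"

lemma bval_same_key: "bval same_key \<sigma> \<longleftrightarrow> (\<forall>i\<le>K. rcd \<sigma> (\<sigma> ''b'' 0) i = rcd \<sigma> (\<sigma> ''tl'' 0) i)"
  by (auto simp: same_key_def less_Suc_eq_le)

lemma trip_add_rcd:
  assumes tab: "table (\<sigma> ''f'') (\<sigma> ''M'' 0) (rcd \<sigma>) (\<sigma> ''tl'' 0)"
    and a: "\<sigma> ''a'' 0 < \<sigma> ''tl'' 0" and N: "\<sigma> ''tl'' 0 \<le> N"
    and app: "applicable (\<sigma> ''f'') (\<sigma> ''M'' 0) (rcd \<sigma>) (\<sigma> ''a'' 0) (k, f, k')" and "(k, f, k') \<in> set trs"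
  shows "trip (add_rcd k') \<sigma> (add_time N) (\<lambda>\<sigma>'. agree_off {''T'', ''b'', ''tl''} \<sigma> \<sigma>' \<and>
    \<sigma> ''tl'' 0 \<le> \<sigma>' ''tl'' 0 \<and>
    (\<forall>j<\<sigma> ''tl'' 0. \<forall>i<K + 3. rcd \<sigma>' j i = rcd \<sigma> j i) \<and>
    table (\<sigma> ''f'') (\<sigma> ''M'' 0) (rcd \<sigma>') (\<sigma>' ''tl'' 0) \<and>
    has_succ (rcd \<sigma>') (\<sigma>' ''tl'' 0) (\<sigma> ''a'' 0) k')"
    (is "trip _ _ _ ?Q")
proof -
  let ?c = "Seq (candidate k') (set_var ''b'' (Const 0))"
  define n a where "n = \<sigma> ''tl'' 0" and "a = \<sigma> ''a'' 0"
  define \<sigma>1 where "\<sigma>1 = run ?c \<sigma>"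
  have k': "k' < K" using letter assms(5) by blast
  have \<sigma>1: "\<sigma>1 = \<sigma>(''T'' := \<lambda>x. if n * (K + 3) \<le> x \<and> x < n * (K + 3) + (K + 3)
       then aval (entry k' (x - n * (K + 3))) \<sigma> else \<sigma> ''T'' x, ''b'' := (\<sigma> ''b'')(0 := 0))"
    using run_candidate[where \<sigma> = \<sigma> and n = "K + 3" and k' = k'] a by (simp add: \<sigma>1_def candidate_def n_def fun_eq_iff)
  have new: "rcd \<sigma>1 n i = aval (entry k' i) \<sigma>" if "i < K + 3" for i
    using that by (simp add: \<sigma>1)
  have old: "rcd \<sigma>1 j i = rcd \<sigma> j i" if "j < n" "i < K + 3" for j i
  proof -
    have "j * (K + 3) + (K + 3) \<le> n * (K + 3)"
      using that mult_le_mono1[of "Suc j" n "K + 3"] by simp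
    then have "j * (K + 3) + i < n * (K + 3)" using that by linarith
    then show ?thesis by (simp add: \<sigma>1)
  qed
  have new': "\<And>i. i < K \<Longrightarrow> rcd \<sigma>1 n i = rcd \<sigma> a i + (if i = k' then 1 else 0)" "rcd \<sigma>1 n K = k'"
      "rcd \<sigma>1 n (K + 1) = Suc (rcd \<sigma> a (K + 1))" "rcd \<sigma>1 n (K + 2) = a"
    using new new[of "K + 1"] new[of "K + 2"] by (simp_all add: entry_def a_def)
  \<comment> \<open>Only the position \<open>b\<close> of the scan changes; all records passed so
    far have a key different from that of the candidate.\<close>
  let ?I = "\<lambda>\<sigma>'. \<exists>b\<le>n. \<sigma>' = \<sigma>1(''b'' := (\<sigma>1 ''b'')(0 := b)) \<and> (\<forall>j<b. \<exists>i\<le>K. rcd \<sigma>1 j i \<noteq> rcd \<sigma>1 n i)"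
  have "trip (While (Not same_key) (incr ''b'')) \<sigma>1 (scan_time N) (\<lambda>\<sigma>'. ?I \<sigma>' \<and> \<not> bval (Not same_key) \<sigma>')"
    unfolding scan_time_def
  proof (rule trip_While_run[where \<mu> = "\<lambda>\<sigma>'. n - \<sigma>' ''b'' 0"])
    show "?I \<sigma>1" by (intro exI[of _ 0]) (auto simp: \<sigma>1 fun_eq_iff)
    fix \<sigma>' assume "?I \<sigma>'" and b: "bval (Not same_key) \<sigma>'"
    then obtain b where b': "b \<le> n" "\<sigma>' = \<sigma>1(''b'' := (\<sigma>1 ''b'')(0 := b))"
      "\<forall>j<b. \<exists>i\<le>K. rcd \<sigma>1 j i \<noteq> rcd \<sigma>1 n i" by blast
    have "\<sigma>1 ''tl'' 0 = n" by (simp add: \<sigma>1 n_def)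
    then have neq: "\<exists>i\<le>K. rcd \<sigma>1 b i \<noteq> rcd \<sigma>1 n i" using b b'(2) by (auto simp: bval_same_key)
    \<comment> \<open>At \<open>b = n\<close> the candidate would be compared with itself.\<close>
    then have "b < n" using b'(1) by (cases "b = n") auto
    moreover have "\<forall>j<Suc b. \<exists>i\<le>K. rcd \<sigma>1 j i \<noteq> rcd \<sigma>1 n i" using neq b'(3) by (auto simp: less_Suc_eq)
    ultimately show "?I (run (incr ''b'') \<sigma>') \<and> n - run (incr ''b'') \<sigma>' ''b'' 0 < n - \<sigma>' ''b'' 0"
      using b'(2) by (intro conjI exI[of _ "Suc b"]) (auto simp: fun_eq_iff)
  qed (use N in \<open>auto simp: n_def\<close>)
  then have "trip (Seq (While (Not same_key) (incr ''b'')) (If (Equal (var ''b'') (var ''tl'')) (incr ''tl'') Skip)) \<sigma>1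
    (scan_time N + max_time (If (Equal (var ''b'') (var ''tl'')) (incr ''tl'') Skip)) ?Q"
  proof (rule trip_Seq)
    fix \<sigma>' assume "?I \<sigma>' \<and> \<not> bval (Not same_key) \<sigma>'"
    then obtain b where b: "b \<le> n" "\<sigma>' = \<sigma>1(''b'' := (\<sigma>1 ''b'')(0 := b))"
      "\<forall>j<b. \<exists>i\<le>K. rcd \<sigma>1 j i \<noteq> rcd \<sigma>1 n i" "bval same_key \<sigma>'" by auto
    have tl: "\<sigma>1 ''tl'' 0 = n" by (simp add: \<sigma>1 n_def)
    have same: "\<forall>i\<le>K. rcd \<sigma>1 b i = rcd \<sigma>1 n i" using b(2,4) tl by (simp add: bval_same_key)
    let ?\<sigma> = "run (If (Equal (var ''b'') (var ''tl'')) (incr ''tl'') Skip) \<sigma>'"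
    have T: "?\<sigma> ''T'' = \<sigma>1 ''T''" using b(2) by simp
    have agree: "agree_off {''T'', ''b'', ''tl''} \<sigma> ?\<sigma>" using b(2) by (auto simp: \<sigma>1 agree_off_def)
    have tab1: "table (\<sigma> ''f'') (\<sigma> ''M'' 0) (rcd \<sigma>1) n"
      using table_cong[OF tab[folded n_def] old] by blast
    have "?Q ?\<sigma>"
    proof (cases "b = n")
      \<comment> \<open>No record has this key, so advancing \<open>''tl''\<close> turns the
        candidate into a record. In the other case the scan stopped at a record that already serves
        as the successor.\<close>
      case True
      have tl': "?\<sigma> ''tl'' 0 = Suc n" using b(2) tl True by simp
      have "table (\<sigma> ''f'') (\<sigma> ''M'' 0) (rcd \<sigma>1) (Suc n)"
      proof (rule table_extend[OF tab[folded n_def] a[folded a_def n_def] app[folded a_def] assms(5) old new'])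
        show "\<forall>j<n. \<exists>i\<le>K. rcd \<sigma> j i \<noteq> rcd \<sigma>1 n i"
        proof (intro allI impI)
          fix j assume "j < n"
          then obtain i where "i \<le> K" "rcd \<sigma>1 j i \<noteq> rcd \<sigma>1 n i" using b(3) True by auto
          then show "\<exists>i\<le>K. rcd \<sigma> j i \<noteq> rcd \<sigma>1 n i" using old[OF \<open>j < n\<close>, of i] by auto
        qed
      qed
      moreover have "has_succ (rcd \<sigma>1) (Suc n) a k'"
        unfolding has_succ_def using new' old[of a] a by (intro exI[of _ n]) (auto simp: a_def n_def)
      ultimately show ?thesis
        unfolding T tl' using agree old by (simp add: n_def a_def)
    next
      case False
      have tl': "?\<sigma> ''tl'' 0 = n" using b(2) tl False by simp
      have "has_succ (rcd \<sigma>1) n a k'"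
        unfolding has_succ_def using new' old[of a] a b(1) False same
        by (intro exI[of _ b]) (auto simp: a_def n_def)
      then show ?thesis
        unfolding T tl' using agree old tab1 by (simp add: n_def a_def)
    qed
    then show "trip (If (Equal (var ''b'') (var ''tl'')) (incr ''tl'') Skip) \<sigma>'
      (max_time (If (Equal (var ''b'') (var ''tl'')) (incr ''tl'') Skip)) ?Q"
      by (intro trip_run) auto
  qed
  note rest = this
  have first: "trip ?c \<sigma> (max_time ?c) (\<lambda>\<sigma>'. \<sigma>' = \<sigma>1)"
    unfolding \<sigma>1_def by (rule trip_run) auto
  have "trip (add_rcd k') \<sigma> (max_time ?c + (scan_time N + max_time (If (Equal (var ''b'') (var ''tl'')) (incr ''tl'') Skip))) ?Q"
    unfolding add_rcd_def by (rule trip_Seq[OF first]) (simp only: rest)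
  moreover have "max_time ?c \<le> (\<Sum>k'<K. max_time (Seq (candidate k') (set_var ''b'' (Const 0))))"
    using k' by (intro member_le_sum[of k' "{..<K}"]) auto
  ultimately show ?thesis unfolding add_time_def by (elim trip_weaken) auto
qed

text \<open>Records are added but never altered, so what is known about old records survives later
  expansions.\<close>

definition grows :: "state \<Rightarrow> state \<Rightarrow> bool" where
  "grows \<sigma> \<sigma>' \<longleftrightarrow> agree_off {''T'', ''b'', ''tl''} \<sigma> \<sigma>' \<and> \<sigma> ''tl'' 0 \<le> \<sigma>' ''tl'' 0 \<and>
    (\<forall>j<\<sigma> ''tl'' 0. \<forall>i<K + 3. rcd \<sigma>' j i = rcd \<sigma> j i) \<and>
    table (\<sigma> ''f'') (\<sigma> ''M'' 0) (rcd \<sigma>') (\<sigma>' ''tl'' 0)"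

lemma grows_trans:
  assumes "grows \<sigma> \<sigma>'" "grows \<sigma>' \<sigma>''"
  shows "grows \<sigma> \<sigma>''"
proof -
  have "\<sigma>' ''f'' = \<sigma> ''f''" "\<sigma>' ''M'' = \<sigma> ''M''" using assms(1) by (auto simp: grows_def agree_off_def)
  then show ?thesis using assms unfolding grows_def by (auto intro: agree_off_trans)
qed

lemma grows_frame:
  "grows \<sigma> \<sigma>' \<Longrightarrow> \<sigma>' ''a'' = \<sigma> ''a'' \<and> \<sigma>' ''f'' = \<sigma> ''f'' \<and> \<sigma>' ''M'' = \<sigma> ''M''"
  by (auto simp: grows_def agree_off_def)

lemma has_succ_grows: "grows \<sigma> \<sigma>' \<Longrightarrow> j < \<sigma> ''tl'' 0 \<Longrightarrow> has_succ (rcd \<sigma>) (\<sigma> ''tl'' 0) j k' \<Longrightarrow>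
   has_succ (rcd \<sigma>') (\<sigma>' ''tl'' 0) j k'"
  by (rule has_succ_mono[where n = "\<sigma> ''tl'' 0" and r = "rcd \<sigma>"]) (auto simp: grows_def)

lemma applicable_grows: "grows \<sigma> \<sigma>' \<Longrightarrow> j < \<sigma> ''tl'' 0 \<Longrightarrow>
   applicable fs M (rcd \<sigma>') j tr \<longleftrightarrow> applicable fs M (rcd \<sigma>) j tr"
proof -
  assume "grows \<sigma> \<sigma>'" "j < \<sigma> ''tl'' 0"
  then have "rcd \<sigma>' j K = rcd \<sigma> j K" "rcd \<sigma>' j (K + 1) = rcd \<sigma> j (K + 1)"
    by (auto simp only: grows_def)
  then show ?thesis by (simp add: applicable_def)
qed

definition expand_time :: "nat \<Rightarrow> nat" where
  "expand_time N = 1 + bcost (guard 0 0) + (add_time N + 1)"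

lemma trip_expand:
  assumes tab: "table (\<sigma> ''f'') (\<sigma> ''M'' 0) (rcd \<sigma>) (\<sigma> ''tl'' 0)"
    and a: "\<sigma> ''a'' 0 < \<sigma> ''tl'' 0" and N: "\<sigma> ''tl'' 0 \<le> N" and tr: "tr \<in> set trs"
  shows "trip (expand tr) \<sigma> (expand_time N) (\<lambda>\<sigma>'. grows \<sigma> \<sigma>' \<and>
    (applicable (\<sigma> ''f'') (\<sigma> ''M'' 0) (rcd \<sigma>) (\<sigma> ''a'' 0) tr \<longrightarrow>
       has_succ (rcd \<sigma>') (\<sigma>' ''tl'' 0) (\<sigma> ''a'' 0) (snd (snd tr))))" (is "trip _ _ _ ?Q")
proof -
  obtain k f k' where [simp]: "tr = (k, f, k')" by (cases tr)
  have g: "bval (guard k f) \<sigma> \<longleftrightarrow> applicable (\<sigma> ''f'') (\<sigma> ''M'' 0) (rcd \<sigma>) (\<sigma> ''a'' 0) tr"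
    by (auto simp: guard_def applicable_def)
  have "trip (If (guard k f) (add_rcd k') Skip) \<sigma> (1 + bcost (guard k f) + (add_time N + 1)) ?Q"
  proof (rule trip_If)
    assume "bval (guard k f) \<sigma>"
    then show "trip (add_rcd k') \<sigma> (add_time N + 1) ?Q"
      using tr g by (intro trip_weaken[OF trip_add_rcd[OF tab a N]]) (auto simp: grows_def)
  next
    assume "\<not> bval (guard k f) \<sigma>"
    then show "trip Skip \<sigma> (add_time N + 1) ?Q"
      using g tab by (intro trip_weaken[OF trip_run[where Q = "?Q"]]) (auto simp: grows_def)
  qed
  moreover have "bcost (guard k f) = bcost (guard 0 0)" by (simp add: guard_def)
  ultimately show ?thesis by (simp only: expand_time_def) (simp add: expand_def)
qed

text \<open>The records before \<open>m\<close> have been expanded. At \<open>m = n\<close> the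
  table is closed under all transitions that stay within length \<open>M\<close>.\<close>

definition closed :: "(nat \<Rightarrow> nat) \<Rightarrow> nat \<Rightarrow> (nat \<Rightarrow> nat \<Rightarrow> nat) \<Rightarrow> nat \<Rightarrow> nat \<Rightarrow> bool" where
  "closed fs M r n m \<longleftrightarrow> (\<forall>j<m. \<forall>tr\<in>set trs. applicable fs M r j tr \<longrightarrow> has_succ r n j (snd (snd tr)))"

text \<open>The table may grow between two transitions from the same record; successors found
  earlier persist by \<open>has_succ_grows\<close>.\<close>

lemma trip_expand_all:
  assumes tab: "table (\<sigma> ''f'') (\<sigma> ''M'' 0) (rcd \<sigma>) (\<sigma> ''tl'' 0)"
    and a: "\<sigma> ''a'' 0 < \<sigma> ''tl'' 0" and N: "(\<sigma> ''M'' 0 + K + 1) ^ (K + 1) \<le> N"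
    and cl: "closed (\<sigma> ''f'') (\<sigma> ''M'' 0) (rcd \<sigma>) (\<sigma> ''tl'' 0) (\<sigma> ''a'' 0)"
  shows "trip (seqs (map expand trs)) \<sigma> (length trs * expand_time N + 1) (\<lambda>\<sigma>'. grows \<sigma> \<sigma>' \<and>
    closed (\<sigma> ''f'') (\<sigma> ''M'' 0) (rcd \<sigma>') (\<sigma>' ''tl'' 0) (Suc (\<sigma> ''a'' 0)))"
proof -
  define fs M a where "fs = \<sigma> ''f''" and "M = \<sigma> ''M'' 0" and "a = \<sigma> ''a'' 0"
  let ?I = "\<lambda>t \<sigma>'. grows \<sigma> \<sigma>' \<and>
    (\<forall>i<t. applicable fs M (rcd \<sigma>') a (trs ! i) \<longrightarrow> has_succ (rcd \<sigma>') (\<sigma>' ''tl'' 0) a (snd (snd (trs ! i))))"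
  have "trip (seqs (map expand trs)) \<sigma> (length (map expand trs) * expand_time N + 1) (?I (length (map expand trs)))"
  proof (rule trip_seqs)
    show "?I 0 \<sigma>" using tab by (auto simp: grows_def)
    fix t \<sigma>' assume t: "t < length (map expand trs)" and I: "?I t \<sigma>'"
    have fr: "\<sigma>' ''a'' = \<sigma> ''a''" "\<sigma>' ''f'' = fs" "\<sigma>' ''M'' 0 = M"
      using I grows_frame[of \<sigma> \<sigma>'] by (auto simp: fs_def M_def)
    have tab': "table fs M (rcd \<sigma>') (\<sigma>' ''tl'' 0)" "\<sigma> ''tl'' 0 \<le> \<sigma>' ''tl'' 0"
      using I by (auto simp: grows_def fs_def M_def)
    have "\<sigma>' ''tl'' 0 \<le> N" using table_bound[OF tab'(1)] N by (simp add: M_def)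
    then have "trip (expand (trs ! t)) \<sigma>' (expand_time N) (\<lambda>\<sigma>''. grows \<sigma>' \<sigma>'' \<and>
      (applicable fs M (rcd \<sigma>') a (trs ! t) \<longrightarrow> has_succ (rcd \<sigma>'') (\<sigma>'' ''tl'' 0) a (snd (snd (trs ! t)))))"
      using trip_expand[of \<sigma>' N "trs ! t"] fr tab' a t by (simp add: a_def)
    then show "trip (map expand trs ! t) \<sigma>' (expand_time N) (?I (Suc t))"
      using t
    proof (simp, elim trip_weaken)
      fix \<sigma>'' assume *: "grows \<sigma>' \<sigma>'' \<and>
        (applicable fs M (rcd \<sigma>') a (trs ! t) \<longrightarrow> has_succ (rcd \<sigma>'') (\<sigma>'' ''tl'' 0) a (snd (snd (trs ! t))))"
      have a': "a < \<sigma>' ''tl'' 0" using a tab'(2) by (simp add: a_def)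
      have "applicable fs M (rcd \<sigma>'') a tr \<longleftrightarrow> applicable fs M (rcd \<sigma>') a tr" for tr
        using applicable_grows[of \<sigma>' \<sigma>'' a] a' * by blast
      moreover have "has_succ (rcd \<sigma>'') (\<sigma>'' ''tl'' 0) a k'" if "has_succ (rcd \<sigma>') (\<sigma>' ''tl'' 0) a k'" for k'
        using has_succ_grows[of \<sigma>' \<sigma>'' a] a' that * by blast
      ultimately show "?I (Suc t) \<sigma>''"
        using * I grows_trans[of \<sigma> \<sigma>' \<sigma>''] by (auto simp: less_Suc_eq)
    qed simp
  qed
  then show ?thesis
  proof (simp, elim trip_weaken)
    fix \<sigma>' assume *: "?I (length trs) \<sigma>'"
    have "closed fs M (rcd \<sigma>') (\<sigma>' ''tl'' 0) (Suc a)"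
      unfolding closed_def
    proof (intro allI ballI impI)
      fix j tr assume j: "j < Suc a" "tr \<in> set trs" "applicable fs M (rcd \<sigma>') j tr"
      show "has_succ (rcd \<sigma>') (\<sigma>' ''tl'' 0) j (snd (snd tr))"
      proof (cases "j = a")
        case True
        then show ?thesis using * j by (auto simp: in_set_conv_nth)
      next
        case False
        then have j': "j < a" "j < \<sigma> ''tl'' 0" using j a by (auto simp: a_def)
        moreover have "applicable fs M (rcd \<sigma>) j tr"
          using j(3) applicable_grows[of \<sigma> \<sigma>' j] j'(2) * by blast
        ultimately have "has_succ (rcd \<sigma>) (\<sigma> ''tl'' 0) j (snd (snd tr))"
          using cl j(2) by (auto simp: closed_def a_def fs_def M_def)
        then show ?thesis using has_succ_grows[of \<sigma> \<sigma>' j] j'(2) * by blast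
      qed
    qed
    then show "grows \<sigma> \<sigma>' \<and> closed (\<sigma> ''f'') (\<sigma> ''M'' 0) (rcd \<sigma>') (\<sigma>' ''tl'' 0) (Suc (\<sigma> ''a'' 0))"
      using * by (simp add: a_def fs_def M_def)
  qed simp
qed

definition bfs_time :: "nat \<Rightarrow> nat" where
  "bfs_time N =
     max_time (Seq (Assign ''T'' (Const K) (Const K)) (Seq (set_var ''a'' (Const 0)) (set_var ''tl'' (Const 1)))) +
     (N * (1 + bcost (Less (var ''a'') (var ''tl'')) + (length trs * expand_time N + 1 + max_time (incr ''a''))) +
      (1 + bcost (Less (var ''a'') (var ''tl''))))"

lemma trip_bfs:
  assumes T: "\<sigma> ''T'' = (\<lambda>_. 0)" and N: "(\<sigma> ''M'' 0 + K + 1) ^ (K + 1) \<le> N"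
  shows "trip bfs \<sigma> (bfs_time N) (\<lambda>\<sigma>'. agree_off {''T'', ''b'', ''tl'', ''a''} \<sigma> \<sigma>' \<and>
    table (\<sigma> ''f'') (\<sigma> ''M'' 0) (rcd \<sigma>') (\<sigma>' ''tl'' 0) \<and>
    closed (\<sigma> ''f'') (\<sigma> ''M'' 0) (rcd \<sigma>') (\<sigma>' ''tl'' 0) (\<sigma>' ''tl'' 0))"
proof -
  define fs M where "fs = \<sigma> ''f''" and "M = \<sigma> ''M'' 0"
  let ?I = "\<lambda>\<sigma>'. agree_off {''T'', ''b'', ''tl'', ''a''} \<sigma> \<sigma>' \<and> \<sigma>' ''a'' 0 \<le> \<sigma>' ''tl'' 0 \<and>
    table fs M (rcd \<sigma>') (\<sigma>' ''tl'' 0) \<and> closed fs M (rcd \<sigma>') (\<sigma>' ''tl'' 0) (\<sigma>' ''a'' 0)"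
  show ?thesis
    unfolding bfs_def bfs_time_def
  proof (rule trip_Seq[where Q = ?I, OF trip_run])
    show "?I (run (Seq (Assign ''T'' (Const K) (Const K)) (Seq (set_var ''a'' (Const 0)) (set_var ''tl'' (Const 1)))) \<sigma>)"
      by (auto simp: agree_off_def table_def closed_def T)
    fix \<sigma>1 assume I1: "?I \<sigma>1"
    have "trip (While (Less (var ''a'') (var ''tl'')) (Seq (seqs (map expand trs)) (incr ''a''))) \<sigma>1
      (N * (1 + bcost (Less (var ''a'') (var ''tl'')) + (length trs * expand_time N + 1 + max_time (incr ''a''))) +
       (1 + bcost (Less (var ''a'') (var ''tl''))))
      (\<lambda>\<sigma>'. ?I \<sigma>' \<and> \<not> bval (Less (var ''a'') (var ''tl'')) \<sigma>')"
    \<comment> \<open>The end \<open>''tl''\<close> of the queue moves during the loop, so the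
      measure uses the fixed bound \<open>N\<close> on the number of records instead.\<close>
    proof (rule trip_While[where \<mu> = "\<lambda>\<sigma>'. N - \<sigma>' ''a'' 0"])
      fix \<sigma>' assume I: "?I \<sigma>'" and b: "bval (Less (var ''a'') (var ''tl'')) \<sigma>'"
      have fr: "\<sigma>' ''f'' = fs" "\<sigma>' ''M'' 0 = M" using I by (auto simp: agree_off_def fs_def M_def)
      have "trip (seqs (map expand trs)) \<sigma>' (length trs * expand_time N + 1) (\<lambda>\<sigma>''. grows \<sigma>' \<sigma>'' \<and>
        closed fs M (rcd \<sigma>'') (\<sigma>'' ''tl'' 0) (Suc (\<sigma>' ''a'' 0)))"
        using trip_expand_all[of \<sigma>' N] I b fr N by (simp add: M_def)
      then show "trip (Seq (seqs (map expand trs)) (incr ''a'')) \<sigma>' (length trs * expand_time N + 1 + max_time (incr ''a''))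
        (\<lambda>\<sigma>''. ?I \<sigma>'' \<and> N - \<sigma>'' ''a'' 0 < N - \<sigma>' ''a'' 0)"
      proof (rule trip_Seq, intro trip_run)
        fix \<sigma>'' assume *: "grows \<sigma>' \<sigma>'' \<and> closed fs M (rcd \<sigma>'') (\<sigma>'' ''tl'' 0) (Suc (\<sigma>' ''a'' 0))"
        have a: "\<sigma>'' ''a'' = \<sigma>' ''a''" using * grows_frame by blast
        have g: "agree_off {''T'', ''b'', ''tl''} \<sigma>' \<sigma>''" "\<sigma>' ''tl'' 0 \<le> \<sigma>'' ''tl'' 0"
          "table fs M (rcd \<sigma>'') (\<sigma>'' ''tl'' 0)"
          using * fr by (auto simp: grows_def)
        have "agree_off {''T'', ''b'', ''tl'', ''a''} \<sigma> (run (incr ''a'') \<sigma>'')"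
          using I g(1) by (auto simp: agree_off_def)
        moreover have "\<sigma>'' ''tl'' 0 \<le> N" using table_bound[OF g(3)] N by (simp add: M_def)
        ultimately show "?I (run (incr ''a'') \<sigma>'') \<and> N - run (incr ''a'') \<sigma>'' ''a'' 0 < N - \<sigma>' ''a'' 0"
          using * a g b by simp
      qed simp
    qed (use I1 in auto)
    then show "trip (While (Less (var ''a'') (var ''tl'')) (Seq (seqs (map expand trs)) (incr ''a''))) \<sigma>1
      (N * (1 + bcost (Less (var ''a'') (var ''tl'')) + (length trs * expand_time N + 1 + max_time (incr ''a''))) +
       (1 + bcost (Less (var ''a'') (var ''tl''))))
      (\<lambda>\<sigma>'. agree_off {''T'', ''b'', ''tl'', ''a''} \<sigma> \<sigma>' \<and>
        table (\<sigma> ''f'') (\<sigma> ''M'' 0) (rcd \<sigma>') (\<sigma>' ''tl'' 0) \<and>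
        closed (\<sigma> ''f'') (\<sigma> ''M'' 0) (rcd \<sigma>') (\<sigma>' ''tl'' 0) (\<sigma>' ''tl'' 0))"
      by (rule trip_weaken) (auto simp: fs_def M_def)
  qed simp
qed

section \<open>Records as accepted words\<close>

inductive trace :: "(nat \<Rightarrow> nat \<Rightarrow> nat) \<Rightarrow> nat \<Rightarrow> nat list \<Rightarrow> bool" for r where
  "trace r 0 []"
| "0 < j \<Longrightarrow> trace r (r j (K + 2)) ks \<Longrightarrow> trace r j (ks @ [r j K])"

text \<open>Soundness of the search, by induction along the back pointers.\<close>

lemma trace_exists:
  "table fs M r n \<Longrightarrow> j < n \<Longrightarrow> \<exists>ks. trace r j ks \<and> accepted K trs fs ks \<and> length ks = r j (K + 1) \<and>
     last (K # ks) = r j K \<and> (\<forall>i<K. r j i = count_list ks i)"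
proof (induction j rule: less_induct)
  case (less j)
  show ?case
  proof (cases "j = 0")
    case True
    then show ?thesis
      using table_first[OF less.prems(1)] trace.intros(1) by (intro exI[of _ "[]"]) (auto simp: accepted_def)
  next
    case False
    define p where "p = r j (K + 2)"
    have e: "extends fs M r p j" using table_prev[OF less.prems(1) _ less.prems(2)] False by (simp add: p_def)
    then have p: "p < j" "(r p K, fs (r p (K + 1)), r j K) \<in> set trs"
      "r j (K + 1) = Suc (r p (K + 1))" "\<forall>i<K. r j i = r p i + (if i = r j K then 1 else 0)"
      unfolding extends_def by blast+
    obtain ks where ks: "trace r p ks" "accepted K trs fs ks" "length ks = r p (K + 1)"
      "last (K # ks) = r p K" "\<forall>i<K. r p i = count_list ks i"
      using less.IH[OF p(1) less.prems(1)] p(1) less.prems(2) by auto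
    have "trace r j (ks @ [r j K])" using ks(1) False by (intro trace.intros) (auto simp: p_def)
    moreover have "accepted K trs fs (ks @ [r j K])"
      unfolding accepted_snoc using ks p by auto
    ultimately show ?thesis
      using p ks by (intro exI[of _ "ks @ [r j K]"]) auto
  qed
qed

lemma accepted_letters: "accepted K trs fs ks \<Longrightarrow> set ks \<subseteq> {..<K}"
  using letter by (fastforce simp: accepted_def in_set_conv_nth)

text \<open>Completeness of the search, by induction on the word. The record found may stem from
  another word: Parikh vector and last letter, with the length that they imply, decide how a word
  can be continued and what it costs.\<close>

lemma closed_complete:
  assumes "table fs M r n" "closed fs M r n n"
  shows "accepted K trs fs ks \<Longrightarrow> length ks \<le> M \<Longrightarrow>
    \<exists>j<n. r j K = last (K # ks) \<and> r j (K + 1) = length ks \<and> (\<forall>i<K. r j i = count_list ks i)"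
proof (induction ks rule: rev_induct)
  case Nil
  then show ?case using table_first[OF assms(1)] by (intro exI[of _ 0]) auto
next
  case (snoc k ks)
  obtain j where j: "j < n" "r j K = last (K # ks)" "r j (K + 1) = length ks" "\<forall>i<K. r j i = count_list ks i"
    using snoc by (auto simp: accepted_snoc)
  have "(r j K, fs (r j (K + 1)), k) \<in> set trs" using snoc.prems j by (auto simp: accepted_snoc)
  moreover have "applicable fs M r j (r j K, fs (r j (K + 1)), k)"
    using snoc.prems j(3) by (simp add: applicable_def)
  ultimately have "has_succ r n j k" using assms(2) j(1) by (force simp: closed_def)
  then obtain j' where j': "j' < n" "r j' K = k" "\<forall>i<K. r j' i = r j i + (if i = k then 1 else 0)"
    by (auto simp: has_succ_def)
  have "\<forall>i<K. r j' i = count_list (ks @ [k]) i" using j' j by auto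
  \<comment> \<open>\<open>has_succ\<close> is silent about the length field; it is recovered from
    the counts.\<close>
  moreover from this have "r j' (K + 1) = (\<Sum>i<K. count_list (ks @ [k]) i)"
    using table_sum[OF assms(1) j'(1)] by simp
  moreover have "\<dots> = length (ks @ [k])"
    using accepted_letters[OF snoc.prems(1)] by (intro sum_count_set) auto
  ultimately show ?case using j' by (intro exI[of _ j']) auto
qed

definition pick_time :: "nat \<Rightarrow> nat" where
  "pick_time N = max_time (Seq (set_var ''a'' (Const 0)) (set_var ''bs'' (Const 0))) +
     (N * (1 + bcost (Less (var ''a'') (var ''tl'')) + max_time pick_body) + (1 + bcost (Less (var ''a'') (var ''tl''))))"

lemma trip_pick_best:
  assumes ex: "\<exists>j<\<sigma> ''tl'' 0. rcd \<sigma> j (K + 1) = \<sigma> ''M'' 0" and N: "\<sigma> ''tl'' 0 \<le> N"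
  shows "trip pick_best \<sigma> (pick_time N) (\<lambda>\<sigma>'. agree_off {''a'', ''bs'', ''bj''} \<sigma> \<sigma>' \<and>
    \<sigma>' ''bj'' 0 < \<sigma> ''tl'' 0 \<and> rcd \<sigma> (\<sigma>' ''bj'' 0) (K + 1) = \<sigma> ''M'' 0 \<and>
    (\<forall>j<\<sigma> ''tl'' 0. rcd \<sigma> j (K + 1) = \<sigma> ''M'' 0 \<longrightarrow> F (rcd \<sigma> (\<sigma>' ''bj'' 0)) \<le> F (rcd \<sigma> j)))"
    (is "trip _ _ _ ?Q")
proof -
  define good where "good j \<longleftrightarrow> rcd \<sigma> j (K + 1) = \<sigma> ''M'' 0" for j
  let ?b = "Less (var ''a'') (var ''tl'')"
  let ?I = "\<lambda>\<sigma>'. agree_off {''a'', ''bs'', ''bj''} \<sigma> \<sigma>' \<and> \<sigma>' ''a'' 0 \<le> \<sigma> ''tl'' 0 \<and>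
    (if \<sigma>' ''bs'' 0 = 0 then \<forall>j<\<sigma>' ''a'' 0. \<not> good j
     else \<sigma>' ''bs'' 0 = Suc (F (rcd \<sigma> (\<sigma>' ''bj'' 0))) \<and> \<sigma>' ''bj'' 0 < \<sigma>' ''a'' 0 \<and> good (\<sigma>' ''bj'' 0) \<and>
       (\<forall>j<\<sigma>' ''a'' 0. good j \<longrightarrow> F (rcd \<sigma> (\<sigma>' ''bj'' 0)) \<le> F (rcd \<sigma> j)))"
  show ?thesis
    unfolding pick_best_def pick_time_def
  proof (rule trip_Seq[where Q = ?I, OF trip_run])
    show "?I (run (Seq (set_var ''a'' (Const 0)) (set_var ''bs'' (Const 0))) \<sigma>)"
      by (auto simp: agree_off_def)
    fix \<sigma>1 assume I1: "?I \<sigma>1"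
    have "trip (While ?b pick_body) \<sigma>1
       (N * (1 + bcost ?b + max_time pick_body) + (1 + bcost ?b)) (\<lambda>\<sigma>'. ?I \<sigma>' \<and> \<not> bval ?b \<sigma>')"
    proof (rule trip_While_run[where \<mu> = "\<lambda>\<sigma>'. \<sigma> ''tl'' 0 - \<sigma>' ''a'' 0"])
      fix \<sigma>' assume I: "?I \<sigma>'" and b: "bval ?b \<sigma>'"
      have fr: "\<sigma>' ''T'' = \<sigma> ''T''" "\<sigma>' ''M'' = \<sigma> ''M''" "\<sigma>' ''tl'' = \<sigma> ''tl''"
        using I[THEN conjunct1] by (auto simp: agree_off_def)
      define a where "a = \<sigma>' ''a'' 0"
      have a: "a < \<sigma> ''tl'' 0" using b fr by (simp add: a_def)
      \<comment> \<open>As \<open>''bs''\<close> is shifted by one, the test against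
        \<open>F (rcd \<sigma> a) + 2\<close> says that the stored cost is at most the new
        one.\<close>
      define upd where "upd \<longleftrightarrow> good a \<and> \<not> (0 < \<sigma>' ''bs'' 0 \<and> \<sigma>' ''bs'' 0 < F (rcd \<sigma> a) + 2)"
      have ce: "aval ce \<sigma>' = F (rcd \<sigma> a)" by (simp only: aval_ce fr a_def)
      have r: "run pick_body \<sigma>' = (if upd then \<sigma>'(''bs'' := (\<sigma>' ''bs'')(0 := F (rcd \<sigma> a) + 1),
          ''bj'' := (\<sigma>' ''bj'')(0 := a), ''a'' := (\<sigma>' ''a'')(0 := Suc a))
        else \<sigma>'(''a'' := (\<sigma>' ''a'')(0 := Suc a)))"
        using fr ce by (cases "\<sigma>' ''bs'' 0 = 0") (simp_all add: pick_body_def upd_def good_def a_def)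
      have "agree_off {''a'', ''bs'', ''bj''} \<sigma> (run pick_body \<sigma>')"
        using I[THEN conjunct1] unfolding r by (simp add: agree_off_def)
      moreover have "run pick_body \<sigma>' ''a'' 0 = Suc a" by (simp add: r)
      moreover have "if run pick_body \<sigma>' ''bs'' 0 = 0 then \<forall>j<Suc a. \<not> good j
        else run pick_body \<sigma>' ''bs'' 0 = Suc (F (rcd \<sigma> (run pick_body \<sigma>' ''bj'' 0))) \<and>
          run pick_body \<sigma>' ''bj'' 0 < Suc a \<and> good (run pick_body \<sigma>' ''bj'' 0) \<and>
          (\<forall>j<Suc a. good j \<longrightarrow> F (rcd \<sigma> (run pick_body \<sigma>' ''bj'' 0)) \<le> F (rcd \<sigma> j))"
      proof (cases upd)
        case True
        have g: "good a" using True by (simp add: upd_def)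
        have le: "F (rcd \<sigma> a) \<le> F (rcd \<sigma> j)" if "j < Suc a" "good j" for j
        proof (cases "j = a")
          case False
          then have ja: "j < \<sigma>' ''a'' 0" using that by (simp add: a_def)
          show ?thesis
          proof (cases "\<sigma>' ''bs'' 0 = 0")
            case False
            then have "F (rcd \<sigma> (\<sigma>' ''bj'' 0)) \<le> F (rcd \<sigma> j)" "\<sigma>' ''bs'' 0 = Suc (F (rcd \<sigma> (\<sigma>' ''bj'' 0)))"
              using I ja that(2) by simp_all
            then show ?thesis using True False by (simp add: upd_def)
          qed (use I ja that(2) in simp)
        qed simp
        have "run pick_body \<sigma>' ''bs'' 0 = Suc (F (rcd \<sigma> a))" "run pick_body \<sigma>' ''bj'' 0 = a"
          using True by (simp_all add: r)
        then show ?thesis using g le by simp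
      next
        case False
        have [simp]: "run pick_body \<sigma>' ''bs'' 0 = \<sigma>' ''bs'' 0" "run pick_body \<sigma>' ''bj'' 0 = \<sigma>' ''bj'' 0"
          using False by (simp_all add: r)
        show ?thesis
        proof (cases "\<sigma>' ''bs'' 0 = 0")
          case True
          then have "\<not> good a" using False by (simp add: upd_def)
          then show ?thesis using I True by (simp add: less_Suc_eq a_def)
        next
          case nz: False
          then have *: "\<sigma>' ''bs'' 0 = Suc (F (rcd \<sigma> (\<sigma>' ''bj'' 0)))" "\<sigma>' ''bj'' 0 < a" "good (\<sigma>' ''bj'' 0)"
            "\<forall>j<a. good j \<longrightarrow> F (rcd \<sigma> (\<sigma>' ''bj'' 0)) \<le> F (rcd \<sigma> j)"
            using I by (simp_all add: a_def)
          have "good a \<Longrightarrow> F (rcd \<sigma> (\<sigma>' ''bj'' 0)) \<le> F (rcd \<sigma> a)"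
            using False *(1) by (simp add: upd_def)
          then show ?thesis using * by (simp add: less_Suc_eq)
        qed
      qed
      ultimately show "?I (run pick_body \<sigma>') \<and>
          \<sigma> ''tl'' 0 - run pick_body \<sigma>' ''a'' 0 < \<sigma> ''tl'' 0 - \<sigma>' ''a'' 0"
        using a unfolding a_def[symmetric] by (metis Suc_leI diff_less_mono2 lessI)
    qed (use N I1 in \<open>simp_all add: pick_body_def\<close>)
    then show "trip (While ?b pick_body) \<sigma>1 (N * (1 + bcost ?b + max_time pick_body) + (1 + bcost ?b)) ?Q"
    proof (rule trip_weaken)
      fix \<sigma>' assume *: "?I \<sigma>' \<and> \<not> bval ?b \<sigma>'"
      have **: "agree_off {''a'', ''bs'', ''bj''} \<sigma> \<sigma>'" "\<sigma>' ''a'' 0 \<le> \<sigma> ''tl'' 0" using * by blast+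
      then have a: "\<sigma>' ''a'' 0 = \<sigma> ''tl'' 0" using * by (simp add: agree_off_def)
      obtain j where "j < \<sigma> ''tl'' 0" "good j" using ex by (auto simp: good_def)
      \<comment> \<open>The value 0 would mean that no record of full length has been met.\<close>
      then have "\<sigma>' ''bs'' 0 \<noteq> 0" using * a by metis
      then show "?Q \<sigma>'" using * ** a by (simp add: good_def)
    qed simp
  qed simp
qed

definition trace_time :: "nat \<Rightarrow> nat" where
  "trace_time M = max_time (set_var ''i'' (var ''M'')) +
     (M * (1 + bcost (Less (Const 0) (var ''i'')) + max_time trace_body) + (1 + bcost (Less (Const 0) (var ''i''))))"

lemma trip_trace_back:
  assumes tr: "trace (rcd \<sigma>) (\<sigma> ''bj'' 0) ks" and len: "length ks = \<sigma> ''M'' 0"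
  shows "trip trace_back \<sigma> (trace_time (\<sigma> ''M'' 0)) (\<lambda>\<sigma>'. agree_off {''i'', ''w'', ''bj''} \<sigma> \<sigma>' \<and>
    (\<forall>i<\<sigma> ''M'' 0. \<sigma>' ''w'' i = ks ! i))" (is "trip _ _ _ ?Q")
proof -
  define M where "M = \<sigma> ''M'' 0"
  let ?b = "Less (Const 0) (var ''i'')"
  let ?I = "\<lambda>\<sigma>'. agree_off {''i'', ''w'', ''bj''} \<sigma> \<sigma>' \<and> \<sigma>' ''i'' 0 \<le> M \<and>
    trace (rcd \<sigma>) (\<sigma>' ''bj'' 0) (take (\<sigma>' ''i'' 0) ks) \<and> (\<forall>i. \<sigma>' ''i'' 0 \<le> i \<and> i < M \<longrightarrow> \<sigma>' ''w'' i = ks ! i)"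
  show ?thesis
    unfolding trace_back_def trace_time_def M_def[symmetric]
  proof (rule trip_Seq[where Q = ?I, OF trip_run])
    show "?I (run (set_var ''i'' (var ''M'')) \<sigma>)"
      using assms by (auto simp: agree_off_def M_def)
    fix \<sigma>1 assume I1: "?I \<sigma>1"
    have "trip (While ?b trace_body) \<sigma>1
       (M * (1 + bcost ?b + max_time trace_body) + (1 + bcost ?b)) (\<lambda>\<sigma>'. ?I \<sigma>' \<and> \<not> bval ?b \<sigma>')"
    proof (rule trip_While_run[where \<mu> = "\<lambda>\<sigma>'. \<sigma>' ''i'' 0"])
      fix \<sigma>' assume I: "?I \<sigma>'" and b: "bval ?b \<sigma>'"
      have fr: "\<sigma>' ''T'' = \<sigma> ''T''" using I by (auto simp: agree_off_def)
      define i j where "i = \<sigma>' ''i'' 0 - 1" and "j = \<sigma>' ''bj'' 0"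
      have i: "\<sigma>' ''i'' 0 = Suc i" "i < M" using b I by (auto simp: i_def)
      then have take: "take (Suc i) ks = take i ks @ [ks ! i]"
        using len by (simp add: M_def take_Suc_conv_app_nth)
      have "trace (rcd \<sigma>) j (take i ks @ [ks ! i])" using I i take by (simp add: j_def)
      then have t: "trace (rcd \<sigma>) (rcd \<sigma> j (K + 2)) (take i ks)" "rcd \<sigma> j K = ks ! i"
        by (cases; simp)+
      have r: "run trace_body \<sigma>' = \<sigma>'(''i'' := (\<sigma>' ''i'')(0 := i), ''w'' := (\<sigma>' ''w'')(i := rcd \<sigma> j K),
        ''bj'' := (\<sigma>' ''bj'')(0 := rcd \<sigma> j (K + 2)))"
        using fr i by (simp add: trace_body_def j_def)
      show "?I (run trace_body \<sigma>') \<and> run trace_body \<sigma>' ''i'' 0 < \<sigma>' ''i'' 0"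
        using I i t unfolding r by (auto simp: agree_off_def)
    qed (use I1 in \<open>simp_all add: trace_body_def\<close>)
    then show "trip (While ?b trace_body) \<sigma>1 (M * (1 + bcost ?b + max_time trace_body) + (1 + bcost ?b))
      (\<lambda>\<sigma>'. agree_off {''i'', ''w'', ''bj''} \<sigma> \<sigma>' \<and> (\<forall>i<M. \<sigma>' ''w'' i = ks ! i))"
      by (rule trip_weaken) auto
  qed simp
qed

definition search_vars :: "vname set" where
  "search_vars = {''T'', ''b'', ''tl'', ''a'', ''bs'', ''bj'', ''i'', ''w''}"

text \<open>A cheapest record of full length is as good as a cheapest word, because \<open>F\<close>
  sees only the Parikh vector. The word \<open>ks0\<close> guarantees that there is a record to
  pick.\<close>

lemma trip_search:
  assumes T: "\<sigma> ''T'' = (\<lambda>_. 0)" and N: "(\<sigma> ''M'' 0 + K + 1) ^ (K + 1) \<le> N"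
    and ex: "accepted K trs (\<sigma> ''f'') ks0" "length ks0 = \<sigma> ''M'' 0"
  shows "trip search \<sigma> (bfs_time N + (pick_time N + trace_time (\<sigma> ''M'' 0))) (\<lambda>\<sigma>'. agree_off search_vars \<sigma> \<sigma>' \<and>
    (\<exists>ks. accepted K trs (\<sigma> ''f'') ks \<and> length ks = \<sigma> ''M'' 0 \<and> (\<forall>i<\<sigma> ''M'' 0. \<sigma>' ''w'' i = ks ! i) \<and>
       (\<forall>ks'. accepted K trs (\<sigma> ''f'') ks' \<and> length ks' = \<sigma> ''M'' 0 \<longrightarrow> F (count_list ks) \<le> F (count_list ks'))))"
    (is "trip _ _ _ ?Q")
  unfolding search_def
proof (rule trip_Seq[OF trip_bfs[OF T N]], elim conjE)
  fix \<sigma>1 :: state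
  define fs M n r where "fs = \<sigma> ''f''" and "M = \<sigma> ''M'' 0" and "n = \<sigma>1 ''tl'' 0" and "r = rcd \<sigma>1"
  assume 1: "agree_off {''T'', ''b'', ''tl'', ''a''} \<sigma> \<sigma>1"
    and "table (\<sigma> ''f'') (\<sigma> ''M'' 0) (rcd \<sigma>1) (\<sigma>1 ''tl'' 0)"
    and "closed (\<sigma> ''f'') (\<sigma> ''M'' 0) (rcd \<sigma>1) (\<sigma>1 ''tl'' 0) (\<sigma>1 ''tl'' 0)"
  then have tab: "table fs M r n" and cl: "closed fs M r n n"
    by (simp_all add: fs_def M_def n_def r_def)
  have fr1: "\<sigma>1 ''M'' 0 = M" using 1 by (simp add: agree_off_def M_def)
  have complete: "\<exists>j<n. r j (K + 1) = M \<and> F (r j) = F (count_list ks)"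
    if acc: "accepted K trs fs ks" "length ks = M" for ks
  proof -
    obtain j where j: "j < n" "r j (K + 1) = M" "\<forall>i<K. r j i = count_list ks i"
      using closed_complete[OF tab cl acc(1)] acc(2) by auto
    moreover from j(3) have "F (r j) = F (count_list ks)" by (intro F_cong) simp
    ultimately show ?thesis by blast
  qed
  have nN: "\<sigma>1 ''tl'' 0 \<le> N" using table_bound[OF tab] N by (simp add: n_def M_def)
  have "\<exists>j<\<sigma>1 ''tl'' 0. rcd \<sigma>1 j (K + 1) = \<sigma>1 ''M'' 0"
    using complete[of ks0] ex unfolding fr1 by (auto simp: fs_def M_def r_def n_def)
  note best = trip_pick_best[OF this nN]
  show "trip (Seq pick_best trace_back) \<sigma>1 (pick_time N + trace_time (\<sigma> ''M'' 0)) ?Q"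
  proof (rule trip_Seq[OF best], elim conjE)
    fix \<sigma>2 :: state
    define j where "j = \<sigma>2 ''bj'' 0"
    assume 2: "agree_off {''a'', ''bs'', ''bj''} \<sigma>1 \<sigma>2" and "\<sigma>2 ''bj'' 0 < \<sigma>1 ''tl'' 0"
      "rcd \<sigma>1 (\<sigma>2 ''bj'' 0) (K + 1) = \<sigma>1 ''M'' 0"
      "\<forall>j<\<sigma>1 ''tl'' 0. rcd \<sigma>1 j (K + 1) = \<sigma>1 ''M'' 0 \<longrightarrow> F (rcd \<sigma>1 (\<sigma>2 ''bj'' 0)) \<le> F (rcd \<sigma>1 j)"
    then have j: "j < n" "r j (K + 1) = M" "\<forall>j'<n. r j' (K + 1) = M \<longrightarrow> F (r j) \<le> F (r j')"
      unfolding fr1 by (simp_all add: j_def n_def r_def)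
    have fr2: "\<sigma>2 ''M'' 0 = M" "\<sigma>2 ''T'' = \<sigma>1 ''T''" using 2 fr1 by (auto simp: agree_off_def)
    obtain ks where ks: "trace r j ks" "accepted K trs fs ks" "length ks = M" "\<forall>i<K. r j i = count_list ks i"
      using trace_exists[OF tab j(1)] j(2) by auto
    have "F (r j) = F (count_list ks)" using ks(4) by (intro F_cong) simp
    then have opt: "F (count_list ks) \<le> F (count_list ks')" if "accepted K trs fs ks'" "length ks' = M" for ks'
      using complete[OF that] j(3) by force
    have "trip trace_back \<sigma>2 (trace_time (\<sigma>2 ''M'' 0)) (\<lambda>\<sigma>'. agree_off {''i'', ''w'', ''bj''} \<sigma>2 \<sigma>' \<and>
      (\<forall>i<\<sigma>2 ''M'' 0. \<sigma>' ''w'' i = ks ! i))"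
      using ks fr2 by (intro trip_trace_back) (auto simp: r_def j_def)
    then show "trip trace_back \<sigma>2 (trace_time (\<sigma> ''M'' 0)) ?Q"
      unfolding fr2 M_def[symmetric]
    proof (rule trip_weaken)
      fix \<sigma>' assume 3: "agree_off {''i'', ''w'', ''bj''} \<sigma>2 \<sigma>' \<and> (\<forall>i<M. \<sigma>' ''w'' i = ks ! i)"
      have "agree_off search_vars \<sigma> \<sigma>'"
        using 1 2 3 by (simp add: search_vars_def agree_off_def)
      then show "agree_off search_vars \<sigma> \<sigma>' \<and>
        (\<exists>ks. accepted K trs (\<sigma> ''f'') ks \<and> length ks = M \<and> (\<forall>i<M. \<sigma>' ''w'' i = ks ! i) \<and>
        (\<forall>ks'. accepted K trs (\<sigma> ''f'') ks' \<and> length ks' = M \<longrightarrow> F (count_list ks) \<le> F (count_list ks')))"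
        using 3 ks opt by (auto simp: fs_def)
    qed simp
  qed
qed

end

section \<open>Listing the chains\<close>

text \<open>Shifted by one, as 0 is a possible name of a node.\<close>

definition parent_code :: "(nat \<times> nat) set \<Rightarrow> nat \<Rightarrow> nat" where
  "parent_code E v = (if \<exists>u. (u, v) \<in> E then Suc (THE u. (u, v) \<in> E) else 0)"

lemma parent_code_empty [simp]: "parent_code {} = (\<lambda>_. 0)"
  by (simp add: parent_code_def fun_eq_iff)

lemma parent_code_0: "parent_code E v = 0 \<longleftrightarrow> (\<forall>u. (u, v) \<notin> E)"
  by (simp add: parent_code_def)

lemma parent_code_Suc:
  assumes "\<And>u u' v. (u, v) \<in> E \<Longrightarrow> (u', v) \<in> E \<Longrightarrow> u = u'"
  shows "parent_code E v = Suc u \<longleftrightarrow> (u, v) \<in> E"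
proof (cases "\<exists>u. (u, v) \<in> E")
  case True
  then obtain w where w: "(w, v) \<in> E" by auto
  then have "(THE u. (u, v) \<in> E) = w" using assms by blast
  then show ?thesis using w assms by (auto simp: parent_code_def)
qed (auto simp: parent_code_def)

lemma parent_code_insert:
  assumes "\<And>u'. (u', v) \<in> E \<Longrightarrow> u' = u"
  shows "parent_code (insert (u, v) E) = (parent_code E)(v := Suc u)"
proof
  fix w
  have "(THE u'. u' = u \<or> (u', v) \<in> E) = u" using assms by blast
  then show "parent_code (insert (u, v) E) w = ((parent_code E)(v := Suc u)) w"
    by (auto simp: parent_code_def)
qed

text \<open>
  \<open>z\<close> is \<open>Suc v0\<close> if there is a node \<open>v0\<close> connecting the chains, and 0 otherwise; so
  the nodes with parent code \<open>z\<close> are the first nodes of the chains in both cases.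
\<close>

definition chains_below :: "nat set \<Rightarrow> (nat \<times> nat) set \<Rightarrow> nat \<Rightarrow> bool" where
  "chains_below V E z \<longleftrightarrow> finite V \<and> E \<subseteq> V \<times> V \<and> acyclic E \<and>
     (\<forall>u u' v. (u, v) \<in> E \<longrightarrow> (u', v) \<in> E \<longrightarrow> u = u') \<and>
     (\<forall>u v v'. (u, v) \<in> E \<longrightarrow> (u, v') \<in> E \<longrightarrow> Suc u \<noteq> z \<longrightarrow> v = v') \<and>
     (z \<noteq> 0 \<longrightarrow> z - 1 \<in> V \<and> (\<forall>u. (u, z - 1) \<notin> E) \<and> (\<forall>v\<in>V. Suc v \<noteq> z \<longrightarrow> (\<exists>u. (u, v) \<in> E)))"

lemma card_le_1D: "card A \<le> 1 \<Longrightarrow> finite A \<Longrightarrow> x \<in> A \<Longrightarrow> y \<in> A \<Longrightarrow> x = y"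
  by (metis One_nat_def card_le_Suc0_iff_eq)

text \<open>\<open>card\<close> is 0 on infinite sets, so the degree bounds become effective only
  together with the finiteness of \<open>V\<close>.\<close>

lemma chain_dag_degrees:
  assumes "chain_dag V E"
  shows "(u, v) \<in> E \<Longrightarrow> (u', v) \<in> E \<Longrightarrow> u = u'" "(u, v) \<in> E \<Longrightarrow> (u, v') \<in> E \<Longrightarrow> v = v'"
proof -
  have V: "finite V" "E \<subseteq> V \<times> V" using assms by (auto simp: chain_dag_def dag_def)
  have fin: "finite {u. (u, v) \<in> E}" "finite {w. (v, w) \<in> E}" for v
    using V by (auto intro: finite_subset[OF _ V(1)])
  have card: "card {u. (u, v) \<in> E} \<le> 1" "card {w. (v, w) \<in> E} \<le> 1" if "v \<in> V" for v
    using assms that by (auto simp: chain_dag_def)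
  show "u = u'" if "(u, v) \<in> E" "(u', v) \<in> E"
  proof -
    have "v \<in> V" using that V(2) by blast
    then show ?thesis using card_le_1D[OF card(1) fin(1), of v u u'] that by simp
  qed
  show "v = v'" if "(u, v) \<in> E" "(u, v') \<in> E"
  proof -
    have "u \<in> V" using that V(2) by blast
    then show ?thesis using card_le_1D[OF card(2) fin(2), of u v v'] that by simp
  qed
qed

lemma chain_dag_chains_below: "chain_dag V E \<Longrightarrow> chains_below V E 0"
  using chain_dag_degrees[of V E] unfolding chains_below_def chain_dag_def dag_def
  by (intro conjI) blast+

lemma connected_chain_dag_chains_below:
  assumes "connected_chain_dag V E"
  obtains v0 where "chains_below V E (Suc v0)"
proof -
  obtain V' E' v0 where *: "chain_dag V' E'" "v0 \<notin> V'" "V = insert v0 V'"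
    and E: "E = E' \<union> {(v0, v) | v. v \<in> V' \<and> (\<forall>u. (u, v) \<notin> E')}"
    using assms unfolding connected_chain_dag_def by (elim exE conjE)
  have V': "finite V'" "E' \<subseteq> V' \<times> V'" "acyclic E'" using *(1) by (auto simp: chain_dag_def dag_def)
  have no_in: "(u, v0) \<notin> E" for u using *(2) V'(2) E by auto
  have "acyclic E"
    unfolding acyclic_def
  proof (intro allI notI)
    fix x assume x: "(x, x) \<in> E\<^sup>+"
    \<comment> \<open>No edge enters \<open>v0\<close>, so a path that starts elsewhere never visits
      \<open>v0\<close> and consists of edges of \<open>E'\<close>.\<close>
    have "a \<noteq> v0 \<longrightarrow> (a, b) \<in> E'\<^sup>+" if "(a, b) \<in> E\<^sup>+" for a b
      using that
    proof (induction rule: trancl_induct)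
      case (base b)
      then show ?case using E by auto
    next
      case (step b c)
      then have "b \<noteq> v0" using no_in by (metis tranclD2)
      then show ?case using step E by (auto intro: trancl_into_trancl)
    qed
    moreover have "x \<noteq> v0" using x no_in by (metis tranclD2)
    ultimately show False using x V'(3) by (auto simp: acyclic_def)
  qed
  moreover have "u = u'" if "(u, v) \<in> E" "(u', v) \<in> E" for u u' v
    using that E chain_dag_degrees(1)[OF *(1), of u v u'] by auto
  moreover have "v = v'" if "(u, v) \<in> E" "(u, v') \<in> E" "Suc u \<noteq> Suc v0" for u v v'
    using that E chain_dag_degrees(2)[OF *(1), of u v v'] by auto
  moreover have "\<exists>u. (u, v) \<in> E" if "v \<in> V" "Suc v \<noteq> Suc v0" for v
    using that E *(3) by auto
  moreover have "finite V" "E \<subseteq> V \<times> V" using * V' E by auto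
  ultimately have "chains_below V E (Suc v0)"
    unfolding chains_below_def using no_in *(3) by simp
  then show thesis by (rule that)
qed

text \<open>Normal form of the graph: the chains are concatenated into \<open>xs\<close>, and
  \<open>st\<close> marks the positions where a chain begins. From here on, positions replace
  paths.\<close>

definition layout :: "bool \<Rightarrow> nat \<Rightarrow> nat list \<Rightarrow> (nat \<Rightarrow> bool) \<Rightarrow> nat set \<Rightarrow> (nat \<times> nat) set \<Rightarrow> bool" where
  "layout conn v0 xs st V E \<longleftrightarrow> distinct xs \<and> (xs \<noteq> [] \<longrightarrow> st 0) \<and> (conn \<longrightarrow> v0 \<notin> set xs) \<and>
     V = (if conn then insert v0 (set xs) else set xs) \<and>
     E = {(xs ! (i - 1), xs ! i) | i. 0 < i \<and> i < length xs \<and> \<not> st i} \<union>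
         (if conn then {(v0, xs ! i) | i. i < length xs \<and> st i} else {})"

section \<open>The commands that list the chains\<close>

definition read_parents_body :: com where
  "read_parents_body = Seq (Assign ''par'' (Cell ''dst'' (var ''e'')) (Plus (Cell ''src'' (var ''e'')) (Const 1))) (incr ''e'')"

definition read_parents :: com where
  "read_parents = Seq (set_var ''e'' (Const 0)) (While (Less (var ''e'') (var ''m'')) read_parents_body)"

definition find_root_body :: com where
  "find_root_body = Seq (If (Equal (Cell ''par'' (Cell ''node'' (var ''j''))) (Const 0))
             (set_var ''z'' (Plus (Cell ''node'' (var ''j'')) (Const 1))) Skip)
          (incr ''j'')"

definition find_root :: com where
  "find_root = Seq (set_var ''j'' (Const 0)) (While (Less (var ''j'') (var ''n'')) find_root_body)"

definition read_children_body :: com where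
  "read_children_body = Seq (If (Equal (Plus (Cell ''src'' (var ''e'')) (Const 1)) (var ''z'')) Skip
            (Assign ''nxt'' (Cell ''src'' (var ''e'')) (Plus (Cell ''dst'' (var ''e'')) (Const 1))))
          (incr ''e'')"

definition read_children :: com where
  "read_children = Seq (set_var ''e'' (Const 0)) (While (Less (var ''e'') (var ''m'')) read_children_body)"

text \<open>\<open>''u''\<close> holds the node to be listed next, plus one, or 0 if another chain
  has to be found. \<open>''fl''\<close> is the flag of that node: 1 at the beginning of a chain, 2
  inside it.\<close>

definition walk_body :: com where
  "walk_body = If (Equal (var ''u'') (Const 0))
     (Seq (If (Equal (Cell ''par'' (Cell ''node'' (var ''j''))) (var ''z''))
             (Seq (set_var ''u'' (Plus (Cell ''node'' (var ''j'')) (Const 1))) (set_var ''fl'' (Const 1))) Skip)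
          (incr ''j''))
     (Seq (Assign ''ord'' (var ''M'') (Minus (var ''u'') (Const 1)))
     (Seq (Assign ''f'' (var ''M'') (var ''fl''))
     (Seq (set_var ''fl'' (Const 2))
     (Seq (incr ''M'') (set_var ''u'' (Cell ''nxt'' (Minus (var ''u'') (Const 1))))))))"

text \<open>Index 0 of \<open>''ord''\<close> and \<open>''f''\<close> is reserved for the head of
  the word, so the nodes of the chains start at index 1. Without a connecting node, truncated
  subtraction leaves 0 in cell 0 as a filler.\<close>

definition walk_init :: com where
  "walk_init = Seq (Assign ''ord'' (Const 0) (Minus (var ''z'') (Const 1)))
     (Seq (set_var ''j'' (Const 0)) (set_var ''M'' (Const 1)))"

definition walk_test :: bexp where
  "walk_test = Not (And (Equal (var ''u'') (Const 0)) (Not (Less (var ''j'') (var ''n''))))"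

definition walk :: com where
  "walk = Seq walk_init (While walk_test walk_body)"

definition preprocess :: "bool \<Rightarrow> com" where
  "preprocess conn = Seq read_parents (Seq (if conn then find_root else Skip) (Seq read_children walk))"

abbreviation loop_time :: "nat \<Rightarrow> bexp \<Rightarrow> com \<Rightarrow> nat" where
  "loop_time N b c \<equiv> N * (1 + bcost b + max_time c) + (1 + bcost b)"

lemma trip_read_parents:
  assumes m: "\<sigma> ''m'' 0 = length es" and src: "\<sigma> ''src'' = list_cells (map fst es)" and dst: "\<sigma> ''dst'' = list_cells (map snd es)"
    and par: "\<sigma> ''par'' = (\<lambda>_. 0)" and in1: "\<And>u u' v. (u, v) \<in> set es \<Longrightarrow> (u', v) \<in> set es \<Longrightarrow> u = u'"
    and N: "length es \<le> N"
  shows "trip read_parents \<sigma> (max_time (set_var ''e'' (Const 0)) + loop_time N (Less (var ''e'') (var ''m'')) read_parents_body)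
    (\<lambda>\<sigma>'. agree_off {''e'', ''par''} \<sigma> \<sigma>' \<and> \<sigma>' ''par'' = parent_code (set es))"
proof -
  let ?b = "Less (var ''e'') (var ''m'')"
  let ?I = "\<lambda>\<sigma>'. agree_off {''e'', ''par''} \<sigma> \<sigma>' \<and> \<sigma>' ''e'' 0 \<le> length es \<and>
    \<sigma>' ''par'' = parent_code (set (take (\<sigma>' ''e'' 0) es))"
  show ?thesis
    unfolding read_parents_def
  proof (rule trip_Seq[where Q = ?I, OF trip_run])
    show "?I (run (set_var ''e'' (Const 0)) \<sigma>)" by (simp add: agree_off_def par)
    fix \<sigma>1 assume I1: "?I \<sigma>1"
    have "trip (While ?b read_parents_body) \<sigma>1 (loop_time N ?b read_parents_body) (\<lambda>\<sigma>'. ?I \<sigma>' \<and> \<not> bval ?b \<sigma>')"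
    proof (rule trip_While_run[where \<mu> = "\<lambda>\<sigma>'. length es - \<sigma>' ''e'' 0"])
      fix \<sigma>' assume I: "?I \<sigma>'" and b: "bval ?b \<sigma>'"
      have fr: "\<sigma>' ''m'' = \<sigma> ''m''" "\<sigma>' ''src'' = \<sigma> ''src''" "\<sigma>' ''dst'' = \<sigma> ''dst''"
        using I[THEN conjunct1] by (simp_all add: agree_off_def)
      define e where "e = \<sigma>' ''e'' 0"
      obtain u v where uv: "es ! e = (u, v)" by fastforce
      have e: "e < length es" using b fr m by (simp add: e_def)
      then have uv_in: "(u, v) \<in> set es" using uv nth_mem by metis
      have "run read_parents_body \<sigma>' = \<sigma>'(''par'' := (\<sigma>' ''par'')(v := Suc u), ''e'' := (\<sigma>' ''e'')(0 := Suc e))"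
        using e uv fr src dst by (simp add: read_parents_body_def list_cells_def flip: e_def)
      \<comment> \<open>The node \<open>v\<close> has one predecessor, so no other value can have
        been stored for it.\<close>
      moreover have "parent_code (set (take (Suc e) es)) = (parent_code (set (take e es)))(v := Suc u)"
        using e uv in1 uv_in
        by (simp add: take_Suc_conv_app_nth) (rule parent_code_insert, meson in_set_takeD)
      ultimately show "?I (run read_parents_body \<sigma>') \<and> length es - run read_parents_body \<sigma>' ''e'' 0 < length es - \<sigma>' ''e'' 0"
        using I e by (simp add: agree_off_def flip: e_def)
    qed (use I1 N in \<open>simp_all add: read_parents_body_def\<close>)
    then show "trip (While ?b read_parents_body) \<sigma>1 (loop_time N ?b read_parents_body)
      (\<lambda>\<sigma>'. agree_off {''e'', ''par''} \<sigma> \<sigma>' \<and> \<sigma>' ''par'' = parent_code (set es))"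
    proof (rule trip_weaken)
      fix \<sigma>' assume *: "?I \<sigma>' \<and> \<not> bval ?b \<sigma>'"
      then have "\<sigma>' ''m'' = \<sigma> ''m''" by (simp add: agree_off_def)
      then have "\<sigma>' ''e'' 0 = length es" using * m by simp
      then show "agree_off {''e'', ''par''} \<sigma> \<sigma>' \<and> \<sigma>' ''par'' = parent_code (set es)" using * by simp
    qed simp
  qed simp
qed

text \<open>Successors are predecessors in the reversed graph, so \<open>parent_code\<close>
  describes \<open>''nxt''\<close> as well. Edges of the connecting node are skipped, since it may
  have several successors.\<close>

lemma trip_read_children:
  assumes m: "\<sigma> ''m'' 0 = length es" and src: "\<sigma> ''src'' = list_cells (map fst es)" and dst: "\<sigma> ''dst'' = list_cells (map snd es)"
    and nxt: "\<sigma> ''nxt'' = (\<lambda>_. 0)"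
    and out1: "\<And>u v v'. (u, v) \<in> set es \<Longrightarrow> (u, v') \<in> set es \<Longrightarrow> Suc u \<noteq> \<sigma> ''z'' 0 \<Longrightarrow> v = v'"
    and N: "length es \<le> N"
  shows "trip read_children \<sigma> (max_time (set_var ''e'' (Const 0)) + loop_time N (Less (var ''e'') (var ''m'')) read_children_body)
    (\<lambda>\<sigma>'. agree_off {''e'', ''nxt''} \<sigma> \<sigma>' \<and> \<sigma>' ''nxt'' = parent_code {(v, u). (u, v) \<in> set es \<and> Suc u \<noteq> \<sigma> ''z'' 0})"
proof -
  define z where "z = \<sigma> ''z'' 0"
  let ?b = "Less (var ''e'') (var ''m'')"
  let ?S = "\<lambda>e. {(v, u). (u, v) \<in> set (take e es) \<and> Suc u \<noteq> z}"
  let ?I = "\<lambda>\<sigma>'. agree_off {''e'', ''nxt''} \<sigma> \<sigma>' \<and> \<sigma>' ''e'' 0 \<le> length es \<and>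
    \<sigma>' ''nxt'' = parent_code (?S (\<sigma>' ''e'' 0))"
  show ?thesis
    unfolding read_children_def z_def[symmetric]
  proof (rule trip_Seq[where Q = ?I, OF trip_run])
    show "?I (run (set_var ''e'' (Const 0)) \<sigma>)" by (simp add: agree_off_def nxt)
    fix \<sigma>1 assume I1: "?I \<sigma>1"
    have "trip (While ?b read_children_body) \<sigma>1 (loop_time N ?b read_children_body) (\<lambda>\<sigma>'. ?I \<sigma>' \<and> \<not> bval ?b \<sigma>')"
    proof (rule trip_While_run[where \<mu> = "\<lambda>\<sigma>'. length es - \<sigma>' ''e'' 0"])
      fix \<sigma>' assume I: "?I \<sigma>'" and b: "bval ?b \<sigma>'"
      have fr: "\<sigma>' ''m'' = \<sigma> ''m''" "\<sigma>' ''src'' = \<sigma> ''src''" "\<sigma>' ''dst'' = \<sigma> ''dst''" "\<sigma>' ''z'' 0 = z"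
        using I[THEN conjunct1] by (simp_all add: agree_off_def z_def)
      define e where "e = \<sigma>' ''e'' 0"
      obtain u v where uv: "es ! e = (u, v)" by fastforce
      have e: "e < length es" using b fr m by (simp add: e_def)
      then have uv_in: "(u, v) \<in> set es" using uv nth_mem by metis
      have "run read_children_body \<sigma>' = \<sigma>'(''nxt'' := if Suc u = z then \<sigma>' ''nxt'' else (\<sigma>' ''nxt'')(u := Suc v), ''e'' := (\<sigma>' ''e'')(0 := Suc e))"
        using e uv fr src dst by (simp add: read_children_body_def list_cells_def flip: e_def)
      moreover have "parent_code (?S (Suc e)) = (if Suc u = z then parent_code (?S e) else (parent_code (?S e))(u := Suc v))"
      proof (cases "Suc u = z")
        case True
        then have "?S (Suc e) = ?S e" using e uv by (auto simp: take_Suc_conv_app_nth)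
        then show ?thesis using True by simp
      next
        case False
        then have S: "?S (Suc e) = insert (v, u) (?S e)" using e uv by (auto simp: take_Suc_conv_app_nth)
        have "parent_code (insert (v, u) (?S e)) = (parent_code (?S e))(u := Suc v)"
        proof (rule parent_code_insert)
          fix v' assume "(v', u) \<in> ?S e"
          then have "(u, v') \<in> set es" by (auto dest: in_set_takeD)
          then show "v' = v" using out1[of u v' v] uv_in False by (simp add: z_def)
        qed
        then show ?thesis using False S by simp
      qed
      ultimately show "?I (run read_children_body \<sigma>') \<and> length es - run read_children_body \<sigma>' ''e'' 0 < length es - \<sigma>' ''e'' 0"
        using I e by (simp add: agree_off_def flip: e_def)
    qed (use I1 N in \<open>simp_all add: read_children_body_def\<close>)
    then show "trip (While ?b read_children_body) \<sigma>1 (loop_time N ?b read_children_body)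
      (\<lambda>\<sigma>'. agree_off {''e'', ''nxt''} \<sigma> \<sigma>' \<and> \<sigma>' ''nxt'' = parent_code {(v, u). (u, v) \<in> set es \<and> Suc u \<noteq> z})"
    proof (rule trip_weaken)
      fix \<sigma>' assume *: "?I \<sigma>' \<and> \<not> bval ?b \<sigma>'"
      then have "\<sigma>' ''m'' = \<sigma> ''m''" by (simp add: agree_off_def)
      then have "\<sigma>' ''e'' 0 = length es" using * m by simp
      then show "agree_off {''e'', ''nxt''} \<sigma> \<sigma>' \<and> \<sigma>' ''nxt'' = parent_code {(v, u). (u, v) \<in> set es \<and> Suc u \<noteq> z}"
        using * by simp
    qed simp
  qed simp
qed

lemma trip_find_root:
  assumes n: "\<sigma> ''n'' 0 = length vs" and node: "\<sigma> ''node'' = list_cells vs" and z: "\<sigma> ''z'' 0 = 0"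
    and v0: "v0 \<in> set vs" "\<And>v. v \<in> set vs \<Longrightarrow> \<sigma> ''par'' v = 0 \<longleftrightarrow> v = v0"
    and N: "length vs \<le> N"
  shows "trip find_root \<sigma> (max_time (set_var ''j'' (Const 0)) + loop_time N (Less (var ''j'') (var ''n'')) find_root_body)
    (\<lambda>\<sigma>'. agree_off {''j'', ''z''} \<sigma> \<sigma>' \<and> \<sigma>' ''z'' 0 = Suc v0)"
proof -
  let ?b = "Less (var ''j'') (var ''n'')"
  let ?I = "\<lambda>\<sigma>'. agree_off {''j'', ''z''} \<sigma> \<sigma>' \<and> \<sigma>' ''j'' 0 \<le> length vs \<and>
    \<sigma>' ''z'' 0 = (if v0 \<in> set (take (\<sigma>' ''j'' 0) vs) then Suc v0 else 0)"
  show ?thesis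
    unfolding find_root_def
  proof (rule trip_Seq[where Q = ?I, OF trip_run])
    show "?I (run (set_var ''j'' (Const 0)) \<sigma>)" by (simp add: agree_off_def z)
    fix \<sigma>1 assume I1: "?I \<sigma>1"
    have "trip (While ?b find_root_body) \<sigma>1 (loop_time N ?b find_root_body) (\<lambda>\<sigma>'. ?I \<sigma>' \<and> \<not> bval ?b \<sigma>')"
    proof (rule trip_While_run[where \<mu> = "\<lambda>\<sigma>'. length vs - \<sigma>' ''j'' 0"])
      fix \<sigma>' assume I: "?I \<sigma>'" and b: "bval ?b \<sigma>'"
      have fr: "\<sigma>' ''n'' = \<sigma> ''n''" "\<sigma>' ''node'' = \<sigma> ''node''" "\<sigma>' ''par'' = \<sigma> ''par''"
        using I[THEN conjunct1] by (simp_all add: agree_off_def)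
      define j where "j = \<sigma>' ''j'' 0"
      have j: "j < length vs" using b fr n by (simp add: j_def)
      then have v: "\<sigma> ''par'' (vs ! j) = 0 \<longleftrightarrow> vs ! j = v0" using v0(2) by simp
      have "run find_root_body \<sigma>' = \<sigma>'(''z'' := if vs ! j = v0 then (\<sigma>' ''z'')(0 := Suc v0) else \<sigma>' ''z'', ''j'' := (\<sigma>' ''j'')(0 := Suc j))"
        using j v fr node by (simp add: find_root_body_def list_cells_def flip: j_def)
      moreover have "length vs - Suc j < length vs - j" using j by simp
      ultimately show "?I (run find_root_body \<sigma>') \<and> length vs - run find_root_body \<sigma>' ''j'' 0 < length vs - \<sigma>' ''j'' 0"
        using I j by (simp add: agree_off_def take_Suc_conv_app_nth flip: j_def) 
    qed (use I1 N in \<open>simp_all add: find_root_body_def\<close>)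
    then show "trip (While ?b find_root_body) \<sigma>1 (loop_time N ?b find_root_body)
      (\<lambda>\<sigma>'. agree_off {''j'', ''z''} \<sigma> \<sigma>' \<and> \<sigma>' ''z'' 0 = Suc v0)"
    proof (rule trip_weaken)
      fix \<sigma>' assume *: "?I \<sigma>' \<and> \<not> bval ?b \<sigma>'"
      then have "\<sigma>' ''n'' = \<sigma> ''n''" by (simp add: agree_off_def)
      then have "\<sigma>' ''j'' 0 = length vs" using * n by simp
      then show "agree_off {''j'', ''z''} \<sigma> \<sigma>' \<and> \<sigma>' ''z'' 0 = Suc v0" using * v0(1) by simp
    qed simp
  qed simp
qed

section \<open>The walk along the chains\<close>

definition pending :: "nat \<Rightarrow> nat list" where
  "pending u = (if u = 0 then [] else [u - 1])"

text \<open>The clauses about the shape of the chains speak of \<open>ys\<close>, the listed nodes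
  followed by the pending one, so that a step along a chain can be justified from its predecessor.
  The beginning of a chain is in \<open>ys\<close> exactly if it has been scanned, so no chain is
  entered twice.\<close>

definition walk_inv :: "nat list \<Rightarrow> (nat \<times> nat) set \<Rightarrow> nat \<Rightarrow> state \<Rightarrow> nat list \<Rightarrow> bool" where
  "walk_inv vs E z \<sigma> xs \<longleftrightarrow> (let ys = xs @ pending (\<sigma> ''u'' 0); js = set (take (\<sigma> ''j'' 0) vs) in
     \<sigma> ''M'' 0 = Suc (length xs) \<and> \<sigma> ''ord'' 0 = z - 1 \<and> \<sigma> ''f'' 0 = 0 \<and> \<sigma> ''j'' 0 \<le> length vs \<and>
     (\<forall>i<length xs. \<sigma> ''ord'' (Suc i) = xs ! i \<and> \<sigma> ''f'' (Suc i) = (if parent_code E (xs ! i) = z then 1 else 2)) \<and>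
     distinct ys \<and> (\<forall>v\<in>set ys. v \<in> set vs \<and> Suc v \<noteq> z) \<and>
     (\<forall>i<length ys. parent_code E (ys ! i) = z \<or> (0 < i \<and> parent_code E (ys ! i) = Suc (ys ! (i - 1)))) \<and>
     (\<sigma> ''u'' 0 \<noteq> 0 \<longrightarrow> \<sigma> ''fl'' 0 = (if parent_code E (\<sigma> ''u'' 0 - 1) = z then 1 else 2)) \<and>
     (\<forall>v\<in>set vs. parent_code E v = z \<longrightarrow> (v \<in> set ys \<longleftrightarrow> v \<in> js)) \<and>
     (\<forall>(x, y)\<in>E. x \<in> set xs \<longrightarrow> y \<in> set ys))"

lemma walk_inv_start:
  assumes inv: "walk_inv vs E z \<sigma> xs" and u: "\<sigma> ''u'' 0 = 0" and j: "\<sigma> ''j'' 0 < length vs"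
    and "distinct vs" and cb: "chains_below (set vs) E z"
    and agree: "agree_off {''u'', ''fl'', ''j''} \<sigma> \<sigma>'"
    and j': "\<sigma>' ''j'' 0 = Suc (\<sigma> ''j'' 0)"
    and u': "if parent_code E (vs ! \<sigma> ''j'' 0) = z then \<sigma>' ''u'' 0 = Suc (vs ! \<sigma> ''j'' 0) \<and> \<sigma>' ''fl'' 0 = 1 else \<sigma>' ''u'' 0 = 0"
  shows "walk_inv vs E z \<sigma>' xs"
proof -
  define v where "v = vs ! \<sigma> ''j'' 0"
  have v: "v \<in> set vs" using j by (simp add: v_def)
  have fr: "\<sigma>' ''M'' = \<sigma> ''M''" "\<sigma>' ''ord'' = \<sigma> ''ord''" "\<sigma>' ''f'' = \<sigma> ''f''"
    using agree by (simp_all add: agree_off_def)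
  have take: "set (take (Suc (\<sigma> ''j'' 0)) vs) = insert v (set (take (\<sigma> ''j'' 0) vs))"
    using j by (simp add: v_def take_Suc_conv_app_nth)
  have v_new: "v \<notin> set (take (\<sigma> ''j'' 0) vs)"
    using \<open>distinct vs\<close> j by (auto simp: v_def in_set_conv_nth nth_eq_iff_index_eq)
  have p0: "pending (\<sigma> ''u'' 0) = []" using u by (simp add: pending_def)
  have pieces: "\<sigma> ''M'' 0 = Suc (length xs) \<and> \<sigma> ''ord'' 0 = z - 1 \<and> \<sigma> ''f'' 0 = 0 \<and>
      (\<forall>i<length xs. \<sigma> ''ord'' (Suc i) = xs ! i \<and> \<sigma> ''f'' (Suc i) = (if parent_code E (xs ! i) = z then 1 else 2))"
    "distinct xs" "\<forall>v\<in>set xs. v \<in> set vs \<and> Suc v \<noteq> z"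
    "\<forall>i<length xs. parent_code E (xs ! i) = z \<or> (0 < i \<and> parent_code E (xs ! i) = Suc (xs ! (i - 1)))"
    "\<forall>w\<in>set vs. parent_code E w = z \<longrightarrow> (w \<in> set xs \<longleftrightarrow> w \<in> set (take (\<sigma> ''j'' 0) vs))"
    "\<forall>(x, y)\<in>E. x \<in> set xs \<longrightarrow> y \<in> set xs"
    using inv unfolding walk_inv_def Let_def p0 append_Nil2 by blast+
  show ?thesis
  proof (cases "parent_code E v = z")
    case True
    have p: "pending (\<sigma>' ''u'' 0) = [v]" using True u' by (simp add: pending_def v_def)
    \<comment> \<open>The connecting node is never mistaken for the beginning of a chain: it would
      have to be its own predecessor.\<close>
    have vz: "Suc v \<noteq> z"
    proof
      assume "Suc v = z"
      then have "(v, v) \<in> E" using True cb parent_code_Suc[of E v v] by (auto simp: chains_below_def)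
      then show False using cb by (auto simp: chains_below_def acyclic_def)
    qed
    have "v \<notin> set xs" using pieces(5) v v_new True by blast
    moreover have "\<forall>i<length (xs @ [v]). parent_code E ((xs @ [v]) ! i) = z \<or>
       (0 < i \<and> parent_code E ((xs @ [v]) ! i) = Suc ((xs @ [v]) ! (i - 1)))"
    proof (intro allI impI)
      fix i assume "i < length (xs @ [v])"
      then consider "i < length xs" | "i = length xs" by fastforce
      then show "parent_code E ((xs @ [v]) ! i) = z \<or>
       (0 < i \<and> parent_code E ((xs @ [v]) ! i) = Suc ((xs @ [v]) ! (i - 1)))"
      proof cases
        case 1
        then have "(xs @ [v]) ! i = xs ! i" "(xs @ [v]) ! (i - 1) = xs ! (i - 1)" by (auto simp: nth_append)
        then show ?thesis using pieces(4) 1 by simp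
      qed (use True in simp)
    qed
    moreover have "\<sigma>' ''u'' 0 - 1 = v" "\<sigma>' ''fl'' 0 = 1" using True u' by (simp_all add: v_def)
    moreover have "\<forall>w\<in>set vs. parent_code E w = z \<longrightarrow>
        (w \<in> set (xs @ [v]) \<longleftrightarrow> w \<in> insert v (set (take (\<sigma> ''j'' 0) vs)))"
      using pieces(5) by auto
    moreover have "\<forall>(x, y)\<in>E. x \<in> set xs \<longrightarrow> y \<in> set (xs @ [v])" using pieces(6) by auto
    ultimately show ?thesis
      using True v vz j pieces(1-3) unfolding walk_inv_def Let_def p fr j' take by simp
  next
    case False
    have p: "pending (\<sigma>' ''u'' 0) = []" "\<sigma>' ''u'' 0 = 0" using False u' by (simp_all add: pending_def v_def)
    have "\<forall>w\<in>set vs. parent_code E w = z \<longrightarrow> (w \<in> set xs \<longleftrightarrow> w \<in> insert v (set (take (\<sigma> ''j'' 0) vs)))"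
      using pieces(5) False by auto
    then show ?thesis
      using pieces(1-4,6) j p(2) unfolding walk_inv_def Let_def p(1) fr j' take append_Nil2 by simp
  qed
qed

lemma walk_inv_step:
  assumes inv: "walk_inv vs E z \<sigma> xs" and u: "\<sigma> ''u'' 0 = Suc x"
    and cb: "chains_below (set vs) E z"
    and agree: "agree_off {''u'', ''fl'', ''M'', ''ord'', ''f''} \<sigma> \<sigma>'"
    and M': "\<sigma>' ''M'' 0 = Suc (\<sigma> ''M'' 0)" and fl': "\<sigma>' ''fl'' 0 = 2"
    and ord': "\<sigma>' ''ord'' = (\<sigma> ''ord'')(\<sigma> ''M'' 0 := x)" and f': "\<sigma>' ''f'' = (\<sigma> ''f'')(\<sigma> ''M'' 0 := \<sigma> ''fl'' 0)"
    and u': "\<sigma>' ''u'' 0 = parent_code {(v, u). (u, v) \<in> E \<and> Suc u \<noteq> z} x"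
  shows "walk_inv vs E z \<sigma>' (xs @ [x])"
proof -
  have fr: "\<sigma>' ''j'' = \<sigma> ''j''" using agree by (simp add: agree_off_def)
  have p0: "pending (\<sigma> ''u'' 0) = [x]" using u by (simp add: pending_def)
  have xz: "Suc x \<noteq> z" using inv by (simp add: walk_inv_def Let_def p0)
  have M: "\<sigma> ''M'' 0 = Suc (length xs)" using inv by (simp add: walk_inv_def Let_def)
  have out: "parent_code {(v, u). (u, v) \<in> E \<and> Suc u \<noteq> z} x = Suc y \<longleftrightarrow> (x, y) \<in> E" for y
    using cb xz by (subst parent_code_Suc) (auto simp: chains_below_def)
  have par: "parent_code E y = Suc x \<longleftrightarrow> (x, y) \<in> E" for x y
    using cb by (subst parent_code_Suc) (auto simp: chains_below_def)
  have cells: "\<forall>i<length (xs @ [x]). \<sigma>' ''ord'' (Suc i) = (xs @ [x]) ! i \<and>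
      \<sigma>' ''f'' (Suc i) = (if parent_code E ((xs @ [x]) ! i) = z then 1 else 2)"
    "\<sigma>' ''ord'' 0 = z - 1" "\<sigma>' ''f'' 0 = 0"
    using inv u by (auto simp: walk_inv_def Let_def ord' f' M nth_append less_Suc_eq)
  have ys: "distinct (xs @ [x])" "\<forall>v\<in>set (xs @ [x]). v \<in> set vs \<and> Suc v \<noteq> z"
    "\<forall>i<length (xs @ [x]). parent_code E ((xs @ [x]) ! i) = z \<or>
       (0 < i \<and> parent_code E ((xs @ [x]) ! i) = Suc ((xs @ [x]) ! (i - 1)))"
    "\<forall>v\<in>set vs. parent_code E v = z \<longrightarrow> (v \<in> set (xs @ [x]) \<longleftrightarrow> v \<in> set (take (\<sigma> ''j'' 0) vs))"
    "\<forall>(a, b)\<in>E. a \<in> set xs \<longrightarrow> b \<in> set (xs @ [x])" "\<sigma> ''j'' 0 \<le> length vs"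
    using inv unfolding walk_inv_def Let_def p0 by blast+
  show ?thesis
  proof (cases "\<sigma>' ''u'' 0")
    case 0
    then have p: "pending (\<sigma>' ''u'' 0) = []" by (simp add: pending_def)
    have "(x, b) \<notin> E" for b using out[of b] 0 u' by simp
    then have "\<forall>(a, b)\<in>E. a \<in> set (xs @ [x]) \<longrightarrow> b \<in> set (xs @ [x])" using ys(5) by auto
    then show ?thesis
      using cells ys 0 M M' unfolding walk_inv_def Let_def p fr append_Nil2 by simp
  next
    case (Suc y)
    then have p: "pending (\<sigma>' ''u'' 0) = [y]" by (simp add: pending_def)
    have xy: "(x, y) \<in> E" using out Suc u' by simp
    then have py: "parent_code E y = Suc x" using par by simp
    \<comment> \<open>A listed \<open>y\<close> would stand directly behind its predecessor
      \<open>x\<close>, but \<open>x\<close> occurs only once, at the end.\<close>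
    have "y \<notin> set (xs @ [x])"
    proof
      assume "y \<in> set (xs @ [x])"
      then obtain i where i: "i < length (xs @ [x])" "(xs @ [x]) ! i = y" by (meson in_set_conv_nth)
      then have "0 < i" "(xs @ [x]) ! (i - 1) = x" using ys(3) py xz by force+
      then have "(xs @ [x]) ! (i - 1) = (xs @ [x]) ! length xs" by simp
      then have "i - 1 = length xs"
        using ys(1) i \<open>0 < i\<close> by (subst (asm) nth_eq_iff_index_eq) auto
      then show False using i \<open>0 < i\<close> by simp
    qed
    moreover have "y \<in> set vs" "Suc y \<noteq> z" using cb xy by (auto simp: chains_below_def)
    moreover have "\<forall>(a, b)\<in>E. a \<in> set (xs @ [x]) \<longrightarrow> b \<in> set (xs @ [x] @ [y])"
    proof -
      have "b = y" if "(x, b) \<in> E" for b using out[of b] that Suc u' by simp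
      then show ?thesis using ys(5) by auto
    qed
    moreover have "\<forall>i<length ((xs @ [x]) @ [y]). parent_code E (((xs @ [x]) @ [y]) ! i) = z \<or>
       (0 < i \<and> parent_code E (((xs @ [x]) @ [y]) ! i) = Suc (((xs @ [x]) @ [y]) ! (i - 1)))"
    proof (intro allI impI)
      fix i assume "i < length ((xs @ [x]) @ [y])"
      then consider "i < length (xs @ [x])" | "i = length (xs @ [x])" by fastforce
      then show "parent_code E (((xs @ [x]) @ [y]) ! i) = z \<or>
       (0 < i \<and> parent_code E (((xs @ [x]) @ [y]) ! i) = Suc (((xs @ [x]) @ [y]) ! (i - 1)))"
      proof cases
        case 1
        then have "((xs @ [x]) @ [y]) ! i = (xs @ [x]) ! i" "((xs @ [x]) @ [y]) ! (i - 1) = (xs @ [x]) ! (i - 1)"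
          by (simp_all only: nth_append[of "xs @ [x]"] if_True less_imp_diff_less)
        then show ?thesis using ys(3) 1 by simp
      next
        case 2
        then have "((xs @ [x]) @ [y]) ! i = y" "((xs @ [x]) @ [y]) ! (i - 1) = x" by (auto simp: nth_append)
        then show ?thesis using py 2 by simp
      qed
    qed
    moreover have "\<forall>v\<in>set vs. parent_code E v = z \<longrightarrow>
        (v \<in> set ((xs @ [x]) @ [y]) \<longleftrightarrow> v \<in> set (take (\<sigma> ''j'' 0) vs))"
      using ys(4) py xz by auto
    moreover have "\<sigma>' ''fl'' 0 = (if parent_code E y = z then 1 else 2)" using fl' py xz by simp
    ultimately show ?thesis
      using cells ys(1,2,6) Suc M M' unfolding walk_inv_def Let_def p fr by simp
  qed
qed

lemma walk_inv_final:
  assumes inv: "walk_inv vs E z \<sigma> xs" and u: "\<sigma> ''u'' 0 = 0" and j: "length vs \<le> \<sigma> ''j'' 0"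
    and cb: "chains_below (set vs) E z"
  shows "layout (z \<noteq> 0) (z - 1) xs (\<lambda>i. parent_code E (xs ! i) = z) (set vs) E"
proof -
  have p: "pending (\<sigma> ''u'' 0) = []" using u by (simp add: pending_def)
  have i: "distinct xs" "\<forall>v\<in>set xs. v \<in> set vs \<and> Suc v \<noteq> z"
    "\<forall>i<length xs. parent_code E (xs ! i) = z \<or> (0 < i \<and> parent_code E (xs ! i) = Suc (xs ! (i - 1)))"
    "\<forall>v\<in>set vs. parent_code E v = z \<longrightarrow> v \<in> set xs" "\<forall>(a, b)\<in>E. a \<in> set xs \<longrightarrow> b \<in> set xs"
    using inv j unfolding walk_inv_def Let_def p by auto
  have par: "parent_code E y = Suc x \<longleftrightarrow> (x, y) \<in> E" for x y
    using cb by (subst parent_code_Suc) (auto simp: chains_below_def)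
  have E: "finite E" "acyclic E" "E \<subseteq> set vs \<times> set vs"
    using cb by (auto simp: chains_below_def intro: finite_subset)
  \<comment> \<open>Induction along the edges: a node begins a chain, and all of these have been
    scanned, or it has a predecessor, which is listed together with its successors.\<close>
  have all: "v \<in> set xs" if "v \<in> set vs" "Suc v \<noteq> z" for v
  proof -
    have "wf E" using E by (intro finite_acyclic_wf)
    then show ?thesis using that
    proof (induction v rule: wf_induct_rule)
      case (less v)
      show ?case
      proof (cases "parent_code E v = z")
        case False
        have "\<exists>w. (w, v) \<in> E"
        proof (cases "z = 0")
          case True
          then show ?thesis using False by (simp add: parent_code_0)
        next
          case False
          then show ?thesis using cb less.prems by (simp add: chains_below_def)
        qed
        then obtain w where w: "(w, v) \<in> E" by blast
        then have "Suc w \<noteq> z" using False par by metis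
        then have "w \<in> set xs" using less.IH[OF w] w E by blast
        then show ?thesis using i(5) w by blast
      qed (use i(4) less in blast)
    qed
  qed
  have V: "set vs = (if z \<noteq> 0 then insert (z - 1) (set xs) else set xs)"
  proof -
    have "z \<noteq> 0 \<Longrightarrow> z - 1 \<in> set vs" using cb by (simp add: chains_below_def)
    moreover have "v = z - 1" if "Suc v = z" for v using that by simp
    ultimately show ?thesis using all i(2) by auto
  qed
  have "E = {(xs ! (i - 1), xs ! i) | i. 0 < i \<and> i < length xs \<and> parent_code E (xs ! i) \<noteq> z} \<union>
         (if z \<noteq> 0 then {(z - 1, xs ! i) | i. i < length xs \<and> parent_code E (xs ! i) = z} else {})" (is "_ = ?A \<union> ?B")
  proof (intro subset_antisym subsetI)
    fix e assume "e \<in> E"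
    then obtain a b where ab: "e = (a, b)" "(a, b) \<in> E" by (cases e) auto
    have "b \<in> set vs" "Suc b \<noteq> z" using cb ab(2) by (auto simp: chains_below_def)
    then obtain k where k: "k < length xs" "b = xs ! k" using all by (metis in_set_conv_nth)
    have pb: "parent_code E b = Suc a" using ab par by simp
    show "e \<in> ?A \<union> ?B"
    proof (cases "parent_code E b = z")
      case True
      then have "z \<noteq> 0" "a = z - 1" using pb by auto
      then have "e \<in> ?B" using k True ab by auto
      then show ?thesis ..
    next
      case False
      then have "0 < k" "xs ! (k - 1) = a" using i(3) k pb by force+
      then have "e \<in> ?A" using k False ab by auto
      then show ?thesis ..
    qed
  next
    fix e assume "e \<in> ?A \<union> ?B"
    then show "e \<in> E"
    proof
      assume "e \<in> ?A"
      then obtain k where k: "e = (xs ! (k - 1), xs ! k)" "0 < k" "k < length xs" "parent_code E (xs ! k) \<noteq> z" by auto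
      then have "parent_code E (xs ! k) = Suc (xs ! (k - 1))" using i(3) by auto
      then show ?thesis using k par by simp
    next
      assume "e \<in> ?B"
      then obtain k where k: "e = (z - 1, xs ! k)" "z \<noteq> 0" "parent_code E (xs ! k) = z"
        by (auto split: if_splits)
      then show ?thesis using par[of "xs ! k" "z - 1"] by simp
    qed
  qed
  moreover have "xs \<noteq> [] \<longrightarrow> parent_code E (xs ! 0) = z" using i(3) by auto
  moreover have "z \<noteq> 0 \<longrightarrow> z - 1 \<notin> set xs" using i(2) by auto
  ultimately show ?thesis unfolding layout_def using V i(1) by simp
qed

lemma trip_walk:
  assumes n: "\<sigma> ''n'' 0 = length vs" and node: "\<sigma> ''node'' = list_cells vs" and z: "\<sigma> ''z'' 0 = z"
    and par: "\<sigma> ''par'' = parent_code E"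
    and nxt: "\<sigma> ''nxt'' = parent_code {(v, u). (u, v) \<in> E \<and> Suc u \<noteq> z}"
    and init: "\<sigma> ''u'' 0 = 0" "\<sigma> ''f'' 0 = 0"
    and "distinct vs" and cb: "chains_below (set vs) E z" and N: "2 * length vs + 1 \<le> N"
  shows "trip walk \<sigma> (max_time walk_init + loop_time N walk_test walk_body)
    (\<lambda>\<sigma>'. agree_off {''ord'', ''j'', ''M'', ''u'', ''fl'', ''f''} \<sigma> \<sigma>' \<and> (\<exists>xs st. layout (z \<noteq> 0) (z - 1) xs st (set vs) E \<and>
       \<sigma>' ''M'' 0 = Suc (length xs) \<and> \<sigma>' ''ord'' 0 = z - 1 \<and> \<sigma>' ''f'' 0 = 0 \<and>
       (\<forall>i<length xs. \<sigma>' ''ord'' (Suc i) = xs ! i \<and> \<sigma>' ''f'' (Suc i) = (if st i then 1 else 2))))" (is "trip _ _ _ ?Q")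
proof -
  let ?X = "{''ord'', ''j'', ''M'', ''u'', ''fl'', ''f''}"
  let ?I = "\<lambda>\<sigma>'. agree_off ?X \<sigma> \<sigma>' \<and> (\<exists>xs. walk_inv vs E z \<sigma>' xs)"
  show ?thesis
    unfolding walk_def
  proof (rule trip_Seq[where Q = ?I, OF trip_run])
    show "?I (run walk_init \<sigma>)"
      using init z by (intro conjI exI[of _ "[]"]) (simp_all add: agree_off_def walk_init_def walk_inv_def pending_def)
    fix \<sigma>1 assume I1: "?I \<sigma>1"
    have "trip (While walk_test walk_body) \<sigma>1 (loop_time N walk_test walk_body) (\<lambda>\<sigma>'. ?I \<sigma>' \<and> \<not> bval walk_test \<sigma>')"
    \<comment> \<open>Every iteration either scans a node for the beginning of a chain or lists a
      node. The two summands are at most \<open>length vs\<close> and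
      \<open>length vs + 1\<close>.\<close>
    proof (rule trip_While_run[where \<mu> = "\<lambda>\<sigma>'. (length vs - \<sigma>' ''j'' 0) + (Suc (length vs) - \<sigma>' ''M'' 0)"])
      fix \<sigma>' assume I: "?I \<sigma>'" and b: "bval walk_test \<sigma>'"
      let ?s = "run walk_body \<sigma>'"
      obtain xs where inv: "walk_inv vs E z \<sigma>' xs" using I by blast
      have fr: "\<sigma>' ''n'' = \<sigma> ''n''" "\<sigma>' ''node'' = \<sigma> ''node''" "\<sigma>' ''par'' = \<sigma> ''par''" "\<sigma>' ''nxt'' = \<sigma> ''nxt''" "\<sigma>' ''z'' = \<sigma> ''z''"
        using I[THEN conjunct1] by (simp_all add: agree_off_def)
      have ag: "agree_off ?X \<sigma> ?s"
        using I[THEN conjunct1] by (simp add: agree_off_def walk_body_def)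
      show "?I ?s \<and> (length vs - ?s ''j'' 0) + (Suc (length vs) - ?s ''M'' 0) <
          (length vs - \<sigma>' ''j'' 0) + (Suc (length vs) - \<sigma>' ''M'' 0)"
      proof (cases "\<sigma>' ''u'' 0")
        case 0
        then have j: "\<sigma>' ''j'' 0 < length vs" using b fr n by (simp add: walk_test_def)
        have "walk_inv vs E z ?s xs"
        proof (rule walk_inv_start[OF inv 0 j \<open>distinct vs\<close> cb])
          show "agree_off {''u'', ''fl'', ''j''} \<sigma>' ?s" using 0 by (simp add: walk_body_def agree_off_def)
        qed (use 0 j fr node par z in \<open>auto simp: walk_body_def list_cells_def\<close>)
        moreover have "?s ''j'' 0 = Suc (\<sigma>' ''j'' 0)" "?s ''M'' 0 = \<sigma>' ''M'' 0" using 0 by (simp_all add: walk_body_def)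
        ultimately show ?thesis using ag j by (intro conjI exI[of _ xs]) simp_all
      next
        case (Suc x)
        have inv': "walk_inv vs E z ?s (xs @ [x])"
        proof (rule walk_inv_step[OF inv Suc cb])
          show "agree_off {''u'', ''fl'', ''M'', ''ord'', ''f''} \<sigma>' ?s" using Suc by (simp add: walk_body_def agree_off_def)
        qed (use Suc fr nxt in \<open>simp_all add: walk_body_def\<close>)
        then have d: "distinct ((xs @ [x]) @ pending (?s ''u'' 0))" "\<forall>v\<in>set ((xs @ [x]) @ pending (?s ''u'' 0)). v \<in> set vs \<and> Suc v \<noteq> z"
          unfolding walk_inv_def Let_def by blast+
        then have "distinct (xs @ [x])" "set (xs @ [x]) \<subseteq> set vs" by auto
        \<comment> \<open>Listed nodes are distinct, so \<open>''M''\<close> stays small enough for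
          the truncated difference to decrease properly.\<close>
        then have "length (xs @ [x]) \<le> length vs"
          using card_mono[of "set vs" "set (xs @ [x])"] \<open>distinct vs\<close> by (simp only: distinct_card List.finite_set)
        moreover have "\<sigma>' ''M'' 0 = Suc (length xs)" using inv by (simp add: walk_inv_def Let_def)
        moreover have "?s ''j'' 0 = \<sigma>' ''j'' 0" "?s ''M'' 0 = Suc (\<sigma>' ''M'' 0)" using Suc by (simp_all add: walk_body_def)
        ultimately show ?thesis using ag inv' by (intro conjI exI[of _ "xs @ [x]"]) simp_all
      qed
    qed (use I1 N in \<open>simp_all add: walk_body_def\<close>)
    then show "trip (While walk_test walk_body) \<sigma>1 (loop_time N walk_test walk_body) ?Q"
    proof (rule trip_weaken)
      fix \<sigma>' assume *: "?I \<sigma>' \<and> \<not> bval walk_test \<sigma>'"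
      then obtain xs where inv: "walk_inv vs E z \<sigma>' xs" by blast
      have "\<sigma>' ''n'' = \<sigma> ''n''" using * by (simp add: agree_off_def)
      then have stop: "\<sigma>' ''u'' 0 = 0" "length vs \<le> \<sigma>' ''j'' 0" using * n by (auto simp: walk_test_def)
      have "\<sigma>' ''M'' 0 = Suc (length xs) \<and> \<sigma>' ''ord'' 0 = z - 1 \<and> \<sigma>' ''f'' 0 = 0 \<and>
        (\<forall>i<length xs. \<sigma>' ''ord'' (Suc i) = xs ! i \<and> \<sigma>' ''f'' (Suc i) = (if parent_code E (xs ! i) = z then 1 else 2))"
        using inv unfolding walk_inv_def Let_def by blast
      then show "?Q \<sigma>'"
        using * walk_inv_final[OF inv stop cb]
        by (intro conjI exI[of _ xs] exI[of _ "\<lambda>i. parent_code E (xs ! i) = z"]) blast+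
    qed simp
  qed (simp add: walk_init_def)
qed

lemma input_state_cells:
  "input_state vs es ''n'' 0 = length vs" "input_state vs es ''m'' 0 = length es"
  "input_state vs es ''node'' = list_cells vs" "input_state vs es ''src'' = list_cells (map fst es)"
  "input_state vs es ''dst'' = list_cells (map snd es)"
  "x \<notin> {''n'', ''node'', ''m'', ''src'', ''dst''} \<Longrightarrow> input_state vs es x = (\<lambda>_. 0)"
  by (simp_all add: input_state_def list_cells_def)

definition preprocess_vars :: "vname set" where
  "preprocess_vars = {''e'', ''par'', ''z'', ''nxt'', ''ord'', ''j'', ''M'', ''u'', ''fl'', ''f''}"

text \<open>The third line covers both values of \<open>conn\<close>; its \<open>+ 1\<close> pays
  for \<open>Skip\<close>.\<close>

definition preprocess_time :: "nat \<Rightarrow> nat" where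
  "preprocess_time n =
     (max_time (set_var ''e'' (Const 0)) + loop_time n (Less (var ''e'') (var ''m'')) read_parents_body) +
     ((max_time (set_var ''j'' (Const 0)) + loop_time n (Less (var ''j'') (var ''n'')) find_root_body + 1) +
     ((max_time (set_var ''e'' (Const 0)) + loop_time n (Less (var ''e'') (var ''m'')) read_children_body) +
      (max_time walk_init + loop_time (2 * n + 1) walk_test walk_body)))"

text \<open>An edge is determined by its target. This is why a time bound in the number of nodes
  alone is possible although the edges are part of the input.\<close>

lemma chains_below_length:
  assumes "distinct vs" "distinct es" "chains_below (set vs) (set es) z"
  shows "length es \<le> length vs"
proof -
  have "inj_on snd (set es)" "snd ` set es \<subseteq> set vs"
    using assms(3) by (auto simp: chains_below_def inj_on_def)
  then have "card (set es) \<le> card (set vs)" by (intro card_inj_on_le) auto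
  then show ?thesis using assms(1,2) by (simp add: distinct_card)
qed

lemma trip_preprocess:
  assumes "distinct vs" "distinct es" and cb: "chains_below (set vs) (set es) (if conn then Suc v0 else 0)"
  shows "trip (preprocess conn) (input_state vs es) (preprocess_time (length vs))
    (\<lambda>\<sigma>'. agree_off preprocess_vars (input_state vs es) \<sigma>' \<and> (\<exists>xs st v0. layout conn v0 xs st (set vs) (set es) \<and>
       \<sigma>' ''M'' 0 = Suc (length xs) \<and> \<sigma>' ''ord'' 0 = v0 \<and> \<sigma>' ''f'' 0 = 0 \<and>
       (\<forall>i<length xs. \<sigma>' ''ord'' (Suc i) = xs ! i \<and> \<sigma>' ''f'' (Suc i) = (if st i then 1 else 2))))" (is "trip _ ?\<sigma> _ ?Q")
proof -
  define z where "z = (if conn then Suc v0 else 0)"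
  have cb': "chains_below (set vs) (set es) z" using cb by (simp add: z_def)
  have in1: "u = u'" if "(u, v) \<in> set es" "(u', v) \<in> set es" for u u' v
    using cb' that unfolding chains_below_def by blast
  have out1: "v = v'" if "(u, v) \<in> set es" "(u, v') \<in> set es" "Suc u \<noteq> z" for u v v'
    using cb' that unfolding chains_below_def by blast
  have len: "length es \<le> length vs" using chains_below_length[OF assms(1,2) cb] .
  let ?I1 = "\<lambda>\<sigma>'. agree_off {''e'', ''par''} ?\<sigma> \<sigma>' \<and> \<sigma>' ''par'' = parent_code (set es)"
  let ?I2 = "\<lambda>\<sigma>'. agree_off {''e'', ''par'', ''j'', ''z''} ?\<sigma> \<sigma>' \<and> \<sigma>' ''par'' = parent_code (set es) \<and> \<sigma>' ''z'' 0 = z"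
  let ?I3 = "\<lambda>\<sigma>'. agree_off {''e'', ''par'', ''j'', ''z'', ''nxt''} ?\<sigma> \<sigma>' \<and> \<sigma>' ''par'' = parent_code (set es) \<and> \<sigma>' ''z'' 0 = z \<and>
    \<sigma>' ''nxt'' = parent_code {(v, u). (u, v) \<in> set es \<and> Suc u \<noteq> z}"
  have first: "trip read_parents ?\<sigma> (max_time (set_var ''e'' (Const 0)) + loop_time (length vs) (Less (var ''e'') (var ''m'')) read_parents_body) ?I1"
    by (rule trip_read_parents) (use len in1 in \<open>simp_all add: input_state_cells\<close>)
  have second: "trip (if conn then find_root else Skip) \<sigma>1
    (max_time (set_var ''j'' (Const 0)) + loop_time (length vs) (Less (var ''j'') (var ''n'')) find_root_body + 1) ?I2"
    if I1: "?I1 \<sigma>1" for \<sigma>1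
  proof (cases conn)
    case True
    have v0: "v0 \<in> set vs" "\<forall>u. (u, v0) \<notin> set es" "\<forall>v\<in>set vs. Suc v \<noteq> Suc v0 \<longrightarrow> (\<exists>u. (u, v) \<in> set es)"
      using cb True by (simp_all add: chains_below_def)
    have "trip find_root \<sigma>1 (max_time (set_var ''j'' (Const 0)) + loop_time (length vs) (Less (var ''j'') (var ''n'')) find_root_body)
      (\<lambda>\<sigma>'. agree_off {''j'', ''z''} \<sigma>1 \<sigma>' \<and> \<sigma>' ''z'' 0 = Suc v0)"
    proof (rule trip_find_root)
      show "v0 \<in> set vs" by (fact v0(1))
      show "\<sigma>1 ''par'' v = 0 \<longleftrightarrow> v = v0" if "v \<in> set vs" for v
        using I1 v0 that by (auto simp: parent_code_0)
    qed (use I1[THEN conjunct1] in \<open>simp_all add: agree_off_def input_state_cells\<close>)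
    then show ?thesis
      unfolding if_P[OF True]
    proof (rule trip_weaken)
      fix \<sigma>2 assume "agree_off {''j'', ''z''} \<sigma>1 \<sigma>2 \<and> \<sigma>2 ''z'' 0 = Suc v0"
      then show "?I2 \<sigma>2" using I1 True by (simp add: agree_off_def z_def)
    qed simp
  next
    case False
    have "trip Skip \<sigma>1 (max_time Skip) ?I2"
      by (rule trip_run) (use I1 False in \<open>simp_all add: agree_off_def input_state_cells z_def\<close>)
    then show ?thesis unfolding if_not_P[OF False] by (rule trip_weaken) simp_all
  qed
  have third: "trip read_children \<sigma>2 (max_time (set_var ''e'' (Const 0)) + loop_time (length vs) (Less (var ''e'') (var ''m'')) read_children_body) ?I3"
    if I2: "?I2 \<sigma>2" for \<sigma>2
  proof -
    have z: "\<sigma>2 ''z'' 0 = z" using I2 by simp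
    have "trip read_children \<sigma>2 (max_time (set_var ''e'' (Const 0)) + loop_time (length vs) (Less (var ''e'') (var ''m'')) read_children_body)
      (\<lambda>\<sigma>'. agree_off {''e'', ''nxt''} \<sigma>2 \<sigma>' \<and> \<sigma>' ''nxt'' = parent_code {(v, u). (u, v) \<in> set es \<and> Suc u \<noteq> \<sigma>2 ''z'' 0})"
      by (rule trip_read_children)
        (use I2[THEN conjunct1] len out1 in \<open>simp_all add: agree_off_def input_state_cells z\<close>)
    then show ?thesis
    proof (rule trip_weaken)
      fix \<sigma>3 assume "agree_off {''e'', ''nxt''} \<sigma>2 \<sigma>3 \<and> \<sigma>3 ''nxt'' = parent_code {(v, u). (u, v) \<in> set es \<and> Suc u \<noteq> \<sigma>2 ''z'' 0}"
      then show "?I3 \<sigma>3" using I2 by (simp add: agree_off_def)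
    qed simp
  qed
  have fourth: "trip walk \<sigma>3 (max_time walk_init + loop_time (2 * length vs + 1) walk_test walk_body) ?Q"
    if I3: "?I3 \<sigma>3" for \<sigma>3
  proof (rule trip_weaken[OF trip_walk[OF _ _ _ _ _ _ _ assms(1) cb' order_refl]])
    fix \<sigma>'
    assume *: "agree_off {''ord'', ''j'', ''M'', ''u'', ''fl'', ''f''} \<sigma>3 \<sigma>' \<and>
      (\<exists>xs st. layout (z \<noteq> 0) (z - 1) xs st (set vs) (set es) \<and> \<sigma>' ''M'' 0 = Suc (length xs) \<and>
       \<sigma>' ''ord'' 0 = z - 1 \<and> \<sigma>' ''f'' 0 = 0 \<and>
       (\<forall>i<length xs. \<sigma>' ''ord'' (Suc i) = xs ! i \<and> \<sigma>' ''f'' (Suc i) = (if st i then 1 else 2)))"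
    have "agree_off preprocess_vars ?\<sigma> \<sigma>'"
      using *[THEN conjunct1] I3[THEN conjunct1] by (simp add: agree_off_def preprocess_vars_def)
    moreover have "(z \<noteq> 0) = conn" by (simp add: z_def)
    ultimately show "?Q \<sigma>'" using * by metis
  qed (use I3 in \<open>simp_all add: agree_off_def input_state_cells\<close>)
  show ?thesis
    unfolding preprocess_def preprocess_time_def
    by (rule trip_Seq[OF first], rule trip_Seq[OF second], assumption, rule trip_Seq[OF third], assumption, rule fourth)
qed

section \<open>Few supersteps suffice\<close>

lemma work_cost_ge: "p \<in> {1..P} \<Longrightarrow> card {v \<in> V. proc X v = p \<and> step X v = s} \<le> work_cost P V X s"
  unfolding work_cost_def by (rule Max_ge) auto

lemma work_cost_le:
  assumes "1 \<le> P" "\<And>p. p \<in> {1..P} \<Longrightarrow> card {v \<in> V. proc X v = p \<and> step X v = s} \<le> b"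
  shows "work_cost P V X s \<le> b"
  unfolding work_cost_def using assms by (subst Max_le_iff) auto

lemma comm_cost_ge:
  "p \<in> {1..P} \<Longrightarrow> sent_cost X s p \<le> comm_cost P X s" "p \<in> {1..P} \<Longrightarrow> rec_cost X s p \<le> comm_cost P X s"
proof -
  assume "p \<in> {1..P}"
  then have "max (sent_cost X s p) (rec_cost X s p) \<le> comm_cost P X s"
    unfolding comm_cost_def by (intro Max_ge) auto
  then show "sent_cost X s p \<le> comm_cost P X s" "rec_cost X s p \<le> comm_cost P X s" by auto
qed

lemma comm_cost_le:
  assumes "1 \<le> P" "\<And>p. p \<in> {1..P} \<Longrightarrow> sent_cost X s p \<le> b" "\<And>p. p \<in> {1..P} \<Longrightarrow> rec_cost X s p \<le> b"
  shows "comm_cost P X s \<le> b"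
  unfolding comm_cost_def using assms by (subst Max_le_iff) auto

lemma total_cost_alt:
  "total_cost P g L V X = (\<Sum>s\<in>{1..supersteps X}. work_cost P V X s) +
     g * (\<Sum>s\<in>{1..supersteps X}. comm_cost P X s) + L * supersteps X"
  unfolding total_cost_def by (simp add: sum.distrib sum_distrib_left mult.commute)

lemma valid_node: "valid_schedule P V E X \<Longrightarrow> v \<in> V \<Longrightarrow> proc X v \<in> {1..P} \<and> step X v \<in> {1..supersteps X}"
  unfolding valid_schedule_def by blast

lemma valid_comm:
  assumes "valid_schedule P V E X" "(v, p, q, s) \<in> comm X"
  shows "v \<in> V" "p \<in> {1..P}" "q \<in> {1..P}" "s \<in> {1..supersteps X}" "p = proc X v" "step X v \<le> s"
proof -
  have "(v, p, q, s) \<in> V \<times> {1..P} \<times> {1..P} \<times> {1..supersteps X}"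
    using assms unfolding valid_schedule_def by blast
  then show "v \<in> V" "p \<in> {1..P}" "q \<in> {1..P}" "s \<in> {1..supersteps X}" by auto
  have "\<forall>(v, p1, p2, s)\<in>comm X. p1 = proc X v \<and> step X v \<le> s"
    using assms(1) unfolding valid_schedule_def by (elim conjE)
  then show "p = proc X v" "step X v \<le> s" using assms(2) by auto
qed

lemma valid_edge:
  assumes "valid_schedule P V E X" "(u, v) \<in> E"
  shows "proc X u = proc X v \<Longrightarrow> step X u \<le> step X v"
    and "proc X u \<noteq> proc X v \<Longrightarrow> \<exists>s. s < step X v \<and> (u, proc X u, proc X v, s) \<in> comm X"
proof -
  have "\<forall>(u, v)\<in>E. (proc X u = proc X v \<longrightarrow> step X u \<le> step X v) \<and>
        (proc X u \<noteq> proc X v \<longrightarrow> (\<exists>s. s < step X v \<and> (u, proc X u, proc X v, s) \<in> comm X))"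
    using assms(1) unfolding valid_schedule_def by (elim conjE)
  then show "proc X u = proc X v \<Longrightarrow> step X u \<le> step X v"
    and "proc X u \<noteq> proc X v \<Longrightarrow> \<exists>s. s < step X v \<and> (u, proc X u, proc X v, s) \<in> comm X"
    using assms(2) by auto
qed

lemma valid_comm_finite: "finite V \<Longrightarrow> valid_schedule P V E X \<Longrightarrow> finite (comm X)"
  unfolding valid_schedule_def by (elim conjE) (erule finite_subset, simp)

text \<open>A change of processor passes through a communication phase, and what is sent in a
  superstep is usable only in later ones. So related nodes in the same superstep share a
  processor.\<close>

lemma valid_edge_precedes:
  assumes "valid_schedule P V E X" "(u, v) \<in> E\<^sup>+"
  shows "step X u < step X v \<or> (step X u = step X v \<and> proc X u = proc X v)"
  using assms(2)
proof (induction rule: trancl_induct)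
  have edge: "step X u < step X v \<or> (step X u = step X v \<and> proc X u = proc X v)" if uv: "(u, v) \<in> E" for u v
  proof (cases "proc X u = proc X v")
    case True
    then show ?thesis using valid_edge(1)[OF assms(1) uv] by auto
  next
    case False
    then obtain s where s: "s < step X v" "(u, proc X u, proc X v, s) \<in> comm X"
      using valid_edge(2)[OF assms(1) uv False] by auto
    have "step X u \<le> s" using valid_comm(6)[OF assms(1) s(2)] .
    then show ?thesis using s by simp
  qed
  {
    case (base y)
    then show ?case by (rule edge)
  next
    case (step y z)
    then show ?case using edge[of y z] by auto
  }
qed

text \<open>
  Two consecutive supersteps may be merged if nothing is sent in the first one; \<open>\<phi>\<close> performs
  many such mergings at once.
\<close>

lemma merge_supersteps:
  assumes P: "1 \<le> P" and V: "finite V" and valid: "valid_schedule P V E X"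
    and range: "\<And>s. s \<in> {1..supersteps X} \<Longrightarrow> \<phi> s \<in> {1..S'}"
    and mono: "\<And>s t. s \<le> t \<Longrightarrow> \<phi> s \<le> \<phi> t"
    and strict: "\<And>s t v p q. (v, p, q, s) \<in> comm X \<Longrightarrow> s < t \<Longrightarrow> \<phi> s < \<phi> t"
  defines "Y \<equiv> \<lparr>supersteps = S', proc = proc X, step = \<phi> \<circ> step X, comm = (\<lambda>(v, p, q, s). (v, p, q, \<phi> s)) ` comm X\<rparr>"
  shows "valid_schedule P V E Y" "total_cost P g L V Y + L * supersteps X \<le> total_cost P g L V X + L * S'"
proof -
  let ?S = "supersteps X"
  have fin: "finite (comm X)" using valid_comm_finite[OF V valid] .
  have range_step: "step X v \<in> {1..?S}" if "v \<in> V" for v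
    using valid_node[OF valid that] by simp
  have Y [simp]: "supersteps Y = S'" "proc Y = proc X" "step Y v = \<phi> (step X v)" for v
    by (simp_all add: Y_def)
  have comm_Y: "x \<in> comm Y \<longleftrightarrow> (\<exists>v p q s. x = (v, p, q, \<phi> s) \<and> (v, p, q, s) \<in> comm X)" for x
    by (auto simp: Y_def image_iff split: prod.splits)
  show "valid_schedule P V E Y"
    unfolding valid_schedule_def
  proof (intro conjI)
    show "\<forall>v\<in>V. proc Y v \<in> {1..P} \<and> step Y v \<in> {1..supersteps Y}"
      using valid_node[OF valid] range by simp
    show "comm Y \<subseteq> V \<times> {1..P} \<times> {1..P} \<times> {1..supersteps Y}"
    proof
      fix x assume "x \<in> comm Y"
      then obtain v p q s where x: "x = (v, p, q, \<phi> s)" "(v, p, q, s) \<in> comm X" unfolding comm_Y by blast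
      show "x \<in> V \<times> {1..P} \<times> {1..P} \<times> {1..supersteps Y}"
        using x(1) valid_comm(1-3)[OF valid x(2)] range[OF valid_comm(4)[OF valid x(2)]] by simp
    qed
    show "\<forall>(u, v)\<in>E. (proc Y u = proc Y v \<longrightarrow> step Y u \<le> step Y v) \<and>
        (proc Y u \<noteq> proc Y v \<longrightarrow> (\<exists>s. s < step Y v \<and> (u, proc Y u, proc Y v, s) \<in> comm Y))"
    proof (clarify, intro conjI impI)
      fix u v assume uv: "(u, v) \<in> E"
      show "step Y u \<le> step Y v" if "proc Y u = proc Y v"
        using valid_edge(1)[OF valid uv] that mono by simp
      show "\<exists>s. s < step Y v \<and> (u, proc Y u, proc Y v, s) \<in> comm Y" if ne: "proc Y u \<noteq> proc Y v"
      proof -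
        obtain s where s: "s < step X v" "(u, proc X u, proc X v, s) \<in> comm X"
          using valid_edge(2)[OF valid uv] ne by auto
        have "\<phi> s < \<phi> (step X v)" using strict[OF s(2,1)] .
        moreover have "(u, proc X u, proc X v, \<phi> s) \<in> comm Y" using s(2) unfolding comm_Y by blast
        ultimately show ?thesis unfolding Y by blast
      qed
    qed
    show "\<forall>(v, p1, p2, s)\<in>comm Y. p1 = proc Y v \<and> step Y v \<le> s"
    proof clarify
      fix v p1 p2 s' assume "(v, p1, p2, s') \<in> comm Y"
      then obtain s where s: "s' = \<phi> s" "(v, p1, p2, s) \<in> comm X" unfolding comm_Y by blast
      show "p1 = proc Y v \<and> step Y v \<le> s'"
        using valid_comm(5,6)[OF valid s(2)] mono s(1) by simp
    qed
  qed
  let ?A = "\<lambda>k. {s \<in> {1..?S}. \<phi> s = k}"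
  \<comment> \<open>Old supersteps are grouped by their new number; each cost of a new superstep is
    then compared with the sum of the old costs in its group.\<close>
  have regroup: "(\<Sum>k\<in>{1..S'}. \<Sum>s\<in>?A k. h s) = (\<Sum>s\<in>{1..?S}. h s)" for h :: "nat \<Rightarrow> nat"
    by (rule sum.group) (use range in auto)
  have work: "work_cost P V Y k \<le> (\<Sum>s\<in>?A k. work_cost P V X s)" for k
  proof (rule work_cost_le[OF P])
    fix p assume p: "p \<in> {1..P}"
    have "{v \<in> V. proc Y v = p \<and> step Y v = k} \<subseteq> (\<Union>s\<in>?A k. {v \<in> V. proc X v = p \<and> step X v = s})"
      using range_step by auto
    then have "card {v \<in> V. proc Y v = p \<and> step Y v = k} \<le> card (\<Union>s\<in>?A k. {v \<in> V. proc X v = p \<and> step X v = s})"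
      using V by (intro card_mono) auto
    also have "\<dots> \<le> (\<Sum>s\<in>?A k. card {v \<in> V. proc X v = p \<and> step X v = s})" by (rule card_UN_le) simp
    also have "\<dots> \<le> (\<Sum>s\<in>?A k. work_cost P V X s)" using p by (intro sum_mono work_cost_ge)
    finally show "card {v \<in> V. proc Y v = p \<and> step Y v = k} \<le> (\<Sum>s\<in>?A k. work_cost P V X s)" .
  qed
  \<comment> \<open>The predicate \<open>Q\<close> on sender and receiver lets one argument serve
    both directions. Transmissions may become equal under \<open>\<phi>\<close>, hence only an
    inequality.\<close>
  have image: "card {x \<in> comm Y. Q (fst (snd x)) (fst (snd (snd x))) \<and> snd (snd (snd x)) = k} \<le>
      (\<Sum>s\<in>?A k. card {x \<in> comm X. Q (fst (snd x)) (fst (snd (snd x))) \<and> snd (snd (snd x)) = s})" for Q k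
  proof -
    let ?C = "\<Union>s\<in>?A k. {x \<in> comm X. Q (fst (snd x)) (fst (snd (snd x))) \<and> snd (snd (snd x)) = s}"
    have "{x \<in> comm Y. Q (fst (snd x)) (fst (snd (snd x))) \<and> snd (snd (snd x)) = k} \<subseteq>
       (\<lambda>(v, p, q, s). (v, p, q, \<phi> s)) ` ?C"
    proof
      fix x assume "x \<in> {x \<in> comm Y. Q (fst (snd x)) (fst (snd (snd x))) \<and> snd (snd (snd x)) = k}"
      then have x0: "x \<in> comm Y" "Q (fst (snd x)) (fst (snd (snd x)))" "snd (snd (snd x)) = k" by auto
      then obtain v p q s where x: "x = (v, p, q, \<phi> s)" "(v, p, q, s) \<in> comm X" unfolding comm_Y by blast
      have "(v, p, q, s) \<in> ?C" using x x0 valid_comm(4)[OF valid x(2)] by simp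
      then show "x \<in> (\<lambda>(v, p, q, s). (v, p, q, \<phi> s)) ` ?C" using x(1) by (intro image_eqI) auto
    qed
    moreover have "finite ?C" using fin by simp
    ultimately have "card {x \<in> comm Y. Q (fst (snd x)) (fst (snd (snd x))) \<and> snd (snd (snd x)) = k} \<le> card ?C"
      by (meson card_mono card_image_le finite_imageI le_trans)
    also have "\<dots> \<le> (\<Sum>s\<in>?A k. card {x \<in> comm X. Q (fst (snd x)) (fst (snd (snd x))) \<and> snd (snd (snd x)) = s})"
      by (rule card_UN_le) simp
    finally show ?thesis .
  qed
  have sent: "sent_cost Z s p = card {x \<in> comm Z. fst (snd x) = p \<and> snd (snd (snd x)) = s}" for Z :: "'a schedule" and s p
    unfolding sent_cost_def by (rule arg_cong[where f = card]) auto
  have rec: "rec_cost Z s p = card {x \<in> comm Z. fst (snd (snd x)) = p \<and> snd (snd (snd x)) = s}" for Z :: "'a schedule" and s p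
    unfolding rec_cost_def by (rule arg_cong[where f = card]) auto
  have comm: "comm_cost P Y k \<le> (\<Sum>s\<in>?A k. comm_cost P X s)" for k
  proof (rule comm_cost_le[OF P])
    fix p assume p: "p \<in> {1..P}"
    have "sent_cost Y k p \<le> (\<Sum>s\<in>?A k. sent_cost X s p)"
      using image[of "\<lambda>a b. a = p" k] by (simp only: sent)
    also have "\<dots> \<le> (\<Sum>s\<in>?A k. comm_cost P X s)" using p by (intro sum_mono comm_cost_ge)
    finally show "sent_cost Y k p \<le> (\<Sum>s\<in>?A k. comm_cost P X s)" .
    have "rec_cost Y k p \<le> (\<Sum>s\<in>?A k. rec_cost X s p)"
      using image[of "\<lambda>a b. b = p" k] by (simp only: rec)
    also have "\<dots> \<le> (\<Sum>s\<in>?A k. comm_cost P X s)" using p by (intro sum_mono comm_cost_ge)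
    finally show "rec_cost Y k p \<le> (\<Sum>s\<in>?A k. comm_cost P X s)" .
  qed
  have "(\<Sum>k\<in>{1..S'}. work_cost P V Y k) \<le> (\<Sum>s\<in>{1..?S}. work_cost P V X s)"
    using sum_mono[of "{1..S'}" "work_cost P V Y", OF work] by (simp only: regroup)
  moreover have "(\<Sum>k\<in>{1..S'}. comm_cost P Y k) \<le> (\<Sum>s\<in>{1..?S}. comm_cost P X s)"
    using sum_mono[of "{1..S'}" "comm_cost P Y", OF comm] by (simp only: regroup)
  ultimately show "total_cost P g L V Y + L * supersteps X \<le> total_cost P g L V X + L * S'"
    unfolding total_cost_alt by (simp add: add_mono)
qed

text \<open>A superstep with a transmission has communication cost at least 1, so there are at most
  as many as the sum of these costs. The final superstep survives even when it is idle, hence the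
  \<open>Suc\<close>.\<close>

lemma merge_idle_supersteps:
  assumes P: "1 \<le> P" and V: "finite V" and valid: "valid_schedule P V E X" and S: "1 \<le> supersteps X"
  obtains Y where "valid_schedule P V E Y" "total_cost P g L V Y \<le> total_cost P g L V X"
    "supersteps Y \<le> supersteps X" "1 \<le> supersteps Y"
    "supersteps Y \<le> Suc (\<Sum>s\<in>{1..supersteps X}. comm_cost P X s)"
proof -
  let ?S = "supersteps X"
  define busy where "busy s \<longleftrightarrow> (\<exists>v p q. (v, p, q, s) \<in> comm X)" for s
  \<comment> \<open>The new number moves on only after a superstep in which something was
    sent.\<close>
  define \<phi> where "\<phi> s = Suc (card {t \<in> {1..<s}. busy t})" for s
  have fin: "finite (comm X)" using valid_comm_finite[OF V valid] .
  have mono: "\<phi> s \<le> \<phi> t" if "s \<le> t" for s t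
    unfolding \<phi>_def using that by (auto intro!: card_mono)
  have strict: "\<phi> s < \<phi> t" if "(v, p, q, s) \<in> comm X" "s < t" for s t v p q
  proof -
    have "1 \<le> s" using valid_comm(4)[OF valid that(1)] by simp
    moreover have "busy s" using that(1) by (auto simp: busy_def)
    ultimately have "{t \<in> {1..<s}. busy t} \<subset> {t' \<in> {1..<t}. busy t'}" using that(2) by auto
    then show ?thesis unfolding \<phi>_def by (simp add: psubset_card_mono)
  qed
  have range: "\<phi> s \<in> {1..\<phi> ?S}" if "s \<in> {1..?S}" for s
    using mono[of s ?S] that by (auto simp: \<phi>_def)
  have le: "\<phi> ?S \<le> ?S"
  proof -
    have "card {t \<in> {1..<?S}. busy t} \<le> card {1..<?S}" by (rule card_mono) auto
    then show ?thesis using S by (simp add: \<phi>_def)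
  qed
  have busy_cost: "1 \<le> comm_cost P X s" if b: "busy s" for s
  proof -
    obtain v p q where x: "(v, p, q, s) \<in> comm X" using b by (auto simp: busy_def)
    have p: "p \<in> {1..P}" using valid_comm(2)[OF valid x] .
    have "finite {(v, p1, p2, s') \<in> comm X. p1 = p \<and> s' = s}" using fin by (rule finite_subset[rotated]) auto
    moreover have "{(v, p1, p2, s') \<in> comm X. p1 = p \<and> s' = s} \<noteq> {}" using x by auto
    ultimately have "0 < sent_cost X s p" by (simp only: sent_cost_def card_gt_0_iff simp_thms)
    then show ?thesis using comm_cost_ge(1)[OF p, of X s] by simp
  qed
  have "card {t \<in> {1..<?S}. busy t} = (\<Sum>t\<in>{t \<in> {1..<?S}. busy t}. 1)" by simp
  also have "\<dots> \<le> (\<Sum>t\<in>{t \<in> {1..<?S}. busy t}. comm_cost P X t)"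
    by (rule sum_mono) (use busy_cost in auto)
  also have "\<dots> \<le> (\<Sum>s\<in>{1..?S}. comm_cost P X s)" by (rule sum_mono2) auto
  finally have few: "\<phi> ?S \<le> Suc (\<Sum>s\<in>{1..?S}. comm_cost P X s)" by (simp add: \<phi>_def)
  define Y where "Y = \<lparr>supersteps = \<phi> ?S, proc = proc X, step = \<phi> \<circ> step X,
      comm = (\<lambda>(v, p, q, s). (v, p, q, \<phi> s)) ` comm X\<rparr>"
  have Y1: "valid_schedule P V E Y"
    unfolding Y_def
    by (rule merge_supersteps(1)[where \<phi> = \<phi> and S' = "\<phi> ?S", OF P V valid]) (fact range mono strict)+
  have Y2: "total_cost P g L V Y + L * ?S \<le> total_cost P g L V X + L * \<phi> ?S"
    unfolding Y_def
    by (rule merge_supersteps(2)[where \<phi> = \<phi> and S' = "\<phi> ?S", OF P V valid]) (fact range mono strict)+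
  have "L * \<phi> ?S \<le> L * ?S" using le by simp
  then have "total_cost P g L V Y \<le> total_cost P g L V X" using Y2 by linarith
  moreover have "supersteps Y = \<phi> ?S" "1 \<le> \<phi> ?S" by (simp_all add: Y_def \<phi>_def)
  ultimately show thesis using le few by (intro that[OF Y1]) simp_all
qed

text \<open>Turns a timetable of unit slots into a schedule. A new superstep begins at each time in
  \<open>D\<close>, and \<open>cut\<close> demands such a time between the ends of every edge that
  changes the processor. The times are split among the supersteps and a processor has one node per
  time, so the work costs add up to at most \<open>W\<close>.\<close>

lemma placement_schedule:
  fixes V :: "'v set" and pr tm :: "'v \<Rightarrow> nat"
  assumes P: "1 \<le> P" and V: "finite V" "E \<subseteq> V \<times> V"
    and pr: "\<And>v. v \<in> V \<Longrightarrow> pr v \<in> {1..P}" and tm: "\<And>v. v \<in> V \<Longrightarrow> tm v < W"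
    and inj: "inj_on (\<lambda>v. (pr v, tm v)) V" and D: "finite D"
    and le: "\<And>u v. (u, v) \<in> E \<Longrightarrow> tm u \<le> tm v"
    and cut: "\<And>u v. (u, v) \<in> E \<Longrightarrow> pr u \<noteq> pr v \<Longrightarrow> \<exists>d\<in>D. tm u < d \<and> d \<le> tm v"
  obtains X where "valid_schedule P V E X" "supersteps X = Suc (card D)"
    "total_cost P g L V X \<le> W + g * card {(u, pr v) | u v. (u, v) \<in> E \<and> pr u \<noteq> pr v} + L * Suc (card D)"
proof -
  \<comment> \<open>Pairs of a node and a receiving processor: successors on the same processor
    share a transmission.\<close>
  define C where "C = {(u, pr v) | u v. (u, v) \<in> E \<and> pr u \<noteq> pr v}"
  define stp where "stp t = Suc (card {d \<in> D. d \<le> t})" for t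
  define X where "X = \<lparr>supersteps = Suc (card D), proc = pr, step = stp \<circ> tm,
    comm = (\<lambda>(u, q). (u, pr u, q, stp (tm u))) ` C\<rparr>"
  have "C \<subseteq> (\<lambda>(u, v). (u, pr v)) ` E" by (auto simp: C_def)
  moreover have "finite E" using V by (auto intro: finite_subset)
  ultimately have finC: "finite C" by (auto intro: finite_subset)
  have stp_mono: "stp s \<le> stp t" if "s \<le> t" for s t
    unfolding stp_def using that D by (auto intro!: card_mono)
  have stp_range: "stp t \<in> {1..Suc (card D)}" for t
    unfolding stp_def using D by (auto intro!: card_mono)
  have "valid_schedule P V E X"
    unfolding valid_schedule_def
  proof (intro conjI)
    show "\<forall>v\<in>V. proc X v \<in> {1..P} \<and> step X v \<in> {1..supersteps X}"
      using pr stp_range by (simp add: X_def)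
    show "comm X \<subseteq> V \<times> {1..P} \<times> {1..P} \<times> {1..supersteps X}"
      using V(2) pr stp_range by (auto simp: X_def C_def)
    show "\<forall>(u, v)\<in>E. (proc X u = proc X v \<longrightarrow> step X u \<le> step X v) \<and>
        (proc X u \<noteq> proc X v \<longrightarrow> (\<exists>s. s < step X v \<and> (u, proc X u, proc X v, s) \<in> comm X))"
    proof (clarify, intro conjI impI)
      fix u v assume uv: "(u, v) \<in> E"
      show "step X u \<le> step X v" using le[OF uv] stp_mono by (simp add: X_def)
      show "\<exists>s. s < step X v \<and> (u, proc X u, proc X v, s) \<in> comm X" if ne: "proc X u \<noteq> proc X v"
      proof -
        obtain d where "d \<in> D" "tm u < d" "d \<le> tm v" using cut[OF uv] ne by (auto simp: X_def)
        then have "{d \<in> D. d \<le> tm u} \<subset> {d \<in> D. d \<le> tm v}" by force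
        then have "stp (tm u) < stp (tm v)" using D by (simp add: stp_def psubset_card_mono)
        moreover have "(u, pr v) \<in> C" using uv ne by (auto simp: C_def X_def)
        ultimately show ?thesis by (force simp: X_def)
      qed
    qed
    show "\<forall>(v, p1, p2, s)\<in>comm X. p1 = proc X v \<and> step X v \<le> s"
      by (auto simp: X_def)
  qed
  moreover have "total_cost P g L V X \<le> W + g * card C + L * Suc (card D)"
  proof -
    have work: "work_cost P V X s \<le> card {t \<in> {..<W}. stp t = s}" for s
    proof (rule work_cost_le[OF P])
      fix p
      have "inj_on tm {v \<in> V. proc X v = p \<and> step X v = s}"
        using inj by (auto simp: inj_on_def X_def)
      moreover have "tm ` {v \<in> V. proc X v = p \<and> step X v = s} \<subseteq> {t \<in> {..<W}. stp t = s}"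
        using tm by (auto simp: X_def)
      ultimately show "card {v \<in> V. proc X v = p \<and> step X v = s} \<le> card {t \<in> {..<W}. stp t = s}"
        by (intro card_inj_on_le) auto
    qed
    have "(\<Sum>s\<in>{1..Suc (card D)}. work_cost P V X s) \<le> (\<Sum>s\<in>{1..Suc (card D)}. \<Sum>t\<in>{t \<in> {..<W}. stp t = s}. 1)"
      using work by (intro sum_mono) simp
    also have "\<dots> = (\<Sum>t<W. 1)" by (rule sum.group) (use stp_range in auto)
    finally have work_sum: "(\<Sum>s\<in>{1..Suc (card D)}. work_cost P V X s) \<le> W" by simp
    have finX: "finite (comm X)" using finC by (simp add: X_def)
    have comm: "comm_cost P X s \<le> card {x \<in> comm X. snd (snd (snd x)) = s}" for s
      by (rule comm_cost_le[OF P]; unfold sent_cost_def rec_cost_def; rule card_mono) (use finX in auto)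
    have "(\<Sum>s\<in>{1..Suc (card D)}. comm_cost P X s) \<le>
        (\<Sum>s\<in>{1..Suc (card D)}. \<Sum>x\<in>{x \<in> comm X. snd (snd (snd x)) = s}. 1)"
      using comm by (intro sum_mono) simp
    also have "\<dots> = (\<Sum>x\<in>comm X. 1)"
    proof (rule sum.group[OF finX])
      show "(\<lambda>x. snd (snd (snd x))) ` comm X \<subseteq> {1..Suc (card D)}"
        using stp_range by (auto simp: X_def simp del: One_nat_def)
    qed simp
    also have "\<dots> \<le> card C" using card_image_le[OF finC] by (simp add: X_def)
    finally have "(\<Sum>s\<in>{1..Suc (card D)}. comm_cost P X s) \<le> card C" .
    then show ?thesis
      using work_sum unfolding total_cost_alt by (simp add: X_def add_mono)
  qed
  ultimately show thesis by (intro that[of X]) (simp_all add: X_def C_def)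
qed

text \<open>By \<open>valid_edge_precedes\<close>, the nodes of \<open>A\<close> in one superstep
  lie on one processor, so they are bounded by the work cost of that superstep.\<close>

lemma comparable_le_work:
  assumes valid: "valid_schedule P V E X" and A: "A \<subseteq> V" "finite V"
    and comparable: "\<And>u v. u \<in> A \<Longrightarrow> v \<in> A \<Longrightarrow> u = v \<or> (u, v) \<in> E\<^sup>+ \<or> (v, u) \<in> E\<^sup>+"
  shows "card A \<le> (\<Sum>s\<in>{1..supersteps X}. work_cost P V X s)"
proof -
  have fin: "finite A" using A by (rule finite_subset)
  have "card {v \<in> A. step X v = s} \<le> work_cost P V X s" for s
  proof (cases "{v \<in> A. step X v = s} = {}")
    case False
    then obtain u where u: "u \<in> A" "step X u = s" by blast
    have "proc X v = proc X u" if v: "v \<in> A" "step X v = s" for v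
      using comparable[OF u(1) v(1)] valid_edge_precedes[OF valid, of u v] valid_edge_precedes[OF valid, of v u] u v
      by auto
    then have "{v \<in> A. step X v = s} \<subseteq> {v \<in> V. proc X v = proc X u \<and> step X v = s}" using A by auto
    then have "card {v \<in> A. step X v = s} \<le> card {v \<in> V. proc X v = proc X u \<and> step X v = s}"
      using A(2) by (intro card_mono) auto
    also have "\<dots> \<le> work_cost P V X s"
      using valid_node[OF valid, of u] u A by (intro work_cost_ge) auto
    finally show ?thesis .
  next
    case True
    show ?thesis by (simp only: True) simp
  qed
  then have "(\<Sum>s\<in>{1..supersteps X}. \<Sum>v\<in>{v \<in> A. step X v = s}. (1::nat)) \<le> (\<Sum>s\<in>{1..supersteps X}. work_cost P V X s)"
    by (intro sum_mono) simp
  moreover have "(\<Sum>s\<in>{1..supersteps X}. \<Sum>v\<in>{v \<in> A. step X v = s}. (1::nat)) = (\<Sum>v\<in>A. 1)"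
  proof (rule sum.group[OF fin])
    show "step X ` A \<subseteq> {1..supersteps X}" using valid_node[OF valid] A by auto
  qed simp
  ultimately show ?thesis by simp
qed

lemma step_card_le:
  assumes valid: "valid_schedule P V E X" and V: "finite V"
  shows "card {v \<in> V. step X v = s} \<le> P * work_cost P V X s"
proof -
  have "{v \<in> V. step X v = s} \<subseteq> (\<Union>p\<in>{1..P}. {v \<in> V. proc X v = p \<and> step X v = s})"
    using valid_node[OF valid] by auto
  then have "card {v \<in> V. step X v = s} \<le> card (\<Union>p\<in>{1..P}. {v \<in> V. proc X v = p \<and> step X v = s})"
    using V by (intro card_mono) auto
  also have "\<dots> \<le> (\<Sum>p\<in>{1..P}. card {v \<in> V. proc X v = p \<and> step X v = s})" by (rule card_UN_le) simp
  also have "\<dots> \<le> (\<Sum>p\<in>{1..P}. work_cost P V X s)" by (intro sum_mono work_cost_ge)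
  finally show ?thesis by simp
qed

lemma card_steps:
  assumes valid: "valid_schedule P V E X" and V: "finite V"
  shows "(\<Sum>s\<in>{1..supersteps X}. card {v \<in> V. step X v = s}) = card V"
proof -
  have "(\<Sum>s\<in>{1..supersteps X}. \<Sum>v\<in>{v \<in> V. step X v = s}. (1::nat)) = (\<Sum>v\<in>V. 1)"
  proof (rule sum.group[OF V])
    show "step X ` V \<subseteq> {1..supersteps X}" using valid_node[OF valid] by auto
  qed simp
  then show ?thesis by simp
qed

lemma card_le_P_work:
  assumes valid: "valid_schedule P V E X" and V: "finite V"
  shows "card V \<le> P * (\<Sum>s\<in>{1..supersteps X}. work_cost P V X s)"
  unfolding card_steps[OF assms, symmetric] sum_distrib_left
  by (intro sum_mono step_card_le[OF assms])

text \<open>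
  No processor but that of the source can work in the superstep of the source.
\<close>

lemma card_le_P_work_source:
  assumes P: "1 \<le> P" and valid: "valid_schedule P V E X" and V: "finite V" "v0 \<in> V"
    and src: "\<And>v. v \<in> V \<Longrightarrow> v \<noteq> v0 \<Longrightarrow> (v0, v) \<in> E\<^sup>+"
  shows "1 \<le> (\<Sum>s\<in>{1..supersteps X}. work_cost P V X s)"
    "card V \<le> Suc (P * ((\<Sum>s\<in>{1..supersteps X}. work_cost P V X s) - 1))"
proof -
  define w c where "w s = work_cost P V X s" and "c s = card {v \<in> V. step X v = s}" for s
  define t where "t = step X v0"
  define R where "R = {1..supersteps X} - {t}"
  have t: "t \<in> {1..supersteps X}" using valid_node[OF valid V(2)] by (simp add: t_def)
  have "{v \<in> V. step X v = t} \<subseteq> {v \<in> V. proc X v = proc X v0 \<and> step X v = t}"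
  proof
    fix v assume v: "v \<in> {v \<in> V. step X v = t}"
    have "proc X v = proc X v0"
    proof (cases "v = v0")
      case False
      then have "(v0, v) \<in> E\<^sup>+" using src v by simp
      from valid_edge_precedes[OF valid this] show ?thesis using v by (simp add: t_def)
    qed simp
    then show "v \<in> {v \<in> V. proc X v = proc X v0 \<and> step X v = t}" using v by simp
  qed
  then have "c t \<le> card {v \<in> V. proc X v = proc X v0 \<and> step X v = t}"
    unfolding c_def using V by (intro card_mono) auto
  also have "\<dots> \<le> w t" unfolding w_def using valid_node[OF valid V(2)] by (intro work_cost_ge) auto
  finally have ct: "c t \<le> w t" .
  have "v0 \<in> {v \<in> V. step X v = t}" using V by (simp add: t_def)
  then have "0 < c t" unfolding c_def using V(1) by (auto simp: card_gt_0_iff)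
  then have wt: "1 \<le> w t" using ct by simp
  have W: "(\<Sum>s\<in>{1..supersteps X}. w s) = w t + sum w R" unfolding R_def using t by (intro sum.remove) auto
  show "1 \<le> (\<Sum>s\<in>{1..supersteps X}. work_cost P V X s)" using W wt by (simp add: w_def)
  have "card V = (\<Sum>s\<in>{1..supersteps X}. c s)" unfolding c_def by (simp only: card_steps[OF valid V(1)])
  also have "\<dots> = c t + sum c R" unfolding R_def using t by (intro sum.remove) auto
  also have "sum c R \<le> (\<Sum>s\<in>R. P * w s)"
    by (intro sum_mono) (simp only: c_def w_def step_card_le[OF valid V(1)])
  also have "(\<Sum>s\<in>R. P * w s) = P * sum w R" by (simp only: sum_distrib_left)
  finally have "card V \<le> w t + P * sum w R" using ct by simp
  \<comment> \<open>The source is split off from the bound \<open>w t\<close> on its superstep; the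
    remaining \<open>k\<close> is then weakened to \<open>P * k\<close> to match the other
    supersteps.\<close>
  moreover obtain k where k: "w t = Suc k" using wt by (cases "w t") auto
  moreover have "k \<le> P * k" using P by simp
  ultimately have "card V \<le> Suc (P * k + P * sum w R)" by linarith
  then show "card V \<le> Suc (P * ((\<Sum>s\<in>{1..supersteps X}. work_cost P V X s) - 1))"
    using W k by (simp add: w_def add_mult_distrib2)
qed

section \<open>Lower bounds on the work in terms of a layout\<close>

lemma layout_finite: "layout conn v0 xs st V E \<Longrightarrow> finite V \<and> E \<subseteq> V \<times> V"
  by (auto simp: layout_def)

lemma layout_chain_step:
  assumes "layout conn v0 xs st V E" "Suc i < length xs" "\<not> st (Suc i)"
  shows "(xs ! i, xs ! Suc i) \<in> E"
proof -
  have "(xs ! i, xs ! Suc i) \<in> {(xs ! (i - 1), xs ! i) | i. 0 < i \<and> i < length xs \<and> \<not> st i}"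
    using assms(2,3) by (auto intro!: exI[of _ "Suc i"])
  then show ?thesis using assms(1) unfolding layout_def by blast
qed

lemma layout_chain_trancl:
  assumes lay: "layout conn v0 xs st V E" and "a < b" "b < length xs" "\<And>k. a < k \<Longrightarrow> k \<le> b \<Longrightarrow> \<not> st k"
  shows "(xs ! a, xs ! b) \<in> E\<^sup>+"
proof -
  have "Suc a \<le> b" using assms(2) by simp
  then show ?thesis using assms(3,4)
  proof (induction b rule: dec_induct)
    case base
    then show ?case using layout_chain_step[OF lay] by auto
  next
    case (step b)
    then have "(xs ! b, xs ! Suc b) \<in> E" using layout_chain_step[OF lay] by auto
    then show ?case using step by (auto intro: trancl_into_trancl)
  qed
qed

text \<open>Finds the beginning of the chain through position \<open>i\<close>;
  \<open>next_start\<close> is the counterpart for its end.\<close>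

lemma last_start:
  assumes "st (0::nat)"
  shows "\<exists>a\<le>i. st a \<and> (\<forall>k. a < k \<longrightarrow> k \<le> i \<longrightarrow> \<not> st k)"
proof (induction i)
  case (Suc i)
  then obtain a where a: "a \<le> i" "st a" "\<forall>k. a < k \<longrightarrow> k \<le> i \<longrightarrow> \<not> st k" by blast
  show ?case
  proof (cases "st (Suc i)")
    case False
    then show ?thesis using a by (intro exI[of _ a]) (auto simp: le_Suc_eq)
  qed (intro exI[of _ "Suc i"], simp)
qed (use assms in auto)

lemma layout_source_trancl:
  assumes lay: "layout True v0 xs st V E" and v: "v \<in> set xs"
  shows "(v0, v) \<in> E\<^sup>+"
proof -
  obtain i where i: "i < length xs" "xs ! i = v" using v by (meson in_set_conv_nth)
  have "st 0" using lay i by (auto simp: layout_def)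
  then obtain a where a: "a \<le> i" "st a" "\<forall>k. a < k \<longrightarrow> k \<le> i \<longrightarrow> \<not> st k"
    using last_start[of st i] by blast
  have "(v0, xs ! a) \<in> {(v0, xs ! i) | i. i < length xs \<and> st i}" using a i by auto
  then have v0a: "(v0, xs ! a) \<in> E" using lay unfolding layout_def by auto
  show ?thesis
  proof (cases "a = i")
    case False
    then have "(xs ! a, xs ! i) \<in> E\<^sup>+" using a i layout_chain_trancl[OF lay, of a i] by auto
    then show ?thesis using v0a i by (metis r_into_trancl trancl_trans)
  qed (use v0a i in auto)
qed

text \<open>These are the two conditions of the wrap-around rule for
  \<open>T = W - of_bool conn\<close>: the total capacity of the processors and the length of each
  chain. The unit subtracted is the one that the source consumes alone.\<close>

lemma layout_lower_bounds:
  assumes P: "1 \<le> P" and lay: "layout conn v0 xs st V E" and valid: "valid_schedule P V E X"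
  defines "W \<equiv> \<Sum>s\<in>{1..supersteps X}. work_cost P V X s"
  shows "conn \<Longrightarrow> 1 \<le> W" "length xs \<le> P * (W - of_bool conn)"
    "a \<le> b \<Longrightarrow> b < length xs \<Longrightarrow> (\<And>k. a < k \<Longrightarrow> k \<le> b \<Longrightarrow> \<not> st k) \<Longrightarrow> b < a + (W - of_bool conn)"
proof -
  have V: "finite V" "E \<subseteq> V \<times> V" using layout_finite[OF lay] by auto
  have d: "distinct xs" "set xs \<subseteq> V" using lay by (auto simp: layout_def)
  have v0: "v0 \<in> V" "\<And>v. v \<in> V \<Longrightarrow> v \<noteq> v0 \<Longrightarrow> (v0, v) \<in> E\<^sup>+" "card V = Suc (length xs)" if conn
  proof -
    show "v0 \<in> V" using lay that by (simp add: layout_def)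
    show "(v0, v) \<in> E\<^sup>+" if "v \<in> V" "v \<noteq> v0" for v
      using layout_source_trancl[of v0 xs st V E v] lay that \<open>conn\<close> by (auto simp: layout_def)
    show "card V = Suc (length xs)" using lay that by (auto simp: layout_def distinct_card)
  qed
  show W1: "conn \<Longrightarrow> 1 \<le> W"
    unfolding W_def using card_le_P_work_source(1)[OF P valid V(1) v0(1,2)] by blast
  show "length xs \<le> P * (W - of_bool conn)"
  proof (cases conn)
    case True
    then show ?thesis using card_le_P_work_source(2)[OF P valid V(1) v0(1,2)] v0(3) by (simp add: W_def)
  next
    case False
    then have "card V = length xs" using lay by (simp add: layout_def distinct_card)
    then show ?thesis using card_le_P_work[OF valid V(1)] False by (simp add: W_def)
  qed
  show "b < a + (W - of_bool conn)" if ab: "a \<le> b" "b < length xs" "\<And>k. a < k \<Longrightarrow> k \<le> b \<Longrightarrow> \<not> st k"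
  proof -
    define A where "A = (!) xs ` {a..b}"
    \<comment> \<open>The source is comparable with every node, so it lengthens the chain by
      one.\<close>
    define A' where "A' = (if conn then insert v0 A else A)"
    have "inj_on ((!) xs) {a..b}" using d(1) ab(2) by (intro inj_on_nth) auto
    then have cA: "card A = Suc b - a" by (simp add: A_def card_image)
    have AV: "A \<subseteq> set xs" using ab(2) by (auto simp: A_def)
    have "card A' = card A + of_bool conn"
      using lay AV by (auto simp: A'_def layout_def A_def card_insert_if)
    moreover have "card A' \<le> W"
      unfolding W_def
    proof (rule comparable_le_work[OF valid _ V(1)])
      show "A' \<subseteq> V" using AV d v0 by (auto simp: A'_def)
      fix u v assume uv: "u \<in> A'" "v \<in> A'"
      have in_A: "u = v \<or> (u, v) \<in> E\<^sup>+ \<or> (v, u) \<in> E\<^sup>+" if A: "u \<in> A" "v \<in> A" for u v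
      proof -
        obtain i j where ij: "u = xs ! i" "v = xs ! j" "i \<in> {a..b}" "j \<in> {a..b}"
          using A unfolding A_def by blast
        consider "i < j" | "i = j" | "j < i" by linarith
        then show ?thesis
          using ij ab layout_chain_trancl[OF lay, of i j] layout_chain_trancl[OF lay, of j i] by cases auto
      qed
      have src: "(v0, v) \<in> E\<^sup>+" if "conn" "v \<in> A" for v
        using layout_source_trancl[of v0 xs st V E v] lay that AV by auto
      show "u = v \<or> (u, v) \<in> E\<^sup>+ \<or> (v, u) \<in> E\<^sup>+"
        using uv in_A src by (auto simp: A'_def split: if_splits)
    qed
    ultimately show ?thesis using cA ab(1) by simp
  qed
qed

lemma next_start:
  fixes i m :: nat
  assumes "i < m"
  shows "\<exists>e. i < e \<and> (m \<le> e \<or> st e) \<and> (\<forall>k. i < k \<longrightarrow> k < e \<longrightarrow> k < m \<and> \<not> st k)"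
proof -
  define Q where "Q e \<longleftrightarrow> i < e \<and> (m \<le> e \<or> st e)" for e
  have "Q m" using assms by (simp add: Q_def)
  then obtain e where "Q e" "\<forall>k<e. \<not> Q k" using exists_least_iff[of Q] by blast
  then show ?thesis by (intro exI[of _ e]) (auto simp: Q_def not_le)
qed

text \<open>
  McNaughton's wrap-around rule. The chains are laid out one after the other in the slots
  \<open>{..<m}\<close>, and every processor takes \<open>T\<close> consecutive slots. A chain that crosses the border
  between two processors is rotated within its slots, so that its beginning is processed
  by the later processor at the beginning of its time, and its end by the earlier one at the
  end of its time.
\<close>

locale wrap_around =
  fixes m T :: nat and st :: "nat \<Rightarrow> bool"
  assumes st0: "st 0" and T_pos: "0 < T"
    and short: "\<And>a b. a \<le> b \<Longrightarrow> b < m \<Longrightarrow> (\<And>k. a < k \<Longrightarrow> k \<le> b \<Longrightarrow> \<not> st k) \<Longrightarrow> b < a + T"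
begin

definition chain :: "nat \<Rightarrow> nat \<Rightarrow> bool" where
  "chain a e \<longleftrightarrow> a < e \<and> e \<le> m \<and> st a \<and> (e = m \<or> st e) \<and> (\<forall>k. a < k \<longrightarrow> k < e \<longrightarrow> \<not> st k)"

lemma chain_exists: "i < m \<Longrightarrow> \<exists>a e. chain a e \<and> a \<le> i \<and> i < e"
proof -
  assume i: "i < m"
  obtain a where a: "a \<le> i" "st a" "\<forall>k. a < k \<longrightarrow> k \<le> i \<longrightarrow> \<not> st k"
    using last_start[of st i, OF st0] by blast
  obtain e where e: "i < e" "m \<le> e \<or> st e" "\<forall>k. i < k \<longrightarrow> k < e \<longrightarrow> k < m \<and> \<not> st k"
    using next_start[OF i] by blast
  have "e \<le> m" using e i by (cases "e \<le> m") auto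
  moreover have "\<not> st k" if "a < k" "k < e" for k using a(3) e(3) that by (cases "k \<le> i") auto
  ultimately have "chain a e" unfolding chain_def using a e by auto
  then show ?thesis using a e by blast
qed

lemma chain_disjoint: "chain a e \<Longrightarrow> chain a' e' \<Longrightarrow> (a = a' \<and> e = e') \<or> e \<le> a' \<or> e' \<le> a"
proof -
  assume c: "chain a e" "chain a' e'"
  have no: "x' \<le> x" if "chain x y" "chain x' y'" "x' < y" for x y x' y'
  proof (rule ccontr)
    assume "\<not> x' \<le> x"
    then show False using that by (auto simp: chain_def)
  qed
  have "e = e'" if "a = a'"
  proof (rule ccontr)
    assume "e \<noteq> e'"
    then consider "e < e'" | "e' < e" by linarith
    then show False using c that by cases (auto simp: chain_def)
  qed
  then show ?thesis using no[OF c] no[OF c(2,1)] by linarith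
qed

lemma chain_short: "chain a e \<Longrightarrow> e \<le> a + T"
proof -
  assume c: "chain a e"
  then have "e - 1 < a + T" unfolding chain_def by (intro short) auto
  then show ?thesis by linarith
qed

text \<open>The first slot of the processor that owns slot \<open>e - 1\<close>, the last one of the
  chain. A chain has at most \<open>T\<close> slots, so no other multiple of \<open>T\<close> lies
  strictly inside it.\<close>

definition border :: "nat \<Rightarrow> nat" where
  "border e = T * ((e - 1) div T)"

text \<open>The number of slots that the chain has before the border it crosses. A cyclic shift by
  this amount sends the first node exactly to the border.\<close>

definition rot :: "nat \<Rightarrow> nat \<Rightarrow> nat" where
  "rot a e = (if a < border e then border e - a else 0)"

definition slot_in :: "nat \<Rightarrow> nat \<Rightarrow> nat \<Rightarrow> nat" where
  "slot_in a e i = (if i + rot a e < e then i + rot a e else i + rot a e - (e - a))"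

text \<open>The choice is unambiguous by \<open>chain_disjoint\<close>.\<close>

definition slot :: "nat \<Rightarrow> nat" where
  "slot i = (SOME s. \<exists>a e. chain a e \<and> a \<le> i \<and> i < e \<and> s = slot_in a e i)"

lemma slot_eq: "chain a e \<Longrightarrow> a \<le> i \<Longrightarrow> i < e \<Longrightarrow> slot i = slot_in a e i"
  unfolding slot_def
proof (rule some_equality)
  fix s assume c: "chain a e" "a \<le> i" "i < e" and "\<exists>a e. chain a e \<and> a \<le> i \<and> i < e \<and> s = slot_in a e i"
  then obtain a' e' where "chain a' e'" "a' \<le> i" "i < e'" "s = slot_in a' e' i" by blast
  then show "s = slot_in a e i" using chain_disjoint[OF c(1), of a' e'] c by auto
qed blast

lemma border_le: "0 < e \<Longrightarrow> border e < e"
proof -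
  assume "0 < e"
  have "border e \<le> e - 1" unfolding border_def by simp
  then show ?thesis using \<open>0 < e\<close> by linarith
qed

lemma slot_in_range: "a \<le> i \<Longrightarrow> i < e \<Longrightarrow> a \<le> slot_in a e i \<and> slot_in a e i < e"
  using border_le[of e] unfolding slot_in_def rot_def by auto

lemma slot_in_inj: "a \<le> i \<Longrightarrow> i < e \<Longrightarrow> a \<le> j \<Longrightarrow> j < e \<Longrightarrow> slot_in a e i = slot_in a e j \<Longrightarrow> i = j"
  using border_le[of e] unfolding slot_in_def rot_def by (auto split: if_splits)

lemma slot_less: "i < m \<Longrightarrow> slot i < m"
proof -
  assume "i < m"
  then obtain a e where c: "chain a e" "a \<le> i" "i < e" using chain_exists by blast
  then have "slot i < e" using slot_eq slot_in_range by simp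
  then show ?thesis using c by (simp add: chain_def)
qed

lemma slot_inj: "inj_on slot {..<m}"
proof (rule inj_onI)
  fix i j assume ij: "i \<in> {..<m}" "j \<in> {..<m}" "slot i = slot j"
  obtain a e where c: "chain a e" "a \<le> i" "i < e" using chain_exists ij by blast
  obtain a' e' where c': "chain a' e'" "a' \<le> j" "j < e'" using chain_exists ij by blast
  have s: "slot i = slot_in a e i" "slot j = slot_in a' e' j" using c c' slot_eq by auto
  have "a = a' \<and> e = e'"
    using chain_disjoint[OF c(1) c'(1)] slot_in_range[OF c(2,3)] slot_in_range[OF c'(2,3)] s ij(3) by auto
  then show "i = j" using slot_in_inj[OF c(2,3), of j] c' s ij(3) by auto
qed

definition crossing :: "nat \<Rightarrow> bool" where
  "crossing i \<longleftrightarrow> Suc i < m \<and> \<not> st (Suc i) \<and> slot (Suc i) div T \<noteq> slot i div T"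

text \<open>Precedence survives the rotation. Apart from the wrap from the last slot of a chain to
  its first, a successor takes the next slot of the same processor. At the wrap it moves to the
  previous processor, but still to a later time, because the chain has at most \<open>T\<close>
  slots.\<close>

lemma slot_edge:
  assumes c: "chain a e" "a \<le> i" "Suc i < e"
  shows "(slot (Suc i) div T = slot i div T \<and> slot (Suc i) mod T = Suc (slot i mod T)) \<or>
    (Suc (slot (Suc i) div T) = slot i div T \<and> slot i mod T < slot (Suc i) mod T \<and> Suc (slot i) = e \<and> slot (Suc i) = a)"
proof -
  define B r where "B = border e" and "r = rot a e"
  define q where "q = (e - 1) div T"
  have e: "0 < e" "B < e" "B = T * q" using c border_le[of e] by (auto simp: B_def border_def q_def)
  have eB: "e \<le> B + T"
  proof -
    have "e - 1 < T + B" unfolding B_def border_def using T_pos by (simp add: dividend_less_times_div)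
    then show ?thesis by linarith
  qed
  have eT: "e \<le> a + T" using chain_short[OF c(1)] .
  have s: "slot i = slot_in a e i" "slot (Suc i) = slot_in a e (Suc i)" using c slot_eq by auto
  have r: "r = (if a < B then B - a else 0)" by (simp add: r_def rot_def B_def)
  show ?thesis
  proof (cases "slot i = e - 1")
    case False
    have nxt: "slot (Suc i) = Suc (slot i)"
      using False c e r unfolding s slot_in_def r_def[symmetric] by (auto split: if_splits)
    have range: "a \<le> slot i" "Suc (slot i) < e"
      using slot_in_range[of a i e] slot_in_range[of a "Suc i" e] c nxt by (auto simp: s)
    \<comment> \<open>Otherwise a border would separate the two slots. It could only be
      \<open>B\<close>, but that slot belongs to the first node of the rotated chain, which is
      nobody's successor within it.\<close>
    have "\<not> T dvd Suc (slot i)"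
    proof
      assume "T dvd Suc (slot i)"
      then obtain k where k: "Suc (slot i) = T * k" by (auto elim: dvdE)
      have "T * k < T * Suc q" "T * q < T * Suc k"
        using k range eB eT e by (simp_all add: algebra_simps)
      then have "k < Suc q" "q < Suc k" unfolding mult_less_cancel1 by blast+
      then have "k = q" by linarith
      then have B: "Suc (slot i) = B" using k e by simp
      then have "r = B - a" "a < B" using r range by auto
      then show False using B c e unfolding s slot_in_def r_def[symmetric] by (auto split: if_splits)
    qed
    then have "Suc (slot i mod T) \<noteq> T" "Suc (slot i) mod T \<noteq> 0" by (auto simp: mod_Suc dvd_eq_mod_eq_0)
    then show ?thesis unfolding nxt by (auto simp: mod_Suc div_Suc)
  next
    case True
    have a: "slot (Suc i) = a" and "0 < r"
      using True c e r unfolding s slot_in_def r_def[symmetric] by (auto split: if_splits)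
    then have aB: "a < B" "r = B - a" using r by (auto split: if_splits)
    then obtain q' where q': "q = Suc q'" using e by (cases q) auto
    have d1: "slot i div T = q" using True by (simp add: q_def)
    have m1: "slot i mod T = e - 1 - B" using True by (simp add: B_def border_def minus_mult_div_eq_mod)
    define x where "x = a - T * q'"
    have ax: "a = T * q' + x" "x < T" using aB eT e q' unfolding x_def by (auto simp: algebra_simps)
    have d2: "a div T = q'" "a mod T = x" using ax T_pos by auto
    \<comment> \<open>The two parts of the chain occupy disjoint times: as
      \<open>B = T * q' + T\<close>, this amounts to \<open>e \<le> a + T\<close>.\<close>
    have "e - 1 - B < x" using ax eT e q' by (simp add: algebra_simps)
    then show ?thesis using a d1 d2 m1 q' True e by simp
  qed
qed

lemma chain_step: "Suc i < m \<Longrightarrow> \<not> st (Suc i) \<Longrightarrow> \<exists>a e. chain a e \<and> a \<le> i \<and> Suc i < e"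
proof -
  assume i: "Suc i < m" "\<not> st (Suc i)"
  obtain a e where c: "chain a e" "a \<le> Suc i" "Suc i < e" using chain_exists[OF i(1)] by blast
  then have "a \<noteq> Suc i" using i(2) by (auto simp: chain_def)
  then show ?thesis using c by (intro exI[of _ a] exI[of _ e]) auto
qed

text \<open>A crossing is identified by the border it crosses, and \<open>P\<close> blocks of slots
  have \<open>P - 1\<close> inner borders.\<close>

lemma crossing_card:
  assumes "m \<le> P * T"
  shows "finite {i. crossing i} \<and> card {i. crossing i} \<le> P - 1"
proof -
  have inj: "inj_on (\<lambda>i. slot i div T) {i. crossing i}"
  proof (rule inj_onI)
    fix i j assume ij: "i \<in> {i. crossing i}" "j \<in> {i. crossing i}" "slot i div T = slot j div T"
    have crossing: "\<exists>a e. chain a e \<and> a \<le> i \<and> i < e \<and> Suc (slot i) = e \<and> Suc (a div T) = slot i div T"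
      if cr: "crossing i" for i
    proof -
      obtain a e where c: "chain a e" "a \<le> i" "Suc i < e" using cr chain_step[of i] by (auto simp: crossing_def)
      have "Suc (slot i) = e" "Suc (a div T) = slot i div T"
        using slot_edge[OF c] cr by (auto simp: crossing_def)
      then show ?thesis using c by (intro exI[of _ a] exI[of _ e]) auto
    qed
    obtain a e where c: "chain a e" "a \<le> i" "i < e" "Suc (slot i) = e" "Suc (a div T) = slot i div T"
      using crossing[of i] ij(1) by blast
    obtain a' e' where c': "chain a' e'" "a' \<le> j" "j < e'" "Suc (slot j) = e'" "Suc (a' div T) = slot j div T"
      using crossing[of j] ij(2) by blast
    \<comment> \<open>Of two different chains one ends before the other begins, so they cannot
      contain the same border.\<close>
    have sep: False if "Suc s \<le> a''" "Suc (a'' div T) = s div T" for s a''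
      using that div_le_mono[of s a'' T] by simp
    have "a = a' \<and> e = e'"
      using chain_disjoint[OF c(1) c'(1)] sep[of "slot i" a'] sep[of "slot j" a] c c' ij(3) by auto
    then have "slot i = slot j" using c c' by auto
    moreover have "i < m" "j < m" using c c' by (auto simp: chain_def)
    ultimately show "i = j" using slot_inj by (auto simp: inj_on_def)
  qed
  have "(\<lambda>i. slot i div T) ` {i. crossing i} \<subseteq> {1..P - 1}"
  proof clarify
    fix i assume cr: "crossing i"
    then obtain a e where c: "chain a e" "a \<le> i" "Suc i < e" using chain_step[of i] by (auto simp: crossing_def)
    then have "1 \<le> slot i div T" using slot_edge[OF c] cr by (auto simp: crossing_def)
    moreover have "slot i < P * T" using slot_less[of i] cr assms by (auto simp: crossing_def)
    then have "slot i div T < P" by (simp add: less_mult_imp_div_less)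
    ultimately show "slot i div T \<in> {1..P - 1}" by simp
  qed
  then have "card {i. crossing i} \<le> card {1..P - 1}" using inj by (intro card_inj_on_le) auto
  moreover have "finite {i. crossing i}" by (rule finite_subset[of _ "{..<m}"]) (auto simp: crossing_def)
  ultimately show ?thesis by simp
qed

end

section \<open>The wrap-around schedule of a layout\<close>

lemma layout_edge_cases:
  assumes "layout conn v0 xs st V E" "(u, v) \<in> E"
  obtains i where "Suc i < length xs" "\<not> st (Suc i)" "u = xs ! i" "v = xs ! Suc i"
  | i where "conn" "u = v0" "i < length xs" "st i" "v = xs ! i"
proof -
  have "(u, v) \<in> {(xs ! (i - 1), xs ! i) | i. 0 < i \<and> i < length xs \<and> \<not> st i} \<or>
    (conn \<and> (u, v) \<in> {(v0, xs ! i) | i. i < length xs \<and> st i})"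
    using assms unfolding layout_def by (auto split: if_splits)
  then show thesis
  proof
    assume "(u, v) \<in> {(xs ! (i - 1), xs ! i) | i. 0 < i \<and> i < length xs \<and> \<not> st i}"
    then obtain i where i: "u = xs ! (i - 1)" "v = xs ! i" "0 < i" "i < length xs" "\<not> st i" by blast
    show thesis by (rule that(1)[of "i - 1"]) (use i in simp_all)
  next
    assume "conn \<and> (u, v) \<in> {(v0, xs ! i) | i. i < length xs \<and> st i}"
    then show thesis using that(2) by blast
  qed
qed

lemma wrap_around_schedule:
  assumes P: "1 \<le> P" and lay: "layout conn v0 xs st V E" and cap: "length xs \<le> P * T"
    and short: "\<And>a b. a \<le> b \<Longrightarrow> b < length xs \<Longrightarrow> (\<And>k. a < k \<Longrightarrow> k \<le> b \<Longrightarrow> \<not> st k) \<Longrightarrow> b < a + T"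
  shows "\<exists>X. valid_schedule P V E X \<and> supersteps X \<le> Suc P \<and>
    total_cost P g L V X \<le> (T + of_bool conn) + g * (2 * P) + L * Suc P"
proof -
  define m where "m = length xs"
  have V: "finite V" "E \<subseteq> V \<times> V" using layout_finite[OF lay] by auto
  \<comment> \<open>A source takes time 0 on processor 1, and all other nodes start one unit
    later.\<close>
  define off :: nat where "off = of_bool conn"
  define slot where wrap_slot: "slot = wrap_around.slot m T st"
  define Z where "Z = {i. Suc i < m \<and> \<not> st (Suc i) \<and> slot (Suc i) div T \<noteq> slot i div T}"
  define idx where "idx v = (THE i. i < m \<and> xs ! i = v)" for v
  define pr where "pr v = (if v \<in> set xs then Suc (slot (idx v) div T) else 1)" for v
  define tm where "tm v = (if v \<in> set xs then slot (idx v) mod T + off else 0)" for v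
  \<comment> \<open>A new superstep begins when a cut chain resumes on another processor, and at
    time 1, when the source is finished. This makes at most \<open>P - 1\<close> cuts and one
    more.\<close>
  define D where "D = (\<lambda>i. slot (Suc i) mod T + off) ` Z \<union> (if conn then {1} else {})"
  have dist: "distinct xs" using lay by (simp add: layout_def)
  have idx: "idx (xs ! i) = i" if i: "i < m" for i
    unfolding idx_def
  proof (rule the_equality)
    show "j = i" if "j < m \<and> xs ! j = xs ! i" for j
      using that i dist by (auto simp: m_def nth_eq_iff_index_eq)
  qed (use i in simp)
  \<comment> \<open>The list of chains may be empty, and only a first position is known to begin a
    chain.\<close>
  have wrap: "wrap_around m T st" if m: "0 < m"
  proof
    show "st 0" using lay m by (auto simp: layout_def m_def)
    have "0 < (0::nat) + T" using m by (intro short) (auto simp: m_def)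
    then show "0 < T" by simp
    show "b < a + T" if "a \<le> b" "b < m" "\<And>k. a < k \<Longrightarrow> k \<le> b \<Longrightarrow> \<not> st k" for a b
      using short[of a b] that by (simp add: m_def)
  qed
  have pt: "pr (xs ! i) = Suc (slot i div T)" "tm (xs ! i) = slot i mod T + off" if "i < m" for i
    using that idx[OF that] by (simp_all add: pr_def tm_def m_def)
  have at: "\<exists>i<m. v = xs ! i" if "v \<in> set xs" for v
    using that by (auto simp: m_def in_set_conv_nth)
  have slot_less: "slot i < m" if i: "i < m" for i
    using wrap_around.slot_less[OF wrap i] i by (simp add: wrap_slot)
  have T: "0 < T" if m: "0 < m" using wrap_around.T_pos[OF wrap[OF m]] .
  have Z: "finite Z" "card Z \<le> P - 1"
  proof -
    have "finite Z \<and> card Z \<le> P - 1"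
    proof (cases "0 < m")
      case True
      have "Z = {i. wrap_around.crossing m T st i}"
        by (simp add: Z_def wrap_around.crossing_def[OF wrap[OF True]] wrap_slot)
      then show ?thesis using wrap_around.crossing_card[OF wrap[OF True], of P] cap by (simp add: m_def)
    qed (simp add: Z_def)
    then show "finite Z" "card Z \<le> P - 1" by auto
  qed
  have V_cases: "v \<in> set xs \<or> (conn \<and> v = v0 \<and> v0 \<notin> set xs)" if "v \<in> V" for v
    using lay that by (auto simp: layout_def split: if_splits)
  have v0: "pr v0 = 1" "tm v0 = 0" "off = 1" if "conn"
    using lay that by (auto simp: layout_def pr_def tm_def off_def)
  have chain_edge: "tm (xs ! i) \<le> tm (xs ! Suc i) \<and>
      (pr (xs ! i) \<noteq> pr (xs ! Suc i) \<longrightarrow> i \<in> Z \<and> tm (xs ! i) < tm (xs ! Suc i))"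
    if i: "Suc i < m" "\<not> st (Suc i)" for i
  proof -
    interpret wrap_around m T st using wrap i by simp
    obtain a e where c: "chain a e" "a \<le> i" "Suc i < e" using chain_step[OF i] by blast
    show ?thesis using slot_edge[OF c, folded wrap_slot] i pt[of i] pt[of "Suc i"] by (auto simp: Z_def)
  qed
  \<comment> \<open>At most \<open>P - 1\<close> crossings plus at most \<open>P\<close> receivers
    of the source, rounded up to \<open>2 * P\<close>.\<close>
  have C_card: "card {(u, pr v) | u v. (u, v) \<in> E \<and> pr u \<noteq> pr v} \<le> 2 * P"
  proof -
    have "{(u, pr v) | u v. (u, v) \<in> E \<and> pr u \<noteq> pr v} \<subseteq>
      (\<lambda>i. (xs ! i, pr (xs ! Suc i))) ` Z \<union> Pair v0 ` {1..P}"
    proof clarify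
      fix u v assume uv: "(u, v) \<in> E" "pr u \<noteq> pr v" "(u, pr v) \<notin> Pair v0 ` {1..P}"
      from lay uv(1) show "(u, pr v) \<in> (\<lambda>i. (xs ! i, pr (xs ! Suc i))) ` Z"
      proof (cases rule: layout_edge_cases)
        case (1 i)
        then show ?thesis using chain_edge[of i] uv(2) by (auto simp: m_def)
      next
        case (2 i)
        have "slot i < P * T" using slot_less[of i] cap 2 by (simp add: m_def)
        then have "pr v \<in> {1..P}" using pt[of i] 2 by (auto simp: m_def less_mult_imp_div_less Suc_le_eq)
        then show ?thesis using uv(3) 2 by auto
      qed
    qed
    then have "card {(u, pr v) | u v. (u, v) \<in> E \<and> pr u \<noteq> pr v} \<le>
       card ((\<lambda>i. (xs ! i, pr (xs ! Suc i))) ` Z \<union> Pair v0 ` {1..P})"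
      using Z by (intro card_mono) auto
    also have "\<dots> \<le> card ((\<lambda>i. (xs ! i, pr (xs ! Suc i))) ` Z) + card (Pair v0 ` {1..P})" by (rule card_Un_le)
    also have "\<dots> \<le> card Z + card {1..P}" using Z by (intro add_mono card_image_le) auto
    finally show ?thesis using Z(2) by simp
  qed
  have D_card: "finite D" "card D \<le> P"
  proof -
    show "finite D" using Z by (simp add: D_def)
    have "card D \<le> card ((\<lambda>i. slot (Suc i) mod T + off) ` Z) + card (if conn then {1::nat} else {})"
      unfolding D_def by (rule card_Un_le)
    also have "\<dots> \<le> card Z + 1" using Z by (intro add_mono card_image_le) auto
    finally show "card D \<le> P" using Z(2) P by simp
  qed
  obtain X where X: "valid_schedule P V E X" "supersteps X = Suc (card D)"
    "total_cost P g L V X \<le> (T + off) + g * card {(u, pr v) | u v. (u, v) \<in> E \<and> pr u \<noteq> pr v} + L * Suc (card D)"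
  proof (rule placement_schedule[OF P V, where pr = pr and tm = tm and W = "T + off" and D = D])
    show "pr v \<in> {1..P}" if v: "v \<in> V" for v
    proof (cases "v \<in> set xs")
      case True
      then obtain i where i: "i < m" "v = xs ! i" using at by blast
      have "slot i < P * T" using slot_less[OF i(1)] cap by (simp add: m_def)
      then show ?thesis using pt i by (auto simp: less_mult_imp_div_less Suc_le_eq)
    qed (use P in \<open>simp add: pr_def\<close>)
    show "tm v < T + off" if v: "v \<in> V" for v
    proof (cases "v \<in> set xs")
      case True
      then obtain i where i: "i < m" "v = xs ! i" using at by blast
      then show ?thesis using pt T by simp
    next
      case False
      then show ?thesis using V_cases[OF v] v0 by auto
    qed
    show "inj_on (\<lambda>v. (pr v, tm v)) V"
    proof (rule inj_onI)
      fix u v assume uv: "u \<in> V" "v \<in> V" "(pr u, tm u) = (pr v, tm v)"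
      have pos: "0 < tm v" if "v \<in> set xs" "conn" for v
        using that v0(3) by (simp add: tm_def)
      show "u = v"
      proof (cases "u \<in> set xs \<and> v \<in> set xs")
        case True
        then obtain i j where ij: "i < m" "u = xs ! i" "j < m" "v = xs ! j" using at by blast
        then have "slot i div T = slot j div T" "slot i mod T = slot j mod T" using pt uv(3) by auto
        then have "slot i = slot j" by (metis div_mult_mod_eq)
        then show ?thesis
          using wrap_around.slot_inj[OF wrap] ij unfolding wrap_slot by (auto simp: inj_on_def)
      next
        case False
        then show ?thesis using V_cases[OF uv(1)] V_cases[OF uv(2)] pos[of u] pos[of v] v0 uv(3) by auto
      qed
    qed
    show "finite D" by (fact D_card)
    show "tm u \<le> tm v" if "(u, v) \<in> E" for u v
      using lay that
    proof (cases rule: layout_edge_cases)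
      case (1 i)
      then show ?thesis using chain_edge[of i] by (simp add: m_def)
    qed (use v0 in simp)
    show "\<exists>d\<in>D. tm u < d \<and> d \<le> tm v" if uv: "(u, v) \<in> E" and ne: "pr u \<noteq> pr v" for u v
      using lay uv
    proof (cases rule: layout_edge_cases)
      case (1 i)
      then have "i \<in> Z" "tm u < tm v" using chain_edge[of i] ne by (auto simp: m_def)
      moreover have "tm v \<in> D" using \<open>i \<in> Z\<close> pt[of "Suc i"] 1 by (auto simp: D_def m_def)
      ultimately show ?thesis by (intro bexI[of _ "tm v"]) auto
    next
      case (2 i)
      then have "1 \<in> D" "tm u = 0" "1 \<le> tm v" using v0 pt[of i] by (auto simp: D_def m_def)
      then show ?thesis by (intro bexI[of _ 1]) auto
    qed
  qed
  have "g * card {(u, pr v) | u v. (u, v) \<in> E \<and> pr u \<noteq> pr v} \<le> g * (2 * P)" "L * Suc (card D) \<le> L * Suc P"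
    using C_card D_card(2) by (intro mult_le_mono order_refl; simp)+
  then have "total_cost P g L V X \<le> (T + off) + g * (2 * P) + L * Suc P" using X(3) by linarith
  then show ?thesis using X(1,2) D_card(2) by (intro exI[of _ X]) (simp add: off_def)
qed

text \<open>If merging leaves more than \<open>2 * P + 1\<close> supersteps, the communication costs
  of \<open>X\<close> add up to more than \<open>2 * P\<close>. They pay for all transmissions of
  the wrap-around schedule, and the supersteps of \<open>X\<close> pay for its \<open>P + 1\<close>
  latencies.\<close>

lemma few_supersteps_suffice:
  assumes P: "1 \<le> P" and lay: "layout conn v0 xs st V E" and valid: "valid_schedule P V E X"
  shows "\<exists>Y. valid_schedule P V E Y \<and> supersteps Y \<le> 2 * P + 1 \<and> total_cost P g L V Y \<le> total_cost P g L V X"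
\<comment> \<open>A schedule without supersteps is short enough as it is; merging always leaves at
  least one.\<close>
proof (cases "1 \<le> supersteps X")
  case S: True
  have V: "finite V" using layout_finite[OF lay] by simp
  define W C where "W = (\<Sum>s\<in>{1..supersteps X}. work_cost P V X s)"
    and "C = (\<Sum>s\<in>{1..supersteps X}. comm_cost P X s)"
  obtain Y where Y: "valid_schedule P V E Y" "total_cost P g L V Y \<le> total_cost P g L V X"
    "supersteps Y \<le> supersteps X" "supersteps Y \<le> Suc C"
    unfolding C_def by (rule merge_idle_supersteps[OF P V valid S, of g L])
  show ?thesis
  proof (cases "supersteps Y \<le> 2 * P + 1")
    case False
    note lower = layout_lower_bounds[OF P lay valid, folded W_def]
    obtain X' where X': "valid_schedule P V E X'" "supersteps X' \<le> Suc P"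
      "total_cost P g L V X' \<le> (W - of_bool conn + of_bool conn) + g * (2 * P) + L * Suc P"
      using wrap_around_schedule[OF P lay lower(2,3), of g L] by blast
    have "W - of_bool conn + of_bool conn = W" using lower(1) by (cases conn) auto
    moreover have "g * (2 * P) \<le> g * C" "L * Suc P \<le> L * supersteps X"
      using False Y(3,4) by (intro mult_le_mono order_refl; simp)+
    moreover have "total_cost P g L V X = W + g * C + L * supersteps X"
      by (simp add: total_cost_alt W_def C_def)
    ultimately have "total_cost P g L V X' \<le> total_cost P g L V X" using X'(3) by linarith
    then show ?thesis using X'(1,2) by (intro exI[of _ X']) auto
  qed (use Y in blast)
qed (use valid in auto)

section \<open>Schedules as words of options\<close>

text \<open>
  A word of options describes a schedule. Its first letter \<open>Head (S, p0, t0, rs)\<close> fixes the number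
  of supersteps and, for connected chains, the place of the source and the list of pairs
  (processor, superstep) of its transmissions. Each further letter \<open>Place h p s c\<close> places the next
  node of the chains and repeats the head \<open>h\<close>; if \<open>c = Some (q, r)\<close>, the output of its
  predecessor is sent to it from \<open>q\<close> in superstep \<open>r\<close>.
\<close>

type_synonym head = "nat \<times> nat \<times> nat \<times> (nat \<times> nat) list"

datatype opt = Head head | Place head nat nat "(nat \<times> nat) option"

fun head_of :: "opt \<Rightarrow> head" where
  "head_of (Head h) = h"
| "head_of (Place h p s c) = h"

fun sends :: "opt \<Rightarrow> (nat \<times> nat \<times> nat) list" where
  "sends (Head (S, p0, t0, rs)) = map (\<lambda>(p, r). (p0, p, r)) rs"
| "sends (Place h p s c) = (case c of None \<Rightarrow> [] | Some (q, r) \<Rightarrow> [(q, p, r)])"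

fun place :: "bool \<Rightarrow> opt \<Rightarrow> (nat \<times> nat) option" where
  "place conn (Head (S, p0, t0, rs)) = (if conn then Some (p0, t0) else None)"
| "place conn (Place h p s c) = Some (p, s)"

fun head_steps :: "opt \<Rightarrow> nat" where
  "head_steps (Head (S, p0, t0, rs)) = S"
| "head_steps (Place h p s c) = 0"

text \<open>The bound on the length of \<open>rs\<close> keeps the set of heads finite; one entry
  per receiving processor is enough. Without a source the other components get default
  values.\<close>

definition valid_head :: "nat \<Rightarrow> nat \<Rightarrow> bool \<Rightarrow> head \<Rightarrow> bool" where
  "valid_head P B conn = (\<lambda>(S, p0, t0, rs). S \<le> B \<and>
     (if conn then p0 \<in> {1..P} \<and> t0 \<in> {1..S} \<and> length rs \<le> P \<and> set rs \<subseteq> {1..P} \<times> {t0..S}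
      else p0 = 0 \<and> t0 = 0 \<and> rs = []))"

text \<open>Validity of the edge from the source to the beginning of a chain.\<close>

definition start_ok :: "head \<Rightarrow> nat \<Rightarrow> nat \<Rightarrow> bool" where
  "start_ok = (\<lambda>(S, p0, t0, rs) p s. (p = p0 \<and> t0 \<le> s) \<or> (p \<noteq> p0 \<and> (\<exists>r. (p, r) \<in> set rs \<and> r < s)))"

text \<open>Validity of an edge inside a chain, from processor \<open>q\<close> and superstep
  \<open>t\<close> to processor \<open>p\<close> and superstep \<open>s\<close>, with a transmission
  exactly when the processor changes.\<close>

definition continue_ok :: "nat \<Rightarrow> nat \<Rightarrow> nat \<Rightarrow> nat \<Rightarrow> (nat \<times> nat) option \<Rightarrow> bool" where
  "continue_ok q t p s c \<longleftrightarrow> (p = q \<and> t \<le> s \<and> c = None) \<or> (p \<noteq> q \<and> (\<exists>r. c = Some (q, r) \<and> t \<le> r \<and> r < s))"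

text \<open>Acceptance compares neighbouring letters only, yet each beginning of a chain has to know
  where the source is and when it was sent. This is why the head travels along in every letter. Flag
  2 demands a preceding \<open>Place\<close>, so no chain continues from the head.\<close>

definition next_ok :: "nat \<Rightarrow> nat \<Rightarrow> bool \<Rightarrow> nat \<Rightarrow> opt option \<Rightarrow> opt \<Rightarrow> bool" where
  "next_ok P B conn f prev o' \<longleftrightarrow> (case o' of
     Head h \<Rightarrow> f = 0 \<and> prev = None \<and> valid_head P B conn h
   | Place h p s c \<Rightarrow> (\<exists>o1. prev = Some o1 \<and> head_of o1 = h) \<and> p \<in> {1..P} \<and> s \<in> {1..fst h} \<and>
       ((f = 1 \<and> c = None \<and> (conn \<longrightarrow> start_ok h p s)) \<or>
        (f = 2 \<and> (\<exists>q t c'. prev = Some (Place h q t c') \<and> continue_ok q t p s c))))"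

definition word_ok :: "nat \<Rightarrow> nat \<Rightarrow> bool \<Rightarrow> (nat \<Rightarrow> nat) \<Rightarrow> opt list \<Rightarrow> bool" where
  "word_ok P B conn fs ops \<longleftrightarrow>
     (\<forall>i<length ops. next_ok P B conn (fs i) (if i = 0 then None else Some (ops ! (i - 1))) (ops ! i))"

definition at_place :: "bool \<Rightarrow> nat \<Rightarrow> nat \<Rightarrow> opt \<Rightarrow> nat" where
  "at_place conn p s o' = of_bool (place conn o' = Some (p, s))"

definition sent_by :: "nat \<Rightarrow> nat \<Rightarrow> opt \<Rightarrow> nat" where
  "sent_by p s o' = length (filter (\<lambda>(q, q', r). q = p \<and> r = s) (sends o'))"

definition received_by :: "nat \<Rightarrow> nat \<Rightarrow> opt \<Rightarrow> nat" where
  "received_by p s o' = length (filter (\<lambda>(q, q', r). q' = p \<and> r = s) (sends o'))"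

text \<open>\<open>lin h\<close> stands for the sum of the weights \<open>h\<close> of the options of a word.\<close>

definition opt_cost :: "nat \<Rightarrow> nat \<Rightarrow> nat \<Rightarrow> nat \<Rightarrow> bool \<Rightarrow> ((opt \<Rightarrow> nat) \<Rightarrow> nat) \<Rightarrow> nat" where
  "opt_cost P g L B conn lin = (\<Sum>s\<in>{1..B}. (MAX p\<in>{1..P}. lin (at_place conn p s)) +
     g * (MAX p\<in>{1..P}. max (lin (sent_by p s)) (lin (received_by p s)))) + L * lin head_steps"

definition word_sum :: "opt list \<Rightarrow> (opt \<Rightarrow> nat) \<Rightarrow> nat" where
  "word_sum ops h = sum_list (map h ops)"

definition item :: "nat \<Rightarrow> nat list \<Rightarrow> nat \<Rightarrow> nat" where
  "item v0 xs i = (v0 # xs) ! i"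

text \<open>Because of truncated subtraction, the transmissions of the head get the source itself.\<close>

definition transmissions :: "(nat \<Rightarrow> nat) \<Rightarrow> opt list \<Rightarrow> (nat \<times> nat \<times> nat \<times> nat) list" where
  "transmissions nd ops = concat (map (\<lambda>i. map (\<lambda>(q, p, r). (nd (i - 1), q, p, r)) (sends (ops ! i))) [0..<length ops])"

text \<open>The contents that \<open>walk\<close> leaves in \<open>''f''\<close>. Position 0 is the
  head, so entry \<open>i\<close> of the layout sits at position \<open>i + 1\<close>.\<close>

definition flags :: "(nat \<Rightarrow> bool) \<Rightarrow> nat \<Rightarrow> nat" where
  "flags st i = (if i = 0 then 0 else if st (i - 1) then 1 else 2)"

text \<open>By induction all copies of the head agree, so one \<open>h\<close> serves every
  position.\<close>

lemma word_ok_cases: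
  assumes ok: "word_ok P B conn (flags st) ops" and len: "length ops = Suc m"
  obtains h where "ops ! 0 = Head h" "valid_head P B conn h"
    "\<And>i. i < m \<Longrightarrow> \<exists>p s c. ops ! Suc i = Place h p s c \<and> p \<in> {1..P} \<and> s \<in> {1..fst h} \<and>
       (if st i then c = None \<and> (conn \<longrightarrow> start_ok h p s)
        else \<exists>q t c'. ops ! i = Place h q t c' \<and> continue_ok q t p s c)"
proof -
  have "next_ok P B conn 0 None (ops ! 0)"
    using ok len by (auto simp: word_ok_def flags_def dest!: spec[of _ 0])
  then obtain h where h: "ops ! 0 = Head h" "valid_head P B conn h"
    by (cases "ops ! 0") (auto simp: next_ok_def)
  have nxt: "next_ok P B conn (if st i then 1 else 2) (Some (ops ! i)) (ops ! Suc i)" if "i < m" for i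
    using ok len that unfolding word_ok_def flags_def by (auto dest!: spec[of _ "Suc i"])
  have hd: "head_of (ops ! i) = h" if "i \<le> m" for i
    using that
  proof (induction i)
    case (Suc i)
    then show ?case using nxt[of i] by (cases "ops ! Suc i") (auto simp: next_ok_def)
  qed (simp add: h)
  show thesis
  proof (rule that[OF h])
    fix i assume i: "i < m"
    show "\<exists>p s c. ops ! Suc i = Place h p s c \<and> p \<in> {1..P} \<and> s \<in> {1..fst h} \<and>
       (if st i then c = None \<and> (conn \<longrightarrow> start_ok h p s)
        else \<exists>q t c'. ops ! i = Place h q t c' \<and> continue_ok q t p s c)"
    proof (cases "ops ! Suc i")
      case (Head h')
      then show ?thesis using nxt[OF i] by (auto simp: next_ok_def)
    next
      case (Place h' p s c)
      then have "h' = h" using hd[of "Suc i"] i by simp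
      then show ?thesis using nxt[OF i] Place by (auto simp: next_ok_def split: if_splits)
    qed
  qed
qed


section \<open>Translations between words and schedules\<close>

lemma Max_image_mono:
  fixes h h' :: "nat \<Rightarrow> nat"
  assumes "finite A" "A \<noteq> {}" "\<And>p. p \<in> A \<Longrightarrow> h p \<le> h' p"
  shows "Max (h ` A) \<le> Max (h' ` A)"
proof -
  have "h p \<le> Max (h' ` A)" if "p \<in> A" for p
    by (rule order_trans[OF assms(3)[OF that] Max_ge]) (use assms(1) that in auto)
  then show ?thesis using assms by (subst Max_le_iff) auto
qed

lemma word_sum_conv: "word_sum ops h = (\<Sum>i<length ops. h (ops ! i))"
  by (simp add: word_sum_def sum_list_sum_nth atLeast0LessThan)

lemma length_transmissions_filter:
  "length (filter (\<lambda>(v, q, p, r). Q q p r) (transmissions nd ops)) =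
     word_sum ops (\<lambda>o'. length (filter (\<lambda>(q, p, r). Q q p r) (sends o')))"
proof -
  have "length (filter (\<lambda>(v, q, p, r). Q q p r) (map (\<lambda>(q, p, r). (nd (i - 1), q, p, r)) l)) =
    length (filter (\<lambda>(q, p, r). Q q p r) l)" for l i
    by (induction l) auto
  then show ?thesis
    by (simp add: word_sum_conv transmissions_def filter_concat length_concat comp_def
      sum_list_sum_nth atLeast0LessThan)
qed

lemma in_transmissions:
  "x \<in> set (transmissions nd ops) \<longleftrightarrow>
     (\<exists>i<length ops. \<exists>(q, p, r)\<in>set (sends (ops ! i)). x = (nd (i - 1), q, p, r))"
  unfolding transmissions_def set_concat set_map set_upt by fastforce

lemma word_sum_place: "word_sum ops (at_place conn p s) = card {i. i < length ops \<and> place conn (ops ! i) = Some (p, s)}"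
proof -
  have "word_sum ops (at_place conn p s) = card ({..<length ops} \<inter> {i. place conn (ops ! i) = Some (p, s)})"
    by (simp add: word_sum_conv at_place_def sum_of_bool_eq)
  also have "{..<length ops} \<inter> {i. place conn (ops ! i) = Some (p, s)} = {i. i < length ops \<and> place conn (ops ! i) = Some (p, s)}"
    by auto
  finally show ?thesis .
qed

text \<open>Only an inequality holds for the cost: a word may list a transmission of the source
  twice, whereas \<open>comm X\<close> is a set.\<close>

lemma word_schedule:
  assumes P: "1 \<le> P" and lay: "layout conn v0 xs st V E" and ok: "word_ok P B conn (flags st) ops"
    and len: "length ops = Suc (length xs)"
    and S: "supersteps X = word_sum ops head_steps"
    and pl: "\<And>i p s. i < length ops \<Longrightarrow> place conn (ops ! i) = Some (p, s) \<Longrightarrow>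
      proc X (item v0 xs i) = p \<and> step X (item v0 xs i) = s"
    and comm: "comm X = set (transmissions (item v0 xs) ops)"
  shows "valid_schedule P V E X" "total_cost P g L V X \<le> opt_cost P g L B conn (word_sum ops)"
proof -
  obtain h where h: "ops ! 0 = Head h" "valid_head P B conn h"
    and nodes: "\<And>i. i < length xs \<Longrightarrow> \<exists>p s c. ops ! Suc i = Place h p s c \<and> p \<in> {1..P} \<and> s \<in> {1..fst h} \<and>
       (if st i then c = None \<and> (conn \<longrightarrow> start_ok h p s)
        else \<exists>q t c'. ops ! i = Place h q t c' \<and> continue_ok q t p s c)"
    using word_ok_cases[OF ok len] by blast
  obtain S' p0 t0 rs where hh: "h = (S', p0, t0, rs)" by (cases h)
  have "word_sum ops head_steps = head_steps (ops ! 0) + (\<Sum>i<length xs. head_steps (ops ! Suc i))"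
    unfolding word_sum_conv len by (rule sum.lessThan_Suc_shift)
  also have "(\<Sum>i<length xs. head_steps (ops ! Suc i)) = 0"
  proof (rule sum.neutral, rule ballI)
    fix i assume "i \<in> {..<length xs}"
    then obtain p s c where "ops ! Suc i = Place h p s c" using nodes[of i] by auto
    then show "head_steps (ops ! Suc i) = 0" by simp
  qed
  finally have steps: "word_sum ops head_steps = S'" using h hh by simp
  then have SX: "supersteps X = S'" "fst h = S'" using S hh by simp_all
  have head: "proc X v0 = p0" "step X v0 = t0" "p0 \<in> {1..P}" "t0 \<in> {1..S'}" "set rs \<subseteq> {1..P} \<times> {t0..S'}" if conn
    using pl[of 0 p0 t0] h that len by (auto simp: hh item_def valid_head_def)
  have rs: "\<not> conn \<Longrightarrow> rs = []" and SB: "S' \<le> B" using h by (auto simp: hh valid_head_def)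
  have V: "finite V" "E \<subseteq> V \<times> V" using layout_finite[OF lay] by auto
  have st0: "xs \<noteq> [] \<Longrightarrow> st 0" using lay by (simp add: layout_def)
  have node: "\<exists>c. ops ! Suc i = Place h (proc X (xs ! i)) (step X (xs ! i)) c \<and>
      proc X (xs ! i) \<in> {1..P} \<and> step X (xs ! i) \<in> {1..S'} \<and>
      (if st i then c = None \<and> (conn \<longrightarrow> start_ok h (proc X (xs ! i)) (step X (xs ! i)))
       else 0 < i \<and> continue_ok (proc X (xs ! (i - 1))) (step X (xs ! (i - 1))) (proc X (xs ! i)) (step X (xs ! i)) c)"
    if i: "i < length xs" for i
  proof -
    obtain p s c where o': "ops ! Suc i = Place h p s c" "p \<in> {1..P}" "s \<in> {1..fst h}"
       "if st i then c = None \<and> (conn \<longrightarrow> start_ok h p s)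
        else \<exists>q t c'. ops ! i = Place h q t c' \<and> continue_ok q t p s c"
      using nodes[OF i] by blast
    have ps: "proc X (xs ! i) = p" "step X (xs ! i) = s"
      using pl[of "Suc i" p s] o'(1) i len by (auto simp: item_def)
    show ?thesis
    proof (cases "st i")
      case True
      then show ?thesis using o' ps SX by auto
    next
      case False
      then have "0 < i" using i st0 by (cases i) auto
      obtain q t c' where q: "ops ! i = Place h q t c'" "continue_ok q t p s c" using o'(4) False by auto
      have "proc X (xs ! (i - 1)) = q" "step X (xs ! (i - 1)) = t"
        using pl[of i q t] q(1) i len \<open>0 < i\<close> by (auto simp: item_def nth_Cons')
      then show ?thesis using o' q ps SX False \<open>0 < i\<close> by auto
    qed
  qed
  \<comment> \<open>Position 0 sends the output of the source. Position \<open>Suc i\<close> sends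
    the output of item \<open>i\<close>, the item just before its own.\<close>
  have in_comm: "x \<in> comm X \<longleftrightarrow> (\<exists>(p, r)\<in>set rs. x = (v0, p0, p, r)) \<or>
      (\<exists>i<length xs. \<exists>(q, p, r)\<in>set (sends (ops ! Suc i)). x = (item v0 xs i, q, p, r))" for x
  proof -
    have "x \<in> comm X \<longleftrightarrow> (\<exists>i<Suc (length xs). \<exists>(q, p, r)\<in>set (sends (ops ! i)). x = (item v0 xs (i - 1), q, p, r))"
      unfolding comm in_transmissions len ..
    also have "\<dots> \<longleftrightarrow> (\<exists>(q, p, r)\<in>set (sends (ops ! 0)). x = (item v0 xs 0, q, p, r)) \<or>
      (\<exists>i<length xs. \<exists>(q, p, r)\<in>set (sends (ops ! Suc i)). x = (item v0 xs i, q, p, r))"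
      by (auto simp only: Ex_less_Suc2 diff_0_eq_0 diff_Suc_1)
    finally show ?thesis by (auto simp: h hh item_def)
  qed
  \<comment> \<open>Letters at the beginning of a chain send nothing, so in the second case the
    sender is a true predecessor in the chain.\<close>
  have comm_cases: "(conn \<and> v = v0 \<and> a = p0 \<and> (b, r) \<in> set rs) \<or>
      (\<exists>i. 0 < i \<and> i < length xs \<and> v = xs ! (i - 1) \<and> a = proc X v \<and> b = proc X (xs ! i) \<and>
         step X v \<le> r \<and> r < step X (xs ! i))"
    if x: "(v, a, b, r) \<in> comm X" for v a b r
  proof -
    have "((b, r) \<in> set rs \<and> v = v0 \<and> a = p0) \<or>
      (\<exists>i<length xs. (a, b, r) \<in> set (sends (ops ! Suc i)) \<and> v = item v0 xs i)"
      using x unfolding in_comm by blast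
    then show ?thesis
    proof
      assume "(b, r) \<in> set rs \<and> v = v0 \<and> a = p0"
      then show ?thesis using rs by (cases conn) auto
    next
      assume "\<exists>i<length xs. (a, b, r) \<in> set (sends (ops ! Suc i)) \<and> v = item v0 xs i"
      then obtain i where i: "i < length xs" "(a, b, r) \<in> set (sends (ops ! Suc i))" "v = item v0 xs i" by blast
      obtain c where c: "ops ! Suc i = Place h (proc X (xs ! i)) (step X (xs ! i)) c"
        "if st i then c = None \<and> (conn \<longrightarrow> start_ok h (proc X (xs ! i)) (step X (xs ! i)))
       else 0 < i \<and> continue_ok (proc X (xs ! (i - 1))) (step X (xs ! (i - 1))) (proc X (xs ! i)) (step X (xs ! i)) c"
        using node[OF i(1)] by blast
      have nst: "\<not> st i" using c i(2) by auto
      then have "0 < i" and co: "continue_ok (proc X (xs ! (i - 1))) (step X (xs ! (i - 1))) (proc X (xs ! i)) (step X (xs ! i)) c"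
        using c(2) by auto
      have "v = xs ! (i - 1)" using i(3) \<open>0 < i\<close> by (simp add: item_def nth_Cons')
      then show ?thesis
        using co i(1,2) c(1) \<open>0 < i\<close> by (intro disjI2 exI[of _ i]) (auto simp: continue_ok_def)
    qed
  qed
  have V_items: "\<exists>i<length ops. item v0 xs i = v \<and> place conn (ops ! i) = Some (proc X v, step X v)" if v: "v \<in> V" for v
  proof (cases "v \<in> set xs")
    case True
    then obtain i where i: "i < length xs" "v = xs ! i" by (auto simp: in_set_conv_nth)
    then show ?thesis using node[OF i(1)] len by (intro exI[of _ "Suc i"]) (auto simp: item_def)
  next
    case False
    then have "conn" "v = v0" using lay v by (auto simp: layout_def split: if_splits)
    then show ?thesis using head h len by (intro exI[of _ 0]) (auto simp: item_def hh)
  qed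
  have place_range: "proc X v \<in> {1..P} \<and> step X v \<in> {1..S'}" if v: "v \<in> V" for v
  proof (cases "v \<in> set xs")
    case True
    then obtain i where i: "i < length xs" "v = xs ! i" by (auto simp: in_set_conv_nth)
    then show ?thesis using node[OF i(1)] by auto
  next
    case False
    then have "conn" "v = v0" using lay v by (auto simp: layout_def split: if_splits)
    then show ?thesis using head by simp
  qed
  have xsV: "xs ! i \<in> V" if "i < length xs" for i
    using that lay by (auto simp: layout_def)
  show "valid_schedule P V E X"
    unfolding valid_schedule_def SX(1)
  proof (intro conjI)
    show "\<forall>v\<in>V. proc X v \<in> {1..P} \<and> step X v \<in> {1..S'}" using place_range by blast
    show "comm X \<subseteq> V \<times> {1..P} \<times> {1..P} \<times> {1..S'}"
    proof
      fix x assume x: "x \<in> comm X"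
      obtain v a b r where vabr: "x = (v, a, b, r)" by (cases x)
      with x consider "conn" "v = v0" "a = p0" "(b, r) \<in> set rs"
        | i where "0 < i" "i < length xs" "v = xs ! (i - 1)" "a = proc X v" "b = proc X (xs ! i)"
          "step X v \<le> r" "r < step X (xs ! i)"
        using comm_cases by blast
      then have "v \<in> V \<and> a \<in> {1..P} \<and> b \<in> {1..P} \<and> r \<in> {1..S'}"
      proof cases
        case 1
        have "(b, r) \<in> {1..P} \<times> {t0..S'}" using head(5) 1 by blast
        moreover have "v0 \<in> V" using lay 1 by (simp add: layout_def)
        ultimately show ?thesis using head(3,4) 1 by auto
      next
        case 2
        then have "v \<in> V" using xsV[of "i - 1"] by simp
        then show ?thesis using place_range[of v] place_range[OF xsV[OF 2(2)]] 2 by auto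
      qed
      then show "x \<in> V \<times> {1..P} \<times> {1..P} \<times> {1..S'}" using vabr by simp
    qed
    show "\<forall>(u, v)\<in>E. (proc X u = proc X v \<longrightarrow> step X u \<le> step X v) \<and>
        (proc X u \<noteq> proc X v \<longrightarrow> (\<exists>s. s < step X v \<and> (u, proc X u, proc X v, s) \<in> comm X))"
    proof clarify
      fix u v assume uv: "(u, v) \<in> E"
      from lay uv show "(proc X u = proc X v \<longrightarrow> step X u \<le> step X v) \<and>
        (proc X u \<noteq> proc X v \<longrightarrow> (\<exists>s. s < step X v \<and> (u, proc X u, proc X v, s) \<in> comm X))"
      proof (cases rule: layout_edge_cases)
        case (1 i)
        obtain c where c: "ops ! Suc (Suc i) = Place h (proc X v) (step X v) c"
          "continue_ok (proc X u) (step X u) (proc X v) (step X v) c"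
          using node[OF 1(1)] 1 by auto
        have it: "item v0 xs (Suc i) = u" using 1 by (simp add: item_def)
        show ?thesis
        proof (cases "proc X u = proc X v")
          case False
          then obtain r where r: "c = Some (proc X u, r)" "r < step X v" using c(2) by (auto simp: continue_ok_def)
          have "(proc X u, proc X v, r) \<in> set (sends (ops ! Suc (Suc i)))" using c(1) r(1) by simp
          then have "(u, proc X u, proc X v, r) \<in> comm X" unfolding in_comm using 1(1) it by blast
          then show ?thesis using False r(2) by blast
        qed (use c(2) in \<open>auto simp: continue_ok_def\<close>)
      next
        case (2 i)
        have s: "start_ok h (proc X v) (step X v)" using node[OF 2(3)] 2 by auto
        show ?thesis
        proof (cases "proc X u = proc X v")
          case True
          then show ?thesis using s 2 head by (auto simp: start_ok_def hh)
        next
          case False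
          then obtain r where r: "(proc X v, r) \<in> set rs" "r < step X v"
            using s 2 head by (auto simp: start_ok_def hh)
          then have "(u, proc X u, proc X v, r) \<in> comm X" unfolding in_comm using 2 head by blast
          then show ?thesis using False r(2) by blast
        qed
      qed
    qed
    show "\<forall>(v, p1, p2, s)\<in>comm X. p1 = proc X v \<and> step X v \<le> s"
    proof clarify
      fix v a b r assume "(v, a, b, r) \<in> comm X"
      then consider "conn" "v = v0" "a = p0" "(b, r) \<in> set rs" | "a = proc X v" "step X v \<le> r"
        using comm_cases by blast
      then show "a = proc X v \<and> step X v \<le> r"
      proof cases
        case 1
        have "(b, r) \<in> {1..P} \<times> {t0..S'}" using head(5) 1 by blast
        then show ?thesis using head(1,2) 1 by auto
      qed simp
    qed
  qed
  have work: "work_cost P V X s \<le> (MAX p\<in>{1..P}. word_sum ops (at_place conn p s))" for s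
    unfolding work_cost_def
  proof (rule Max_image_mono)
    fix p
    have "{v \<in> V. proc X v = p \<and> step X v = s} \<subseteq> item v0 xs ` {i. i < length ops \<and> place conn (ops ! i) = Some (p, s)}"
      using V_items by force
    then have "card {v \<in> V. proc X v = p \<and> step X v = s} \<le> card {i. i < length ops \<and> place conn (ops ! i) = Some (p, s)}"
      by (intro surj_card_le) auto
    then show "card {v \<in> V. proc X v = p \<and> step X v = s} \<le> word_sum ops (at_place conn p s)"
      by (simp add: word_sum_place)
  qed (use P in auto)
  have filter: "card {x \<in> comm X. Q x} \<le> length (filter Q (transmissions (item v0 xs) ops))" for Q
    unfolding comm by (metis card_length set_filter)
  have sent: "sent_cost X s p \<le> word_sum ops (sent_by p s)" for s p
    using filter[of "\<lambda>(v, q, q', r). q = p \<and> r = s"] length_transmissions_filter[of "\<lambda>q q' r. q = p \<and> r = s" "item v0 xs" ops]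
    by (simp add: sent_cost_def sent_by_def[abs_def] case_prod_unfold)
  have rec: "rec_cost X s p \<le> word_sum ops (received_by p s)" for s p
    using filter[of "\<lambda>(v, q, q', r). q' = p \<and> r = s"] length_transmissions_filter[of "\<lambda>q q' r. q' = p \<and> r = s" "item v0 xs" ops]
    by (simp add: rec_cost_def received_by_def[abs_def] case_prod_unfold)
  have comm_le: "comm_cost P X s \<le> (MAX p\<in>{1..P}. max (word_sum ops (sent_by p s)) (word_sum ops (received_by p s)))" for s
    unfolding comm_cost_def by (rule Max_image_mono) (use P in \<open>auto intro!: max.mono sent rec simp del: max.bounded_iff\<close>)
  let ?c = "\<lambda>s. (MAX p\<in>{1..P}. word_sum ops (at_place conn p s)) +
     g * (MAX p\<in>{1..P}. max (word_sum ops (sent_by p s)) (word_sum ops (received_by p s)))"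
  have "total_cost P g L V X = (\<Sum>s\<in>{1..S'}. work_cost P V X s + g * comm_cost P X s) + L * S'"
    unfolding total_cost_def SX(1) by (simp add: sum.distrib)
  also have "(\<Sum>s\<in>{1..S'}. work_cost P V X s + g * comm_cost P X s) \<le> (\<Sum>s\<in>{1..S'}. ?c s)"
    using work comm_le by (intro sum_mono add_mono mult_le_mono order_refl) auto
  \<comment> \<open>\<open>opt_cost\<close> has to be one fixed expression, so it runs over all
    \<open>B\<close> supersteps, whatever number the head selects.\<close>
  also have "\<dots> \<le> (\<Sum>s\<in>{1..B}. ?c s)" using SB by (intro sum_mono2) auto
  finally show "total_cost P g L V X \<le> opt_cost P g L B conn (word_sum ops)"
    unfolding opt_cost_def steps by simp
qed

text \<open>Of the transmissions from a node to a processor at most one is kept, so all counts can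
  only drop.\<close>

lemma schedule_word:
  assumes P: "1 \<le> P" and lay: "layout conn v0 xs st V E" and valid: "valid_schedule P V E Y"
    and SB: "supersteps Y \<le> B"
  shows "\<exists>ops. word_ok P B conn (flags st) ops \<and> length ops = Suc (length xs) \<and>
    opt_cost P g L B conn (word_sum ops) \<le> total_cost P g L V Y"
proof -
  define m where "m = length xs"
  have V: "finite V" "E \<subseteq> V \<times> V" using layout_finite[OF lay] by auto
  have fin: "finite (comm Y)" using valid_comm_finite[OF V(1) valid] .
  have dist: "distinct xs" and st0: "xs \<noteq> [] \<Longrightarrow> st 0" using lay by (auto simp: layout_def)
  have xsV: "xs ! i \<in> V" if "i < m" for i
    using that lay by (auto simp: layout_def m_def)
  have v0V: "v0 \<in> V" if conn using lay that by (simp add: layout_def)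
  define S where "S = supersteps Y"
  \<comment> \<open>The earliest transmission to \<open>p\<close> serves every use of the output
    there.\<close>
  define sent_at where "sent_at p = (LEAST r. (v0, proc Y v0, p, r) \<in> comm Y)" for p
  define rs where "rs = (if conn then map (\<lambda>p. (p, sent_at p)) (filter (\<lambda>p. \<exists>r. (v0, proc Y v0, p, r) \<in> comm Y) [1..<Suc P]) else [])"
  define h where "h = (S, if conn then proc Y v0 else 0, if conn then step Y v0 else 0, rs)"
  define pr tm where "pr i = proc Y (xs ! i)" and "tm i = step Y (xs ! i)" for i
  define recv where "recv i = (LEAST r. r < tm i \<and> (xs ! (i - 1), pr (i - 1), pr i, r) \<in> comm Y)" for i
  define cc where "cc i = (if st i \<or> pr (i - 1) = pr i then None else Some (pr (i - 1), recv i))" for i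
  define ops where "ops = Head h # map (\<lambda>i. Place h (pr i) (tm i) (cc i)) [0..<m]"
  have len: "length ops = Suc m" by (simp add: ops_def)
  have op: "ops ! 0 = Head h" "\<And>i. i < m \<Longrightarrow> ops ! Suc i = Place h (pr i) (tm i) (cc i)"
    by (simp_all add: ops_def)
  have rs_sent: "(v0, proc Y v0, p, r) \<in> comm Y" if pr: "(p, r) \<in> set rs" for p r
  proof -
    have "r = sent_at p" "\<exists>r. (v0, proc Y v0, p, r) \<in> comm Y"
      using pr by (auto simp: rs_def split: if_splits)
    then show ?thesis unfolding sent_at_def by (metis (mono_tags, lifting) LeastI_ex)
  qed
  have rs_conn: "conn" if "(p, r) \<in> set rs" for p r using that by (auto simp: rs_def split: if_splits)
  have head: "valid_head P B conn h"
  proof (cases conn)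
    case True
    have "set rs \<subseteq> {1..P} \<times> {step Y v0..S}"
    proof
      fix x assume "x \<in> set rs"
      moreover obtain p r where "x = (p, r)" by (cases x)
      ultimately have x: "x = (p, r)" "(p, r) \<in> set rs" by simp_all
      show "x \<in> {1..P} \<times> {step Y v0..S}"
        using valid_comm(3,4,6)[OF valid rs_sent[OF x(2)]] x(1) by (simp add: S_def)
    qed
    moreover have "length rs \<le> P"
      unfolding rs_def using True length_filter_le[of _ "[1..<Suc P]"] by (simp del: upt_Suc)
    ultimately show ?thesis
      using True SB valid_node[OF valid v0V] by (simp add: valid_head_def h_def S_def)
  qed (use SB in \<open>simp add: valid_head_def h_def S_def rs_def\<close>)
  have range: "pr i \<in> {1..P} \<and> tm i \<in> {1..S}" if "i < m" for i
    using valid_node[OF valid xsV[OF that]] by (simp add: pr_def tm_def S_def)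
  have recv: "recv i < tm i \<and> (xs ! (i - 1), pr (i - 1), pr i, recv i) \<in> comm Y \<and> tm (i - 1) \<le> recv i"
    if i: "i < m" "\<not> st i" "pr (i - 1) \<noteq> pr i" for i
  proof -
    have "0 < i" using i st0 by (cases i) (auto simp: m_def)
    then have "(xs ! (i - 1), xs ! i) \<in> E" using layout_chain_step[OF lay, of "i - 1"] i by (simp add: m_def)
    then have "\<exists>r. r < tm i \<and> (xs ! (i - 1), pr (i - 1), pr i, r) \<in> comm Y"
      using valid_edge(2)[OF valid] i(3) by (simp add: pr_def tm_def)
    then have "recv i < tm i \<and> (xs ! (i - 1), pr (i - 1), pr i, recv i) \<in> comm Y"
      unfolding recv_def by (rule LeastI_ex)
    then show ?thesis using valid_comm(6)[OF valid] by (auto simp: tm_def)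
  qed
  have "word_ok P B conn (flags st) ops"
    unfolding word_ok_def
  proof (intro allI impI)
    fix k assume "k < length ops"
    show "next_ok P B conn (flags st k) (if k = 0 then None else Some (ops ! (k - 1))) (ops ! k)"
    proof (cases k)
      case 0
      then show ?thesis using head op(1) by (simp add: next_ok_def flags_def)
    next
      case (Suc i)
      then have i: "i < m" using \<open>k < length ops\<close> len by simp
      have hd: "head_of (ops ! i) = h" using op i by (cases i) auto
      have main: "(flags st k = 1 \<and> cc i = None \<and> (conn \<longrightarrow> start_ok h (pr i) (tm i))) \<or>
        (flags st k = 2 \<and> (\<exists>q t c'. Some (ops ! i) = Some (Place h q t c') \<and> continue_ok q t (pr i) (tm i) (cc i)))"
      proof (cases "st i")
        case True
        have "start_ok h (pr i) (tm i)" if conn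
        proof -
          have "(v0, xs ! i) \<in> {(v0, xs ! i) | i. i < length xs \<and> st i}" using i True by (auto simp: m_def)
          then have e: "(v0, xs ! i) \<in> E" using lay \<open>conn\<close> unfolding layout_def by auto
          show ?thesis
          proof (cases "proc Y v0 = pr i")
            case True
            then show ?thesis using valid_edge(1)[OF valid e] \<open>conn\<close> by (simp add: start_ok_def h_def pr_def tm_def)
          next
            case False
            obtain r where r: "r < tm i" "(v0, proc Y v0, pr i, r) \<in> comm Y"
              using valid_edge(2)[OF valid e] False by (auto simp: pr_def tm_def)
            then have "sent_at (pr i) < tm i" unfolding sent_at_def by (meson Least_le le_less_trans)
            moreover have "(pr i, sent_at (pr i)) \<in> set rs"
              using range[OF i] r \<open>conn\<close> by (auto simp: rs_def less_Suc_eq_le simp del: upt_Suc)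
            ultimately show ?thesis using False \<open>conn\<close> by (auto simp: start_ok_def h_def)
          qed
        qed
        then show ?thesis using True Suc by (simp add: flags_def cc_def)
      next
        case False
        then obtain j where j: "i = Suc j" using i st0 by (cases i) (auto simp: m_def)
        have e: "(xs ! j, xs ! i) \<in> E" using layout_chain_step[OF lay, of j] i False j by (simp add: m_def)
        have "ops ! i = Place h (pr j) (tm j) (cc j)" using op(2)[of j] i j by simp
        moreover have "continue_ok (pr j) (tm j) (pr i) (tm i) (cc i)"
        proof (cases "pr j = pr i")
          case True
          then show ?thesis
            using valid_edge(1)[OF valid e] j by (simp add: continue_ok_def cc_def pr_def tm_def)
        next
          case ne: False
          then show ?thesis using recv[OF i False] False j by (simp add: continue_ok_def cc_def)
        qed
        ultimately show ?thesis using False Suc by (simp add: flags_def)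
      qed
      show ?thesis
        using main range[OF i] hd op(2)[OF i] Suc by (simp add: next_ok_def h_def)
    qed
  qed
  moreover have "opt_cost P g L B conn (word_sum ops) \<le> total_cost P g L V Y"
  proof -
    \<comment> \<open>Without a source, item 0 is an arbitrary number that may also name a node of a
      chain, so index 0 is excluded.\<close>
    have item_inj: "i = j" if ij: "i \<le> m" "j \<le> m" "item v0 xs i = item v0 xs j" "conn \<or> 0 < i" "conn \<or> 0 < j" for i j
    proof (cases conn)
      case True
      then have "distinct (v0 # xs)" using lay by (simp add: layout_def)
      then show ?thesis using ij nth_eq_iff_index_eq[of "v0 # xs" i j] by (simp add: item_def m_def)
    next
      case False
      then obtain i' j' where "i = Suc i'" "j = Suc j'" using ij(4,5) by (metis gr0_implies_Suc)
      then show ?thesis using ij(1-3) dist by (simp add: item_def m_def nth_eq_iff_index_eq)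
    qed
    have place: "place conn (ops ! i) = Some (p, s) \<Longrightarrow>
        (conn \<or> 0 < i) \<and> item v0 xs i \<in> V \<and> proc Y (item v0 xs i) = p \<and> step Y (item v0 xs i) = s"
      if "i \<le> m" for i p s
    proof (cases i)
      case 0
      then show "place conn (ops ! i) = Some (p, s) \<Longrightarrow> ?thesis"
        using op(1) v0V by (auto simp: h_def item_def split: if_splits)
    next
      case (Suc j)
      then show "place conn (ops ! i) = Some (p, s) \<Longrightarrow> ?thesis"
        using op(2)[of j] that xsV[of j] by (auto simp: item_def pr_def tm_def)
    qed
    have work: "word_sum ops (at_place conn p s) \<le> card {v \<in> V. proc Y v = p \<and> step Y v = s}" for p s
      unfolding word_sum_place
    proof (rule card_inj_on_le)
      show "inj_on (item v0 xs) {i. i < length ops \<and> place conn (ops ! i) = Some (p, s)}"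
        using place item_inj len by (intro inj_onI) (auto simp: less_Suc_eq_le)
      show "item v0 xs ` {i. i < length ops \<and> place conn (ops ! i) = Some (p, s)} \<subseteq> {v \<in> V. proc Y v = p \<and> step Y v = s}"
        using place len by (auto simp: less_Suc_eq_le)
    qed (use V in simp)
    have sends_subset: "(item v0 xs (i - 1), q, p, r) \<in> comm Y \<and> (conn \<or> 0 < i - 1)"
      if i: "i < length ops" and x: "(q, p, r) \<in> set (sends (ops ! i))" for i q p r
    proof (cases i)
      case 0
      then have "(p, r) \<in> set rs" "q = (if conn then proc Y v0 else 0)" using x op(1) by (auto simp: h_def)
      then show ?thesis using rs_sent rs_conn 0 by (auto simp: item_def)
    next
      case (Suc j)
      then have j: "j < m" using i len by simp
      have "cc j \<noteq> None" using x op(2)[OF j] Suc by (cases "cc j") auto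
      then have nst: "\<not> st j" "pr (j - 1) \<noteq> pr j" by (auto simp: cc_def split: if_splits)
      then obtain j' where "j = Suc j'" using j st0 by (cases j) (auto simp: m_def)
      moreover have "(q, p, r) = (pr (j - 1), pr j, recv j)" using x op(2)[OF j] Suc nst by (simp add: cc_def)
      ultimately show ?thesis using recv[OF j nst] Suc by (simp add: item_def)
    qed
    have dist_sends: "distinct (sends (ops ! i))" if i: "i < length ops" for i
    proof (cases i)
      case 0
      have "distinct (map (\<lambda>p. (p, sent_at p)) (filter (\<lambda>p. \<exists>r. (v0, proc Y v0, p, r) \<in> comm Y) [1..<Suc P]))"
        by (auto simp: distinct_map inj_on_def simp del: upt_Suc)
      then have "distinct rs" by (simp add: rs_def)
      then show ?thesis using op(1) 0 by (simp add: h_def distinct_map inj_on_def)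
    next
      case (Suc j)
      then show ?thesis using op(2)[of j] i len by (cases "cc j") auto
    qed
    \<comment> \<open>By truncated subtraction positions 0 and 1 both refer to item 0. They are
      excluded here and settled by \<open>sends1\<close>: position 1 begins a chain and sends
      nothing.\<close>
    have no_overlap: "i = j"
      if "i < length ops" "j < length ops" "x \<in> set (sends (ops ! i))" "y \<in> set (sends (ops ! j))"
        "item v0 xs (i - 1) = item v0 xs (j - 1)" "\<not> (i \<le> 1 \<and> j \<le> 1)" for i j x y
    proof -
      obtain q p r q' p' r' where xy: "x = (q, p, r)" "y = (q', p', r')" by (cases x; cases y) auto
      have "conn \<or> 0 < i - 1" using sends_subset[OF that(1), of q p r] that(3) xy by simp
      moreover have "conn \<or> 0 < j - 1" using sends_subset[OF that(2), of q' p' r'] that(4) xy by simp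
      ultimately have "i - 1 = j - 1" using item_inj[of "i - 1" "j - 1"] that(1,2,5) len by simp
      then show "i = j" using that(6) by linarith
    qed
    have sends1: "sends (ops ! 1) = []" if "1 < length ops"
    proof -
      have "0 < m" using that len by simp
      then have "cc 0 = None" using st0 by (auto simp: cc_def m_def)
      then show ?thesis using op(2)[of 0] \<open>0 < m\<close> by simp
    qed
    \<comment> \<open>Different positions that send anything send outputs of different nodes, so no
      element of \<open>comm Y\<close> is counted twice.\<close>
    have count: "word_sum ops (\<lambda>o'. length (filter (\<lambda>(q, p, r). Q q p r) (sends o'))) \<le>
        card {(v, q, p, r) \<in> comm Y. Q q p r}" for Q
    proof -
      define T where "T i = (\<lambda>(q, p, r). (item v0 xs (i - 1), q, p, r)) ` set (filter (\<lambda>(q, p, r). Q q p r) (sends (ops ! i)))" for i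
      have T_card: "card (T i) = length (filter (\<lambda>(q, p, r). Q q p r) (sends (ops ! i)))" if "i < length ops" for i
      proof -
        have "card (T i) = card (set (filter (\<lambda>(q, p, r). Q q p r) (sends (ops ! i))))"
          unfolding T_def by (rule card_image) (auto simp: inj_on_def)
        also have "\<dots> = length (filter (\<lambda>(q, p, r). Q q p r) (sends (ops ! i)))"
          by (intro distinct_card distinct_filter dist_sends[OF that])
        finally show ?thesis .
      qed
      have "word_sum ops (\<lambda>o'. length (filter (\<lambda>(q, p, r). Q q p r) (sends o'))) = (\<Sum>i<length ops. card (T i))"
        unfolding word_sum_conv using T_card by (intro sum.cong) auto
      also have "\<dots> = card (\<Union>i<length ops. T i)"
      proof (rule card_UN_disjoint[symmetric])
        show "\<forall>i\<in>{..<length ops}. \<forall>j\<in>{..<length ops}. i \<noteq> j \<longrightarrow> T i \<inter> T j = {}"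
        proof (intro ballI impI)
          fix i j assume ij: "i \<in> {..<length ops}" "j \<in> {..<length ops}" "i \<noteq> j"
          show "T i \<inter> T j = {}"
          proof (rule ccontr)
            assume "T i \<inter> T j \<noteq> {}"
            then obtain x y where xy: "x \<in> set (sends (ops ! i))" "y \<in> set (sends (ops ! j))"
              "item v0 xs (i - 1) = item v0 xs (j - 1)"
              unfolding T_def by auto
            have "i \<noteq> 1" "j \<noteq> 1" using sends1 xy ij by auto
            then have "\<not> (i \<le> 1 \<and> j \<le> 1)" using ij(3) by auto
            then show False using no_overlap[OF _ _ xy] ij by auto
          qed
        qed
      qed (auto simp: T_def)
      also have "\<dots> \<le> card {(v, q, p, r) \<in> comm Y. Q q p r}"
      proof (rule card_mono)
        show "finite {(v, q, p, r) \<in> comm Y. Q q p r}" using fin by (rule finite_subset[rotated]) auto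
        show "(\<Union>i<length ops. T i) \<subseteq> {(v, q, p, r) \<in> comm Y. Q q p r}"
          using sends_subset by (auto simp: T_def)
      qed
      finally show ?thesis .
    qed
    have sent: "word_sum ops (sent_by p s) \<le> sent_cost Y s p" for p s
      using count[of "\<lambda>q q' r. q = p \<and> r = s"] by (simp add: sent_cost_def sent_by_def[abs_def])
    have received: "word_sum ops (received_by p s) \<le> rec_cost Y s p" for p s
      using count[of "\<lambda>q q' r. q' = p \<and> r = s"] by (simp add: rec_cost_def received_by_def[abs_def])
    have "word_sum ops head_steps = head_steps (ops ! 0) + (\<Sum>i<m. head_steps (ops ! Suc i))"
      unfolding word_sum_conv len by (rule sum.lessThan_Suc_shift)
    also have "(\<Sum>i<m. head_steps (ops ! Suc i)) = 0" using op(2) by (auto intro!: sum.neutral)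
    finally have steps: "word_sum ops head_steps = S" using op(1) by (simp add: h_def)
    let ?c = "\<lambda>s. (MAX p\<in>{1..P}. word_sum ops (at_place conn p s)) +
       g * (MAX p\<in>{1..P}. max (word_sum ops (sent_by p s)) (word_sum ops (received_by p s)))"
    have c: "?c s \<le> work_cost P V Y s + g * comm_cost P Y s" for s
      unfolding work_cost_def comm_cost_def
      by (intro add_mono mult_le_mono order_refl Max_image_mono max.mono sent received work) (use P in auto)
    \<comment> \<open>Supersteps beyond \<open>S\<close> contribute nothing, so the sum up to
      \<open>B\<close> reduces to the sum up to \<open>S\<close>.\<close>
    have idle: "work_cost P V Y s + g * comm_cost P Y s = 0" if s: "s \<notin> {1..S}" for s
    proof -
      have "{v \<in> V. proc Y v = p \<and> step Y v = s} = {}" for p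
        using valid_node[OF valid] s by (auto simp: S_def)
      then have "work_cost P V Y s \<le> 0" by (intro work_cost_le[OF P]) (simp only: card.empty order_refl)
      moreover have "comm_cost P Y s \<le> 0"
      proof (rule comm_cost_le[OF P])
        have no: "r \<noteq> s" if "(v, q, p, r) \<in> comm Y" for v q p r
          using valid_comm(4)[OF valid that] s by (auto simp: S_def)
        have "{(v, p1, p2, s') \<in> comm Y. p1 = p \<and> s' = s} = {}" for p using no by auto
        then show "sent_cost Y s p \<le> 0" for p by (simp only: sent_cost_def card.empty order_refl)
        have "{(v, p1, p2, s') \<in> comm Y. p2 = p \<and> s' = s} = {}" for p using no by auto
        then show "rec_cost Y s p \<le> 0" for p by (simp only: rec_cost_def card.empty order_refl)
      qed
      ultimately show ?thesis by simp
    qed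
    have "(\<Sum>s\<in>{1..B}. ?c s) \<le> (\<Sum>s\<in>{1..B}. work_cost P V Y s + g * comm_cost P Y s)"
      using c by (rule sum_mono)
    also have "\<dots> = (\<Sum>s\<in>{1..S}. work_cost P V Y s + g * comm_cost P Y s)"
      using SB idle by (intro sum.mono_neutral_right) (auto simp: S_def)
    also have "\<dots> + L * S = total_cost P g L V Y"
      unfolding total_cost_def S_def[symmetric] by (simp add: sum.distrib)
    finally show ?thesis unfolding opt_cost_def steps by simp
  qed
  ultimately show ?thesis using len by (auto simp: m_def)
qed

section \<open>The program\<close>

text \<open>The program needs the cost of record \<open>''a''\<close> as an arithmetic expression.
  The cost is built from coordinates by sums, maxima and constant multiples.\<close>

definition expressible :: "nat \<Rightarrow> ((nat \<Rightarrow> nat) \<Rightarrow> nat) \<Rightarrow> bool" where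
  "expressible K F \<longleftrightarrow> (\<exists>e. \<forall>\<sigma>. aval e \<sigma> = F (\<lambda>i. \<sigma> ''T'' (\<sigma> ''a'' 0 * (K + 3) + i)))"

lemma expressible_coordinate: "expressible K (\<lambda>x. x i)"
  unfolding expressible_def
  by (rule exI[of _ "Cell ''T'' (Plus (times_const (K + 3) (var ''a'')) (Const i))"])
    (simp only: aval.simps aval_times_const mult.commute simp_thms)

lemma expressible_const: "expressible K (\<lambda>x. c)"
  unfolding expressible_def by (rule exI[of _ "Const c"]) simp

lemma expressible_add: "expressible K F \<Longrightarrow> expressible K G \<Longrightarrow> expressible K (\<lambda>x. F x + G x)"
  unfolding expressible_def by (elim exE, rule_tac x = "Plus e ea" in exI) simp

lemma expressible_max: "expressible K F \<Longrightarrow> expressible K G \<Longrightarrow> expressible K (\<lambda>x. max (F x) (G x))"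
  \<comment> \<open>With truncated subtraction, \<open>x + (y - x)\<close> is the maximum of
    \<open>x\<close> and \<open>y\<close>.\<close>
  unfolding expressible_def by (elim exE, rule_tac x = "Plus e (Minus ea e)" in exI) (simp add: max_def)

lemma expressible_mult: "expressible K F \<Longrightarrow> expressible K (\<lambda>x. c * F x)"
  unfolding expressible_def by (elim exE, rule_tac x = "times_const c e" in exI) simp

lemma expressible_sum: "finite A \<Longrightarrow> (\<And>a. a \<in> A \<Longrightarrow> expressible K (F a)) \<Longrightarrow> expressible K (\<lambda>x. \<Sum>a\<in>A. F a x)"
  by (induction A rule: finite_induct) (auto intro: expressible_const expressible_add)

lemma expressible_Max:
  "finite A \<Longrightarrow> A \<noteq> {} \<Longrightarrow> (\<And>a. a \<in> A \<Longrightarrow> expressible K (F a)) \<Longrightarrow> expressible K (\<lambda>x. MAX a\<in>A. F a x)"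
  by (induction A rule: finite_ne_induct) (auto intro: expressible_max)

lemma expressible_opt_cost:
  assumes "1 \<le> P"
  shows "expressible K (\<lambda>x. opt_cost P g L B conn (\<lambda>h. \<Sum>k<K. h (Os ! k) * x k))"
  unfolding opt_cost_def
  by (intro expressible_add expressible_mult expressible_sum expressible_Max expressible_max expressible_coordinate)
    (use assms in auto)

text \<open>Makes the cost of a word a function of its Parikh vector.\<close>

lemma sum_count_list:
  fixes h :: "nat \<Rightarrow> nat"
  assumes "set ks \<subseteq> {..<K}"
  shows "(\<Sum>k<K. h k * count_list ks k) = sum_list (map h ks)"
  using assms
proof (induction ks)
  case (Cons a ks)
  have "(\<Sum>k<K. h k * count_list (a # ks) k) = (\<Sum>k<K. h k * count_list ks k + (if k = a then h k else 0))"
    by (rule sum.cong) auto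
  then show ?case using Cons by (simp add: sum.distrib)
qed simp

section \<open>Writing the schedule\<close>

definition emit_send :: "nat \<times> nat \<times> nat \<Rightarrow> com" where
  "emit_send = (\<lambda>(q, p, r).
     Seq (Assign ''cnode'' (var ''k'') (Cell ''ord'' (Minus (var ''i'') (Const 1))))
    (Seq (Assign ''cfrom'' (var ''k'') (Const q))
    (Seq (Assign ''cto'' (var ''k'') (Const p))
    (Seq (Assign ''cstep'' (var ''k'') (Const r)) (incr ''k'')))))"

definition emit_place :: "(nat \<times> nat) option \<Rightarrow> com" where
  "emit_place pl = (case pl of None \<Rightarrow> Skip | Some (p, s) \<Rightarrow>
     Seq (Assign ''proc'' (Cell ''ord'' (var ''i'')) (Const p)) (Assign ''step'' (Cell ''ord'' (var ''i'')) (Const s)))"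

definition emit :: "bool \<Rightarrow> opt \<Rightarrow> com" where
  "emit conn o' = Seq (set_var ''S'' (Plus (var ''S'') (Const (head_steps o'))))
     (Seq (emit_place (place conn o')) (seqs (map emit_send (sends o'))))"

definition dispatch :: "aexp \<Rightarrow> (nat \<Rightarrow> com) \<Rightarrow> nat \<Rightarrow> com" where
  "dispatch e c n = seqs (map (\<lambda>k. If (Equal e (Const k)) (c k) Skip) [0..<n])"

definition emit_body :: "bool \<Rightarrow> opt list \<Rightarrow> com" where
  "emit_body conn Os = Seq (dispatch (Cell ''w'' (var ''i'')) (\<lambda>k. emit conn (Os ! k)) (length Os)) (incr ''i'')"

definition emit_all :: "bool \<Rightarrow> opt list \<Rightarrow> com" where
  "emit_all conn Os = Seq (set_var ''i'' (Const 0)) (While (Less (var ''i'') (var ''M'')) (emit_body conn Os))"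

text \<open>No branch changes the tested value, so at most one of the successive tests
  succeeds.\<close>

lemma run_dispatch:
  assumes "\<And>k. aval e (run (c k) \<sigma>) = aval e \<sigma>"
  shows "run (dispatch e c n) \<sigma> = (if aval e \<sigma> < n then run (c (aval e \<sigma>)) \<sigma> else \<sigma>)"
  unfolding dispatch_def using assms by (induction n) (auto simp: less_Suc_eq)

definition listed :: "state \<Rightarrow> (nat \<times> nat \<times> nat \<times> nat) list" where
  "listed \<sigma> = map (\<lambda>j. (\<sigma> ''cnode'' j, \<sigma> ''cfrom'' j, \<sigma> ''cto'' j, \<sigma> ''cstep'' j)) [0..<\<sigma> ''k'' 0]"

lemma run_emit_send:
  "agree_off {''cnode'', ''cfrom'', ''cto'', ''cstep'', ''k''} \<sigma> (run (emit_send x) \<sigma>) \<and>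
   listed (run (emit_send x) \<sigma>) = listed \<sigma> @ [(\<sigma> ''ord'' (\<sigma> ''i'' 0 - 1), x)]"
  by (cases x) (auto simp: emit_send_def agree_off_def listed_def)

lemma run_emit_sends:
  "agree_off {''cnode'', ''cfrom'', ''cto'', ''cstep'', ''k''} \<sigma> (run (seqs (map emit_send l)) \<sigma>) \<and>
   listed (run (seqs (map emit_send l)) \<sigma>) = listed \<sigma> @ map (Pair (\<sigma> ''ord'' (\<sigma> ''i'' 0 - 1))) l"
proof (induction l arbitrary: \<sigma>)
  case (Cons x l)
  let ?s = "run (emit_send x) \<sigma>"
  have 1: "agree_off {''cnode'', ''cfrom'', ''cto'', ''cstep'', ''k''} \<sigma> ?s"
    "listed ?s = listed \<sigma> @ [(\<sigma> ''ord'' (\<sigma> ''i'' 0 - 1), x)]"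
    using run_emit_send by blast+
  have 2: "?s ''ord'' = \<sigma> ''ord''" "?s ''i'' = \<sigma> ''i''" using 1(1) by (simp_all add: agree_off_def)
  have 3: "agree_off {''cnode'', ''cfrom'', ''cto'', ''cstep'', ''k''} ?s (run (seqs (map emit_send l)) ?s)"
    "listed (run (seqs (map emit_send l)) ?s) = listed ?s @ map (Pair (?s ''ord'' (?s ''i'' 0 - 1))) l"
    using Cons.IH[of ?s] by blast+
  have "agree_off {''cnode'', ''cfrom'', ''cto'', ''cstep'', ''k''} \<sigma> (run (seqs (map emit_send l)) ?s)"
    using 1(1) 3(1) by (rule agree_off_trans) simp
  then show ?case using 3(2) 1(2) 2 by simp
qed simp

definition emit_vars :: "vname set" where
  "emit_vars = {''S'', ''proc'', ''step'', ''cnode'', ''cfrom'', ''cto'', ''cstep'', ''k''}"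

lemma run_emit:
  fixes \<sigma> :: state and conn :: bool and o' :: opt
  defines "\<sigma>' \<equiv> run (emit conn o') \<sigma>"
  shows "agree_off emit_vars \<sigma> \<sigma>'"
    "listed \<sigma>' = listed \<sigma> @ map (Pair (\<sigma> ''ord'' (\<sigma> ''i'' 0 - 1))) (sends o')"
    "\<sigma>' ''S'' 0 = \<sigma> ''S'' 0 + head_steps o'"
    "\<sigma>' ''proc'' = (case place conn o' of None \<Rightarrow> \<sigma> ''proc'' | Some (p, s) \<Rightarrow> (\<sigma> ''proc'')(\<sigma> ''ord'' (\<sigma> ''i'' 0) := p))"
    "\<sigma>' ''step'' = (case place conn o' of None \<Rightarrow> \<sigma> ''step'' | Some (p, s) \<Rightarrow> (\<sigma> ''step'')(\<sigma> ''ord'' (\<sigma> ''i'' 0) := s))"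
proof -
  define \<sigma>1 where "\<sigma>1 = run (Seq (set_var ''S'' (Plus (var ''S'') (Const (head_steps o')))) (emit_place (place conn o'))) \<sigma>"
  have 1: "agree_off {''S'', ''proc'', ''step''} \<sigma> \<sigma>1" "listed \<sigma>1 = listed \<sigma>"
    "\<sigma>1 ''S'' 0 = \<sigma> ''S'' 0 + head_steps o'"
    "\<sigma>1 ''proc'' = (case place conn o' of None \<Rightarrow> \<sigma> ''proc'' | Some (p, s) \<Rightarrow> (\<sigma> ''proc'')(\<sigma> ''ord'' (\<sigma> ''i'' 0) := p))"
    "\<sigma>1 ''step'' = (case place conn o' of None \<Rightarrow> \<sigma> ''step'' | Some (p, s) \<Rightarrow> (\<sigma> ''step'')(\<sigma> ''ord'' (\<sigma> ''i'' 0) := s))"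
    by (auto simp: \<sigma>1_def emit_place_def agree_off_def listed_def split: option.splits)
  have \<sigma>': "\<sigma>' = run (seqs (map emit_send (sends o'))) \<sigma>1" by (simp add: \<sigma>'_def emit_def \<sigma>1_def)
  have 2: "agree_off {''cnode'', ''cfrom'', ''cto'', ''cstep'', ''k''} \<sigma>1 \<sigma>'"
    "listed \<sigma>' = listed \<sigma>1 @ map (Pair (\<sigma>1 ''ord'' (\<sigma>1 ''i'' 0 - 1))) (sends o')"
    using run_emit_sends[of \<sigma>1 "sends o'"] unfolding \<sigma>' by blast+
  have 3: "\<sigma>1 ''ord'' = \<sigma> ''ord''" "\<sigma>1 ''i'' = \<sigma> ''i''" using 1(1) by (simp_all add: agree_off_def)
  have 4: "\<sigma>' ''S'' = \<sigma>1 ''S''" "\<sigma>' ''proc'' = \<sigma>1 ''proc''" "\<sigma>' ''step'' = \<sigma>1 ''step''"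
    using 2(1) by (simp_all add: agree_off_def)
  show "agree_off emit_vars \<sigma> \<sigma>'" using 1(1) 2(1) by (rule agree_off_trans) (auto simp: emit_vars_def)
  show "listed \<sigma>' = listed \<sigma> @ map (Pair (\<sigma> ''ord'' (\<sigma> ''i'' 0 - 1))) (sends o')" using 1(2) 2(2) 3 by simp
  show "\<sigma>' ''S'' 0 = \<sigma> ''S'' 0 + head_steps o'" using 1(3) 4 by simp
  show "\<sigma>' ''proc'' = (case place conn o' of None \<Rightarrow> \<sigma> ''proc'' | Some (p, s) \<Rightarrow> (\<sigma> ''proc'')(\<sigma> ''ord'' (\<sigma> ''i'' 0) := p))"
    using 1(4) 4(2) by simp
  show "\<sigma>' ''step'' = (case place conn o' of None \<Rightarrow> \<sigma> ''step'' | Some (p, s) \<Rightarrow> (\<sigma> ''step'')(\<sigma> ''ord'' (\<sigma> ''i'' 0) := s))"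
    using 1(5) 4(3) by simp
qed

lemma loop_free_emit [simp]: "loop_free (emit conn o')"
  by (auto simp: emit_def emit_place_def emit_send_def split: option.splits)

lemma loop_free_emit_body [simp]: "loop_free (emit_body conn Os)"
  by (auto simp: emit_body_def dispatch_def)

definition emit_time :: "bool \<Rightarrow> opt list \<Rightarrow> nat \<Rightarrow> nat" where
  "emit_time conn Os N = max_time (set_var ''i'' (Const 0)) + loop_time N (Less (var ''i'') (var ''M'')) (emit_body conn Os)"

text \<open>The condition \<open>inj\<close> ensures that no later write overwrites the place of an
  earlier item. It speaks of placed items because, without a source, cell 0 of
  \<open>''ord''\<close> is a filler that may coincide with a node.\<close>

lemma trip_emit_all:
  assumes init: "\<sigma> ''S'' 0 = 0" "\<sigma> ''k'' 0 = 0" and M: "\<sigma> ''M'' 0 = length ops" and N: "length ops \<le> N"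
    and w: "\<And>i. i < length ops \<Longrightarrow> \<sigma> ''w'' i < length Os \<and> Os ! \<sigma> ''w'' i = ops ! i"
    and inj: "\<And>i j. i < j \<Longrightarrow> j < length ops \<Longrightarrow> place conn (ops ! i) \<noteq> None \<Longrightarrow> \<sigma> ''ord'' i \<noteq> \<sigma> ''ord'' j"
  shows "trip (emit_all conn Os) \<sigma> (emit_time conn Os N) (\<lambda>\<sigma>'.
    \<sigma>' ''S'' 0 = word_sum ops head_steps \<and> listed \<sigma>' = transmissions (\<sigma> ''ord'') ops \<and>
    (\<forall>i<length ops. \<forall>p s. place conn (ops ! i) = Some (p, s) \<longrightarrow>
       \<sigma>' ''proc'' (\<sigma> ''ord'' i) = p \<and> \<sigma>' ''step'' (\<sigma> ''ord'' i) = s))" (is "trip _ _ _ ?Q")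
proof -
  let ?b = "Less (var ''i'') (var ''M'')"
  let ?tr = "\<lambda>i. map (Pair (\<sigma> ''ord'' (i - 1))) (sends (ops ! i))"
  let ?I = "\<lambda>\<sigma>'. agree_off (insert ''i'' emit_vars) \<sigma> \<sigma>' \<and> \<sigma>' ''i'' 0 \<le> length ops \<and>
    \<sigma>' ''S'' 0 = (\<Sum>i<\<sigma>' ''i'' 0. head_steps (ops ! i)) \<and> listed \<sigma>' = concat (map ?tr [0..<\<sigma>' ''i'' 0]) \<and>
    (\<forall>i<\<sigma>' ''i'' 0. \<forall>p s. place conn (ops ! i) = Some (p, s) \<longrightarrow>
       \<sigma>' ''proc'' (\<sigma> ''ord'' i) = p \<and> \<sigma>' ''step'' (\<sigma> ''ord'' i) = s)"
  show ?thesis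
    unfolding emit_all_def emit_time_def
  proof (rule trip_Seq[where Q = ?I, OF trip_run])
    show "?I (run (set_var ''i'' (Const 0)) \<sigma>)" using init by (simp add: agree_off_def listed_def)
    fix \<sigma>1 assume I1: "?I \<sigma>1"
    have "trip (While ?b (emit_body conn Os)) \<sigma>1 (loop_time N ?b (emit_body conn Os)) (\<lambda>\<sigma>'. ?I \<sigma>' \<and> \<not> bval ?b \<sigma>')"
    proof (rule trip_While_run[where \<mu> = "\<lambda>\<sigma>'. length ops - \<sigma>' ''i'' 0"])
      fix \<sigma>' assume I: "?I \<sigma>'" and b: "bval ?b \<sigma>'"
      define i where "i = \<sigma>' ''i'' 0"
      have fr: "\<sigma>' ''M'' = \<sigma> ''M''" "\<sigma>' ''w'' = \<sigma> ''w''" "\<sigma>' ''ord'' = \<sigma> ''ord''"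
        using I[THEN conjunct1] by (simp_all add: agree_off_def emit_vars_def)
      have i: "i < length ops" using b fr M by (simp add: i_def)
      define s where "s = run (emit conn (ops ! i)) \<sigma>'"
      have "aval (Cell ''w'' (var ''i'')) (run (emit conn o') \<sigma>') = aval (Cell ''w'' (var ''i'')) \<sigma>'" for o'
        using run_emit(1)[where \<sigma> = \<sigma>' and conn = conn and o' = o'] by (simp add: agree_off_def emit_vars_def)
      then have r: "run (emit_body conn Os) \<sigma>' = run (incr ''i'') s"
        using w[OF i] fr(2) by (simp add: emit_body_def run_dispatch s_def i_def[symmetric])
      note e = run_emit[where \<sigma> = \<sigma>' and conn = conn and o' = "ops ! i", folded s_def, unfolded fr i_def[symmetric]]
      have si: "s ''i'' = \<sigma>' ''i''" using e(1) by (simp add: agree_off_def emit_vars_def)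
      have r_i: "run (incr ''i'') s ''i'' 0 = Suc i" using si by (simp add: i_def)
      have r_other: "run (incr ''i'') s x = s x" if "x \<noteq> ''i''" for x using that by simp
      have r_listed: "listed (run (incr ''i'') s) = listed s" by (simp add: listed_def)
      define s' where "s' = run (incr ''i'') s"
      have s': "s' ''i'' 0 = Suc i" "s' ''S'' = s ''S''" "s' ''proc'' = s ''proc''" "s' ''step'' = s ''step''" "listed s' = listed s"
        unfolding s'_def using r_i r_other r_listed by simp_all
      have "agree_off (insert ''i'' emit_vars) \<sigma> s'"
        using I[THEN conjunct1] e(1) by (simp add: agree_off_def s'_def)
      moreover have "s' ''i'' 0 \<le> length ops" using s' i by simp
      moreover have "s' ''S'' 0 = (\<Sum>i<s' ''i'' 0. head_steps (ops ! i))" using e(3) I s' by (simp add: i_def)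
      moreover have "listed s' = concat (map ?tr [0..<s' ''i'' 0])" using e(2) I s' by (simp add: i_def)
      moreover have "\<forall>j<s' ''i'' 0. \<forall>p t. place conn (ops ! j) = Some (p, t) \<longrightarrow>
         s' ''proc'' (\<sigma> ''ord'' j) = p \<and> s' ''step'' (\<sigma> ''ord'' j) = t"
        unfolding s'
      proof (intro allI impI)
        fix j p t assume j: "j < Suc i" "place conn (ops ! j) = Some (p, t)"
        show "s ''proc'' (\<sigma> ''ord'' j) = p \<and> s ''step'' (\<sigma> ''ord'' j) = t"
        proof (cases "j = i")
          case True
          then show ?thesis using e(4,5) j(2) by simp
        next
          case False
          then have "j < i" using j(1) by simp
          then have ne: "\<sigma> ''ord'' j \<noteq> \<sigma> ''ord'' i" using inj[of j i] i j(2) by simp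
          have "s ''proc'' (\<sigma> ''ord'' j) = \<sigma>' ''proc'' (\<sigma> ''ord'' j)" "s ''step'' (\<sigma> ''ord'' j) = \<sigma>' ''step'' (\<sigma> ''ord'' j)"
            unfolding e(4,5) using ne by (simp_all split: option.split)
          moreover have "\<sigma>' ''proc'' (\<sigma> ''ord'' j) = p \<and> \<sigma>' ''step'' (\<sigma> ''ord'' j) = t"
            using I \<open>j < i\<close> j(2) unfolding i_def by blast
          ultimately show ?thesis by simp
        qed
      qed
      ultimately have "?I s'" by (intro conjI)
      moreover have "length ops - Suc i < length ops - i" using i by simp
      ultimately show "?I (run (emit_body conn Os) \<sigma>') \<and>
          length ops - run (emit_body conn Os) \<sigma>' ''i'' 0 < length ops - \<sigma>' ''i'' 0"
        unfolding r r_i i_def[symmetric] s'_def by (elim conjE) (intro conjI; assumption)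
    qed (use I1 N in simp_all)
    then show "trip (While ?b (emit_body conn Os)) \<sigma>1 (loop_time N ?b (emit_body conn Os)) ?Q"
    proof (rule trip_weaken)
      fix \<sigma>' assume *: "?I \<sigma>' \<and> \<not> bval ?b \<sigma>'"
      then have "\<sigma>' ''M'' = \<sigma> ''M''" by (simp add: agree_off_def emit_vars_def)
      then have end_i: "\<sigma>' ''i'' 0 = length ops" using * M by simp
      have "transmissions (\<sigma> ''ord'') ops = concat (map ?tr [0..<length ops])"
        unfolding transmissions_def by (intro arg_cong[where f = concat] map_cong) auto
      then show "?Q \<sigma>'" using * unfolding end_i word_sum_conv by (elim conjE) (intro conjI; simp only:)
    qed simp
  qed simp
qed

section \<open>The finite alphabet and its transitions\<close>

definition usable_opts :: "nat \<Rightarrow> nat \<Rightarrow> bool \<Rightarrow> opt set" where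
  "usable_opts P B conn = Head ` {h. valid_head P B conn h} \<union>
     (\<lambda>(h, p, s, c). Place h p s c) `
       ({h. valid_head P B conn h} \<times> {..P} \<times> {..B} \<times> insert None (Some ` ({..P} \<times> {..B})))"

lemma finite_usable_opts: "finite (usable_opts P B conn)"
proof -
  let ?R = "{rs. set rs \<subseteq> {..P} \<times> {..B} \<and> length rs \<le> P}"
  have "h \<in> {..B} \<times> {..P} \<times> {..B} \<times> ?R" if h: "valid_head P B conn h" for h
  proof (cases h)
    case (fields S p0 t0 rs)
    have sub: "set rs \<subseteq> {..P} \<times> {..B}" if "set rs \<subseteq> {1..P} \<times> {t0..S}" "S \<le> B"
      using that by fastforce
    show ?thesis
    proof (cases conn)
      case True
      then show ?thesis using h fields sub by (auto simp: valid_head_def)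
    next
      case False
      then show ?thesis using h fields by (simp add: valid_head_def)
    qed
  qed
  then have "{h. valid_head P B conn h} \<subseteq> {..B} \<times> {..P} \<times> {..B} \<times> ?R" by blast
  moreover have "finite ({..B} \<times> {..P} \<times> {..B} \<times> ?R)"
    by (intro finite_cartesian_product finite_lists_length_le finite_atMost)
  ultimately have "finite {h. valid_head P B conn h}" by (rule finite_subset)
  then show ?thesis unfolding usable_opts_def by (intro finite_UnI finite_imageI finite_cartesian_product) auto
qed

lemma word_ok_usable_opts:
  assumes ok: "word_ok P B conn (flags st) ops" and len: "length ops = Suc m"
  shows "set ops \<subseteq> usable_opts P B conn"
proof -
  obtain h where h: "ops ! 0 = Head h" "valid_head P B conn h"
    and nodes: "\<And>i. i < m \<Longrightarrow> \<exists>p s c. ops ! Suc i = Place h p s c \<and> p \<in> {1..P} \<and> s \<in> {1..fst h} \<and>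
       (if st i then c = None \<and> (conn \<longrightarrow> start_ok h p s)
        else \<exists>q t c'. ops ! i = Place h q t c' \<and> continue_ok q t p s c)"
    using word_ok_cases[OF ok len] by blast
  have B: "fst h \<le> B" using h(2) by (cases h) (simp add: valid_head_def)
  have "ops ! k \<in> usable_opts P B conn" if k: "k < Suc m" for k
  proof (cases k)
    case 0
    then show ?thesis using h by (simp add: usable_opts_def)
  next
    case (Suc i)
    then have i: "i < m" using k by simp
    obtain p s c where o': "ops ! Suc i = Place h p s c" "p \<in> {1..P}" "s \<in> {1..fst h}"
       "if st i then c = None \<and> (conn \<longrightarrow> start_ok h p s)
        else \<exists>q t c'. ops ! i = Place h q t c' \<and> continue_ok q t p s c"
      using nodes[OF i] by blast
    have "c \<in> insert None (Some ` ({..P} \<times> {..B}))"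
    proof (cases c)
      case (Some x)
      then have "\<not> st i" using o'(4) by (auto split: if_splits)
      then obtain q t c' where q: "ops ! i = Place h q t c'" "continue_ok q t p s c" using o'(4) by auto
      \<comment> \<open>A letter that receives something follows a \<open>Place\<close>, so its
        sender is the processor of a node and lies in range.\<close>
      then obtain j where j: "i = Suc j" using h(1) by (cases i) auto
      have "q \<in> {1..P}" using nodes[of j] i q(1) j by auto
      moreover obtain r where "c = Some (q, r)" "r < s" using q(2) Some by (auto simp: continue_ok_def)
      ultimately show ?thesis using o'(3) B by auto
    qed simp
    then have "(h, p, s, c) \<in> {h. valid_head P B conn h} \<times> {..P} \<times> {..B} \<times> insert None (Some ` ({..P} \<times> {..B}))"
      using h(2) o'(2,3) B by simp
    from imageI[OF this, of "\<lambda>(h, p, s, c). Place h p s c"] show ?thesis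
      using o'(1) Suc by (simp only: usable_opts_def) simp
  qed
  then show ?thesis using len by (auto simp: in_set_conv_nth)
qed

text \<open>Letters are indices into \<open>Os\<close>. The index \<open>length Os\<close> marks the
  missing predecessor of the first letter and corresponds to \<open>None\<close>.\<close>

lemma accepted_iff_word_ok:
  assumes trs: "set trs = {(k, f, k'). k \<le> length Os \<and> f \<le> 2 \<and> k' < length Os \<and>
      next_ok P B conn f (if k = length Os then None else Some (Os ! k)) (Os ! k')}"
    and fs: "\<And>i. i < length ks \<Longrightarrow> fs i = flags st i"
  shows "accepted (length Os) trs fs ks \<longleftrightarrow> set ks \<subseteq> {..<length Os} \<and> word_ok P B conn (flags st) (map ((!) Os) ks)"
    (is "?A \<longleftrightarrow> ?B")
proof -
  have f2: "flags st i \<le> 2" for i by (simp add: flags_def)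
  have letter: "((length Os # ks) ! i, fs i, ks ! i) \<in> set trs \<longleftrightarrow> ks ! i < length Os \<and>
      next_ok P B conn (flags st i) (if i = 0 then None else Some (map ((!) Os) ks ! (i - 1))) (map ((!) Os) ks ! i)"
    if "i < length ks" "set ks \<subseteq> {..<length Os}" for i
  proof (cases i)
    case 0
    then show ?thesis using that fs f2 unfolding trs by simp
  next
    case (Suc j)
    then have "ks ! j \<in> set ks" using that(1) by simp
    then have "ks ! j < length Os" using that(2) by blast
    then show ?thesis using that fs f2 Suc unfolding trs by simp
  qed
  show ?thesis
  proof
    assume A: ?A
    have sub: "set ks \<subseteq> {..<length Os}"
    proof
      fix k assume "k \<in> set ks"
      then obtain i where "i < length ks" "ks ! i = k" by (auto simp: in_set_conv_nth)
      then have "((length Os # ks) ! i, fs i, k) \<in> set trs" using A by (auto simp: accepted_def)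
      then show "k \<in> {..<length Os}" unfolding trs by simp
    qed
    then show ?B using A letter by (simp add: accepted_def word_ok_def)
  next
    assume B: ?B
    have "ks ! i < length Os" if "i < length ks" for i using B that nth_mem by blast
    then show ?A using B letter by (simp add: accepted_def word_ok_def)
  qed
qed

text \<open>The wrap-around rule with one slot per listed node, for which both conditions are
  trivial. It provides the accepted word that the search requires.\<close>

lemma valid_schedule_exists:
  assumes "1 \<le> P" "layout conn v0 xs st V E"
  shows "\<exists>X. valid_schedule P V E X"
proof -
  have "length xs \<le> P * length xs" using assms(1) by simp
  then show ?thesis using wrap_around_schedule[OF assms, of "length xs" 0 0] by fastforce
qed

lemma transmissions_cong:
  assumes "\<And>i. i < length ops \<Longrightarrow> nd i = nd' i"
  shows "transmissions nd ops = transmissions nd' ops"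
  unfolding transmissions_def
proof (rule arg_cong[where f = concat], rule map_cong[OF refl])
  fix i assume "i \<in> set [0..<length ops]"
  then have "nd (i - 1) = nd' (i - 1)" using assms[of "i - 1"] by auto
  then show "map (\<lambda>(q, p, r). (nd (i - 1), q, p, r)) (sends (ops ! i)) = map (\<lambda>(q, p, r). (nd' (i - 1), q, p, r)) (sends (ops ! i))"
    by simp
qed

lemma solvable_if_chains_below:
  assumes P: "1 \<le> P"
    and dags: "\<And>V E. \<C> V E \<Longrightarrow> \<exists>v0. chains_below V E (if conn then Suc v0 else 0)"
  shows "bsp_poly_time_solvable P g L \<C>"
proof -
  define B where "B = 2 * P + 1"
  \<comment> \<open>Options, transitions and cost expression depend on \<open>P\<close>,
    \<open>g\<close>, \<open>L\<close> and \<open>conn\<close> only, so the program may contain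
    them.\<close>
  obtain Os where Os: "set Os = usable_opts P B conn" using finite_list[OF finite_usable_opts] by blast
  define K where "K = length Os"
  let ?T = "{(k, f, k'). k \<le> length Os \<and> f \<le> 2 \<and> k' < length Os \<and>
      next_ok P B conn f (if k = length Os then None else Some (Os ! k)) (Os ! k')}"
  have "finite ?T" by (rule finite_subset[of _ "{..length Os} \<times> {..2} \<times> {..<length Os}"]) auto
  then obtain trs where trs: "set trs = ?T" using finite_list by blast
  define F where "F x = opt_cost P g L B conn (\<lambda>h. \<Sum>k<K. h (Os ! k) * x k)" for x :: "nat \<Rightarrow> nat"
  obtain ce where ce: "\<And>\<sigma>. aval ce \<sigma> = F (\<lambda>i. \<sigma> ''T'' (\<sigma> ''a'' 0 * (K + 3) + i))"
    using expressible_opt_cost[OF P, of K g L B conn Os] unfolding expressible_def F_def by blast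
  have ps: "parikh_search K trs ce F"
  proof
    show "k' < K" if "(k, f, k') \<in> set trs" for k f k' using that by (simp add: trs K_def)
    show "F x = F y" if "\<And>i. i < K \<Longrightarrow> x i = y i" for x y
    proof -
      have "(\<Sum>k<K. h (Os ! k) * x k) = (\<Sum>k<K. h (Os ! k) * y k)" for h using that by (intro sum.cong) auto
      then show ?thesis by (simp add: F_def)
    qed
  qed (rule ce)
  interpret parikh_search K trs ce F by (rule ps)
  have F_word: "F (count_list ks) = opt_cost P g L B conn (word_sum (map ((!) Os) ks))" if "set ks \<subseteq> {..<K}" for ks
    unfolding F_def word_sum_def sum_count_list[OF that] by (simp add: comp_def)
  \<comment> \<open>A word has at most \<open>n + 1\<close> letters, the head and one for each
    listed node; this instantiates the bound on the number of records.\<close>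
  define N where "N n = (n + 1 + K + 1) ^ (K + 1)" for n
  define time where "time n = preprocess_time n + (bfs_time (N n) + (pick_time (N n) + trace_time (n + 1)) +
      emit_time conn Os (n + 1))" for n
  have poly: "poly_bounded time"
    unfolding time_def N_def preprocess_time_def bfs_time_def pick_time_def trace_time_def emit_time_def
      expand_time_def add_time_def scan_time_def
    by (intro poly_bounded_add poly_bounded_mult poly_bounded_power poly_bounded_id poly_bounded_const)
  then obtain q :: "nat poly" where q: "\<And>n. time n \<le> poly q n" by (auto simp: poly_bounded_def)
  let ?prog = "Seq (preprocess conn) (Seq search (emit_all conn Os))"
  have main: "trip ?prog (input_state vs es) (time (length vs))
      (\<lambda>\<sigma>. optimal_schedule P g L (set vs) (set es) (output_schedule \<sigma>))"
    if in': "distinct vs" "distinct es" "\<C> (set vs) (set es)" for vs es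
  proof -
    let ?\<sigma> = "input_state vs es" and ?V = "set vs" and ?E = "set es"
    obtain v00 where cb: "chains_below ?V ?E (if conn then Suc v00 else 0)" using dags[OF in'(3)] by blast
    show ?thesis
      unfolding time_def
    proof (rule trip_Seq[OF trip_preprocess[OF in'(1,2) cb]], elim conjE exE)
      fix \<sigma>1 :: state and xs st v0
      assume fr1: "agree_off preprocess_vars ?\<sigma> \<sigma>1" and lay: "layout conn v0 xs st ?V ?E"
        and M1: "\<sigma>1 ''M'' 0 = Suc (length xs)" and ord0: "\<sigma>1 ''ord'' 0 = v0" and f0: "\<sigma>1 ''f'' 0 = 0"
        and cells: "\<forall>i<length xs. \<sigma>1 ''ord'' (Suc i) = xs ! i \<and> \<sigma>1 ''f'' (Suc i) = (if st i then 1 else 2)"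
      have "set xs \<subseteq> ?V" "distinct xs" using lay by (auto simp: layout_def)
      then have len_xs: "length xs \<le> length vs"
        using card_mono[of ?V "set xs"] in'(1) by (simp add: distinct_card)
      have zero: "\<sigma>1 ''T'' = (\<lambda>_. 0)" "\<sigma>1 ''S'' 0 = 0" "\<sigma>1 ''k'' 0 = 0"
        using fr1 by (simp_all add: agree_off_def preprocess_vars_def input_state_cells)
      have fs: "\<sigma>1 ''f'' i = flags st i" if "i < Suc (length xs)" for i
        using that f0 cells by (cases i) (auto simp: flags_def)
      have ord: "\<sigma>1 ''ord'' i = item v0 xs i" if "i < Suc (length xs)" for i
        using that ord0 cells by (cases i) (auto simp: item_def)
      have acc: "accepted K trs (\<sigma>1 ''f'') ks \<longleftrightarrow> set ks \<subseteq> {..<K} \<and> word_ok P B conn (flags st) (map ((!) Os) ks)"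
        if "length ks = Suc (length xs)" for ks
        unfolding K_def using fs that by (intro accepted_iff_word_ok[OF trs]) simp
      \<comment> \<open>Every competitor, once brought within \<open>B\<close> supersteps, is
        matched by a word in the search space that costs no more.\<close>
      have encode: "\<exists>ks. accepted K trs (\<sigma>1 ''f'') ks \<and> length ks = \<sigma>1 ''M'' 0 \<and>
          F (count_list ks) \<le> total_cost P g L ?V Y" if Y: "valid_schedule P ?V ?E Y" for Y
      proof -
        obtain Y' where Y': "valid_schedule P ?V ?E Y'" "supersteps Y' \<le> B"
          "total_cost P g L ?V Y' \<le> total_cost P g L ?V Y"
          using few_supersteps_suffice[OF P lay Y] unfolding B_def by blast
        obtain ops where ops: "word_ok P B conn (flags st) ops" "length ops = Suc (length xs)"
          "opt_cost P g L B conn (word_sum ops) \<le> total_cost P g L ?V Y'"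
          using schedule_word[OF P lay Y'(1,2)] by blast
        have "\<forall>o'\<in>set ops. \<exists>k<K. Os ! k = o'"
          using word_ok_usable_opts[OF ops(1,2)] unfolding Os[symmetric] K_def by (auto simp: in_set_conv_nth subset_iff)
        \<comment> \<open>\<open>Os\<close> may list an option more than once; any of its indices
          will do.\<close>
        then obtain idx where idx: "\<forall>o'\<in>set ops. idx o' < K \<and> Os ! idx o' = o'" by metis
        have ks: "set (map idx ops) \<subseteq> {..<K}" "map ((!) Os) (map idx ops) = ops"
          using idx by (auto intro: map_idI)
        have "accepted K trs (\<sigma>1 ''f'') (map idx ops)" using acc[of "map idx ops"] ops(1,2) ks by simp
        moreover have "F (count_list (map idx ops)) \<le> total_cost P g L ?V Y"
          using F_word[OF ks(1)] ops(3) Y'(3) unfolding ks(2) by simp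
        ultimately show ?thesis using ops(2) M1 by (intro exI[of _ "map idx ops"]) simp
      qed
      obtain X0 where "valid_schedule P ?V ?E X0" using valid_schedule_exists[OF P lay] by blast
      then obtain ks0 where ks0: "accepted K trs (\<sigma>1 ''f'') ks0" "length ks0 = \<sigma>1 ''M'' 0" using encode by blast
      have N: "(\<sigma>1 ''M'' 0 + K + 1) ^ (K + 1) \<le> N (length vs)"
        unfolding N_def M1 using len_xs by (intro power_mono) auto
      note trip_search[OF zero(1) N ks0]
      then have "trip search \<sigma>1 (bfs_time (N (length vs)) + (pick_time (N (length vs)) + trace_time (length vs + 1)))
        (\<lambda>\<sigma>'. agree_off search_vars \<sigma>1 \<sigma>' \<and>
          (\<exists>ks. accepted K trs (\<sigma>1 ''f'') ks \<and> length ks = \<sigma>1 ''M'' 0 \<and> (\<forall>i<\<sigma>1 ''M'' 0. \<sigma>' ''w'' i = ks ! i) \<and>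
            (\<forall>ks'. accepted K trs (\<sigma>1 ''f'') ks' \<and> length ks' = \<sigma>1 ''M'' 0 \<longrightarrow> F (count_list ks) \<le> F (count_list ks'))))"
      proof (rule trip_weaken)
        have "trace_time (\<sigma>1 ''M'' 0) \<le> trace_time (length vs + 1)"
          unfolding trace_time_def by (intro add_mono mult_le_mono order_refl) (use M1 len_xs in simp)
        then show "bfs_time (N (length vs)) + (pick_time (N (length vs)) + trace_time (\<sigma>1 ''M'' 0)) \<le>
          bfs_time (N (length vs)) + (pick_time (N (length vs)) + trace_time (length vs + 1))" by simp
      qed
      then show "trip (Seq search (emit_all conn Os)) \<sigma>1
          (bfs_time (N (length vs)) + (pick_time (N (length vs)) + trace_time (length vs + 1)) + emit_time conn Os (length vs + 1))
          (\<lambda>\<sigma>. optimal_schedule P g L ?V ?E (output_schedule \<sigma>))"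
      proof (rule trip_Seq, elim conjE exE)
        fix \<sigma>2 :: state and ks
        assume fr2: "agree_off search_vars \<sigma>1 \<sigma>2" and ks: "accepted K trs (\<sigma>1 ''f'') ks" "length ks = \<sigma>1 ''M'' 0"
          and w: "\<forall>i<\<sigma>1 ''M'' 0. \<sigma>2 ''w'' i = ks ! i"
          and best: "\<forall>ks'. accepted K trs (\<sigma>1 ''f'') ks' \<and> length ks' = \<sigma>1 ''M'' 0 \<longrightarrow> F (count_list ks) \<le> F (count_list ks')"
        define ops where "ops = map ((!) Os) ks"
        have len: "length ops = Suc (length xs)" by (simp add: ops_def ks(2) M1)
        have ok: "set ks \<subseteq> {..<K}" "word_ok P B conn (flags st) ops"
          using acc[of ks] ks M1 by (simp_all add: ops_def)
        obtain h where h: "ops ! 0 = Head h" using word_ok_cases[OF ok(2) len] by blast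
        have same: "\<sigma>2 ''S'' 0 = 0" "\<sigma>2 ''k'' 0 = 0" "\<sigma>2 ''M'' 0 = length ops" "\<sigma>2 ''ord'' = \<sigma>1 ''ord''"
          using fr2 zero M1 len by (simp_all add: agree_off_def search_vars_def)
        have emit: "trip (emit_all conn Os) \<sigma>2 (emit_time conn Os (length vs + 1)) (\<lambda>\<sigma>'.
          \<sigma>' ''S'' 0 = word_sum ops head_steps \<and> listed \<sigma>' = transmissions (\<sigma>2 ''ord'') ops \<and>
          (\<forall>i<length ops. \<forall>p s. place conn (ops ! i) = Some (p, s) \<longrightarrow>
            \<sigma>' ''proc'' (\<sigma>2 ''ord'' i) = p \<and> \<sigma>' ''step'' (\<sigma>2 ''ord'' i) = s))"
        proof (rule trip_emit_all[where \<sigma> = \<sigma>2 and ops = ops, OF same(1-3)])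
          show "length ops \<le> length vs + 1" using len len_xs by simp
          show "\<sigma>2 ''w'' i < length Os \<and> Os ! \<sigma>2 ''w'' i = ops ! i" if i: "i < length ops" for i
          proof -
            have "i < length ks" using i by (simp add: ops_def)
            then have "ks ! i \<in> {..<K}" using ok(1) nth_mem by blast
            moreover have "\<sigma>2 ''w'' i = ks ! i" using w ks(2) \<open>i < length ks\<close> by simp
            ultimately show ?thesis using \<open>i < length ks\<close> by (simp add: ops_def K_def)
          qed
          show "\<sigma>2 ''ord'' i \<noteq> \<sigma>2 ''ord'' j"
            if ij: "i < j" "j < length ops" "place conn (ops ! i) \<noteq> None" for i j
          proof -
            have o': "\<sigma>2 ''ord'' i = item v0 xs i" "\<sigma>2 ''ord'' j = item v0 xs j"
              using ij len by (auto simp: same(4) ord)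
            show ?thesis
            proof (cases conn)
              case True
              then have "distinct (v0 # xs)" using lay by (simp add: layout_def)
              then show ?thesis using ij len nth_eq_iff_index_eq[of "v0 # xs" i j] by (simp add: o' item_def)
            next
              case False
              then have "place conn (ops ! 0) = None" using h by (cases h) simp
              then have "i \<noteq> 0" using ij(3) by metis
              then obtain i' j' where "i = Suc i'" "j = Suc j'" using ij(1) by (cases i; cases j) auto
              then show ?thesis using ij(1,2) len \<open>distinct xs\<close> unfolding o' by (simp add: item_def nth_eq_iff_index_eq)
            qed
          qed
        qed
        then show "trip (emit_all conn Os) \<sigma>2 (emit_time conn Os (length vs + 1))
          (\<lambda>\<sigma>. optimal_schedule P g L ?V ?E (output_schedule \<sigma>))"
        proof (rule trip_weaken[OF _ order_refl], elim conjE)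
          fix \<sigma>3 :: state
          assume S3: "\<sigma>3 ''S'' 0 = word_sum ops head_steps" and l3: "listed \<sigma>3 = transmissions (\<sigma>2 ''ord'') ops"
            and p3: "\<forall>i<length ops. \<forall>p s. place conn (ops ! i) = Some (p, s) \<longrightarrow>
              \<sigma>3 ''proc'' (\<sigma>2 ''ord'' i) = p \<and> \<sigma>3 ''step'' (\<sigma>2 ''ord'' i) = s"
          let ?X = "output_schedule \<sigma>3"
          have tr: "transmissions (\<sigma>2 ''ord'') ops = transmissions (item v0 xs) ops"
            by (rule transmissions_cong) (simp add: same(4) ord len)
          have SX: "supersteps ?X = word_sum ops head_steps" by (simp add: output_schedule_def S3)
          have pX: "proc ?X (item v0 xs i) = p \<and> step ?X (item v0 xs i) = s"
            if "i < length ops" "place conn (ops ! i) = Some (p, s)" for i p s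
          proof -
            have "\<sigma>3 ''proc'' (\<sigma>2 ''ord'' i) = p \<and> \<sigma>3 ''step'' (\<sigma>2 ''ord'' i) = s" using p3 that by blast
            then show ?thesis using ord[of i] that(1) len by (simp add: output_schedule_def same(4))
          qed
          have "comm ?X = set (listed \<sigma>3)"
            by (simp add: output_schedule_def listed_def atLeast0LessThan)
          then have cX: "comm ?X = set (transmissions (item v0 xs) ops)" by (simp only: l3 tr)
          note X = word_schedule[OF P lay ok(2) len SX pX cX]
          show "optimal_schedule P g L ?V ?E ?X"
            unfolding optimal_schedule_def
          proof (intro conjI allI impI)
            show "valid_schedule P ?V ?E ?X" by (rule X(1))
            fix Y assume "valid_schedule P ?V ?E Y"
            then obtain ks' where ks': "accepted K trs (\<sigma>1 ''f'') ks'" "length ks' = \<sigma>1 ''M'' 0"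
              "F (count_list ks') \<le> total_cost P g L ?V Y" using encode by blast
            \<comment> \<open>The two translations meet here: decoding the cheapest word does not
              raise its cost, and neither does encoding the competitor \<open>Y\<close>.\<close>
            have "total_cost P g L ?V ?X \<le> F (count_list ks)"
              using X(2)[of g L] unfolding F_word[OF ok(1)] ops_def .
            also have "\<dots> \<le> F (count_list ks')" using best ks'(1,2) by blast
            also have "\<dots> \<le> total_cost P g L ?V Y" by (rule ks'(3))
            finally show "total_cost P g L ?V ?X \<le> total_cost P g L ?V Y" .
          qed
        qed
      qed
    qed
  qed
  show ?thesis
    unfolding bsp_poly_time_solvable_def
  proof (intro exI[of _ ?prog] exI[of _ q] allI impI, elim conjE)
    fix vs es assume "distinct vs" "distinct es" "\<C> (set vs) (set es)"
    from main[OF this] show "\<exists>t \<sigma>. exec ?prog (input_state vs es) t \<sigma> \<and> t \<le> poly q (length vs) \<and>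
        optimal_schedule P g L (set vs) (set es) (output_schedule \<sigma>)"
      unfolding trip_def using q order_trans by blast
  qed
qed

theorem theorem6p1:
  fixes P g L :: nat
  assumes "P \<ge> 1"
  shows "bsp_poly_time_solvable P g L chain_dag \<and>
         bsp_poly_time_solvable P g L connected_chain_dag"
proof
  show "bsp_poly_time_solvable P g L chain_dag"
    by (rule solvable_if_chains_below[OF assms, where conn = False]) (simp add: chain_dag_chains_below)
  show "bsp_poly_time_solvable P g L connected_chain_dag"
    by (rule solvable_if_chains_below[OF assms, where conn = True]) (auto elim: connected_chain_dag_chains_below)
qed

end
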